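(* Let $G$ and $H$ be Lie groups (possibly infinite-dimensional) with Lie algebras $\mathfrak g$ and $\mathfrak h$, each carrying the right invariant metric determined by a positive definite bounded inner product $\langle\,,\rangle$ on its Lie algebra. Let $B:G\times H\to H$ be a smooth action of $G$ on $H$ by group homomorphisms, with induced Lie algebra action $b:\mathfrak g\to\operatorname{Der}\mathfrak h$, and equip $G\ltimes H$ with the right invariant metric determined by $\langle(X_1,Y_1),(X_2,Y_2)\rangle=\langle X_1,X_2\rangle+\langle Y_1,Y_2\rangle$ on $\mathfrak g\ltimes\mathfrak h$. Suppose that the transposes $\operatorname{ad}(X)^\top$, $\operatorname{ad}(Y)^\top$ and $b(X)^\top$ exist for all $X\in\mathfrak g$, $Y\in\mathfrak h$, and that there exists a bilinear map $h:\mathfrak h\times\mathfrak h\to\mathfrak g$ with $\langle b(X)Y_1,Y_2\rangle=\langle h(Y_1,Y_2),X\rangle$ for all $X\in\mathfrak g$, $Y_1,Y_2\in\mathfrak h$. Let $\tilde{\mathcal R}$, $\mathcal R^G$, $\mathcal R^H$ be the Riemannian curvatures of $G\ltimes H$, $G$, $H$. Then for all $X_1,X_2\in\mathfrak g$ and $Y_1,Y_2\in\mathfrak h$, the sign of the sectional curvature of $G\ltimes H$ (on the plane spanned by $(X_1,Y_1)$ and $(X_2,Y_2)$, when these are linearly independent) is the sign of $$\begin{aligned} &\langle\tilde{\mathcal R}((X_1,Y_1),(X_2,Y_2))(X_2,Y_2),(X_1,Y_1)\rangle\\ &=\langle\mathcal R^G(X_1,X_2)X_2,X_1\rangle+\langle\mathcal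 R^H(Y_1,Y_2)Y_2,Y_1\rangle\\ &\quad+\tfrac14\Vert h(Y_1,Y_2)+h(Y_2,Y_1)\Vert^2-\langle h(Y_1,Y_1),h(Y_2,Y_2)\rangle\\ &\quad-\tfrac12\langle h(Y_1,Y_2)+h(Y_2,Y_1),\operatorname{ad}(X_1)^\top X_2+\operatorname{ad}(X_2)^\top X_1\rangle\\ &\quad+\langle h(Y_1,Y_1),\operatorname{ad}(X_2)^\top X_2\rangle+\langle h(Y_2,Y_2),\operatorname{ad}(X_1)^\top X_1\rangle\\ &\quad+\tfrac14\Vert b(X_1)^\top Y_2+b(X_2)^\top Y_1\Vert^2-\tfrac34\Vert b(X_1)Y_2-b(X_2)Y_1\Vert^2\\ &\quad-\langle b(X_1)^\top Y_1,b(X_2)^\top Y_2\rangle\\ &\quad-\tfrac12\langle b(X_1)^\top Y_1,b(X_2)Y_2\rangle-\tfrac12\langle b(X_2)^\top Y_2,b(X_1)Y_1\rangle\\ &\quad+\langle b(X_1)^\top Y_2,b(X_2)Y_1\rangle+\langle b(X_2)^\top Y_1,b(X_1)Y_2\rangle\\ &\quad-\tfrac12\langle b(X_1)^\top Y_2,b(X_1)Y_2\rangle-\tfrac12\langle b(X_2)^\top Y_1,b(X_2)Y_1\rangle\\ &\quad-\langle\operatorname{ad}(Y_1)^\top Y_1,b(X_2)^\top Y_2\rangle-\langle\operatorname{ad}(Y_2)^\top Y_2,b(X_1)^\top Y_1\rangle\\ &\quad+\tfrac12\langle\operatorname{ad}(Y_1)^\top Y_2,\;b(X_1)^\top Y_2+b(X_2)^\top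 Y_1-b(X_1)Y_2+b(X_2)Y_1\rangle\\ &\quad+\tfrac12\langle\operatorname{ad}(Y_2)^\top Y_1,\;b(X_1)^\top Y_2+b(X_2)^\top Y_1-b(X_2)Y_1+b(X_1)Y_2\rangle\\ &\quad-\tfrac12\langle\operatorname{ad}(Y_1)Y_2,\;b(X_1)^\top Y_2-b(X_2)^\top Y_1+3b(X_1)Y_2-3b(X_2)Y_1\rangle . \end{aligned}$$
   Context: Semidirect product: the group operation on $G\ltimes H$ is $(g_1,h_1)(g_2,h_2)=(g_1g_2,\,h_1B(g_1)h_2)$. With $\beta(g)=T_eB(g)\in\operatorname{Aut}\mathfrak h$, the map $b:\mathfrak g\to\operatorname{Der}\mathfrak h$ is the differential of $\beta$ at the identity, and the Lie algebra of $G\ltimes H$ is $\mathfrak g\ltimes\mathfrak h$ with bracket $[(X_1,Y_1),(X_2,Y_2)]=([X_1,X_2],[Y_1,Y_2]+b(X_1)Y_2-b(X_2)Y_1)$. Conventions: $\operatorname{ad}(X)Y=[X,Y]$ is the usual Lie algebra bracket (from left invariant vector fields). $T^\top$ denotes the adjoint of a linear operator $T$ with respect to the relevant inner product, i.e. $\langle T^\top a,c\rangle=\langle a,Tc\rangle$; $\Vert a\Vert^2=\langle a,a\rangle$. Curvature: for a Lie group $K$ with Lie algebra $\mathfrak k$ and right invariant metric determined by an inner product on $\mathfrak k$ for which all $\operatorname{ad}(X)^\top$ exist, identify $C^\infty(K,\mathfrak k)$ with vector fields on $K$ by $X\mapsto R_X$, $R_X(x)=T\rho_x.X(x)$ ($\rho_x$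 = right translation by $x$). The Levi-Civita covariant derivative is then $\nabla_XY=dY.R_X+\frac12\operatorname{ad}(X)^\top Y+\frac12\operatorname{ad}(Y)^\top X-\frac12\operatorname{ad}(X)Y$. The Riemannian curvature $\mathcal R$ (evaluated at the identity, on elements of $\mathfrak k$) has the sign convention $\mathcal R(U,V)=[\nabla_U,\nabla_V]-\nabla_{[U,V]}$ for vector fields $U,V$, so that the sectional curvature is $\mathcal K(X,Y)=\dfrac{\langle\mathcal R(X,Y)Y,X\rangle}{\langle X,X\rangle\langle Y,Y\rangle-\langle X,Y\rangle^2}$. *)

theory Defs
  imports "HOL-Analysis.Analysis" "HOL-Algebra.Bij"
begin

section \<open>Convenient vector spaces\<close>

text \<open>
  Infinite-dimensional Lie groups are understood in the convenient calculus of Froelicher, Kriegl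
  and Michor. A convenient vector space is the space of all elements of a real vector space type
  together with the set \<open>D\<close> of its bounded linear functionals. As smooth curves in a convenient
  vector space are exactly the scalarwise smooth ones, no topology has to be carried along.
\<close>

definition smooth_real_on :: "real set \<Rightarrow> (real \<Rightarrow> real) \<Rightarrow> bool" where
  \<comment> \<open>only used for open \<open>I\<close>\<close>
  "smooth_real_on I f \<longleftrightarrow> (\<forall>n. \<forall>t\<in>I. (deriv ^^ n) f differentiable (at t))"

definition smooth_curve_on :: "('e \<Rightarrow> real) set \<Rightarrow> real set \<Rightarrow> (real \<Rightarrow> 'e) \<Rightarrow> bool" where
  "smooth_curve_on D I c \<longleftrightarrow> (\<forall>l\<in>D. smooth_real_on I (\<lambda>t. l (c t)))"

definition has_velocity :: "('e \<Rightarrow> real) set \<Rightarrow> (real \<Rightarrow> 'e) \<Rightarrow> 'e \<Rightarrow> real \<Rightarrow> bool" where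
  "has_velocity D c v t \<longleftrightarrow> (\<forall>l\<in>D. ((\<lambda>s. l (c s)) has_real_derivative l v) (at t))"

definition velocity :: "('e \<Rightarrow> real) set \<Rightarrow> (real \<Rightarrow> 'e) \<Rightarrow> real \<Rightarrow> 'e" where
  "velocity D c t = (THE v. has_velocity D c v t)"

text \<open>
  The third condition is completeness: a scalarwise smooth curve is differentiable, hence
  (iterating) smooth. The last one says that \<open>D\<close> contains all bounded linear functionals, which
  are the linear functionals that are smooth along smooth curves. A Hausdorff locally convex space
  is convenient iff its set of bounded linear functionals satisfies these conditions (Kriegl and Michor,
  The Convenient Setting of Global Analysis, 2.11 and 2.14).
\<close>

definition convenient :: "('e::real_vector \<Rightarrow> real) set \<Rightarrow> bool" where
  "convenient D \<longleftrightarrow>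
     (\<forall>l\<in>D. linear l) \<and>
     (\<forall>x. (\<forall>l\<in>D. l x = 0) \<longrightarrow> x = 0) \<and>
     (\<forall>c. smooth_curve_on D UNIV c \<longrightarrow> (\<forall>t. \<exists>v. has_velocity D c v t)) \<and>
     (\<forall>l. linear l \<and> (\<forall>c. smooth_curve_on D UNIV c \<longrightarrow> smooth_real_on UNIV (\<lambda>t. l (c t)))
        \<longrightarrow> l \<in> D)"

definition bounded_set :: "('e \<Rightarrow> real) set \<Rightarrow> 'e set \<Rightarrow> bool" where
  "bounded_set D S \<longleftrightarrow> (\<forall>l\<in>D. bounded (l ` S))"

definition cinf_open :: "('e \<Rightarrow> real) set \<Rightarrow> 'e set \<Rightarrow> bool" where
  "cinf_open D U \<longleftrightarrow> (\<forall>c. smooth_curve_on D UNIV c \<longrightarrow> open (c -` U))"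

definition smooth_on_open ::
    "('e \<Rightarrow> real) set \<Rightarrow> 'e set \<Rightarrow> ('f \<Rightarrow> real) set \<Rightarrow> ('e \<Rightarrow> 'f) \<Rightarrow> bool" where
  "smooth_on_open D U D' f \<longleftrightarrow>
     (\<forall>c. smooth_curve_on D UNIV c \<and> range c \<subseteq> U \<longrightarrow> smooth_curve_on D' UNIV (\<lambda>t. f (c t)))"

definition prod_functionals ::
    "('e \<Rightarrow> real) set \<Rightarrow> ('f \<Rightarrow> real) set \<Rightarrow> ('e \<times> 'f \<Rightarrow> real) set" where
  "prod_functionals D D' = {\<lambda>(x, y). l x + k y |l k. l \<in> D \<and> k \<in> D'}"


section \<open>Manifolds\<close>

text \<open>A manifold is given by the functionals of the modelling space and an atlas.\<close>

type_synonym ('m, 'e) manifold = "('e \<Rightarrow> real) set \<times> ('m set \<times> ('m \<Rightarrow> 'e)) set"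

definition points :: "('m, 'e) manifold \<Rightarrow> 'm set" where
  "points M = (\<Union>(U, u)\<in>snd M. U)"

definition manifold_open :: "('m, 'e) manifold \<Rightarrow> 'm set \<Rightarrow> bool" where
  "manifold_open M W \<longleftrightarrow> W \<subseteq> points M \<and> (\<forall>(U, u)\<in>snd M. cinf_open (fst M) (u ` (W \<inter> U)))"

definition is_manifold :: "('m, 'e::real_vector) manifold \<Rightarrow> bool" where
  "is_manifold M \<longleftrightarrow>
     convenient (fst M) \<and>
     (\<forall>(U, u)\<in>snd M. inj_on u U \<and> cinf_open (fst M) (u ` U)) \<and>
     (\<forall>(U, u)\<in>snd M. \<forall>(V, v)\<in>snd M.
        cinf_open (fst M) (u ` (U \<inter> V)) \<and>
        smooth_on_open (fst M) (u ` (U \<inter> V)) (fst M) (\<lambda>x. v (inv_into U u x))) \<and>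
     (\<forall>x\<in>points M. \<forall>y\<in>points M. x \<noteq> y \<longrightarrow>
        (\<exists>V W. manifold_open M V \<and> manifold_open M W \<and> x \<in> V \<and> y \<in> W \<and> V \<inter> W = {}))"

definition smooth_curve_in :: "('m, 'e) manifold \<Rightarrow> (real \<Rightarrow> 'm) \<Rightarrow> bool" where
  "smooth_curve_in M c \<longleftrightarrow>
     (\<forall>t. \<exists>(U, u)\<in>snd M. \<exists>I. open I \<and> t \<in> I \<and> c ` I \<subseteq> U \<and>
        smooth_curve_on (fst M) I (\<lambda>s. u (c s)))"

definition smooth_map :: "('m, 'e) manifold \<Rightarrow> ('n, 'f) manifold \<Rightarrow> ('m \<Rightarrow> 'n) \<Rightarrow> bool" where
  "smooth_map M N f \<longleftrightarrow> (\<forall>c. smooth_curve_in M c \<longrightarrow> smooth_curve_in N (\<lambda>t. f (c t)))"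

definition prod_manifold ::
    "('m, 'e) manifold \<Rightarrow> ('n, 'f) manifold \<Rightarrow> ('m \<times> 'n, 'e \<times> 'f) manifold" where
  "prod_manifold M N =
     (prod_functionals (fst M) (fst N),
      {(U \<times> V, map_prod u v) |U u V v. (U, u) \<in> snd M \<and> (V, v) \<in> snd N})"


section \<open>Lie groups and their Lie algebras\<close>

text \<open>
  The chart \<open>id_chart\<close> around the identity is used to identify the tangent space at the identity
  with the modelling space, so that the Lie algebra lives on the type \<open>'e\<close>.
\<close>

record ('g, 'e) lie_data = "'g monoid" +
  manif :: "('g, 'e) manifold"
  id_chart :: "'g set \<times> ('g \<Rightarrow> 'e)"

definition lie_group :: "('g, 'e::real_vector) lie_data \<Rightarrow> bool" where
  "lie_group G \<longleftrightarrow>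
     group G \<and> is_manifold (manif G) \<and> points (manif G) = carrier G \<and>
     smooth_map (prod_manifold (manif G) (manif G)) (manif G) (\<lambda>(x, y). x \<otimes>\<^bsub>G\<^esub> y) \<and>
     smooth_map (manif G) (manif G) (\<lambda>x. inv\<^bsub>G\<^esub> x) \<and>
     id_chart G \<in> snd (manif G) \<and> \<one>\<^bsub>G\<^esub> \<in> fst (id_chart G)"

definition functionals :: "('g, 'e) lie_data \<Rightarrow> ('e \<Rightarrow> real) set" where
  "functionals G = fst (manif G)"

definition coord :: "('g, 'e) lie_data \<Rightarrow> 'g \<Rightarrow> 'e" where
  "coord G = snd (id_chart G)"

text \<open>
  \<open>param G x\<close> is the point with coordinate \<open>x\<close> when the identity has coordinate \<open>0\<close>. In particular
  \<open>t \<mapsto> param G (t *\<^sub>R X)\<close> is a curve through the identity with velocity \<open>X\<close>. It is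
  meaningful only for \<open>x\<close> near \<open>0\<close>, and below it is always used locally.
\<close>

definition param :: "('g, 'e::real_vector) lie_data \<Rightarrow> 'e \<Rightarrow> 'g" where
  "param G x = inv_into (fst (id_chart G)) (coord G) (coord G \<one>\<^bsub>G\<^esub> + x)"

text \<open>The Lie bracket at \<open>w\<close> of two vector fields on the modelling space:
  \<open>d\<eta>(w) \<xi>(w) - d\<xi>(w) \<eta>(w)\<close>.\<close>

definition vf_bracket ::
    "('e::real_vector \<Rightarrow> real) set \<Rightarrow> ('e \<Rightarrow> 'e) \<Rightarrow> ('e \<Rightarrow> 'e) \<Rightarrow> 'e \<Rightarrow> 'e" where
  "vf_bracket D \<xi> \<eta> w =
     velocity D (\<lambda>s. \<eta> (w + s *\<^sub>R \<xi> w)) 0 - velocity D (\<lambda>s. \<xi> (w + s *\<^sub>R \<eta> w)) 0"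

text \<open>The left invariant vector field generated by \<open>X\<close>, in the chart at the identity.\<close>

definition left_field :: "('g, 'e::real_vector) lie_data \<Rightarrow> 'e \<Rightarrow> 'e \<Rightarrow> 'e" where
  "left_field G X w =
     velocity (functionals G) (\<lambda>t. coord G (param G w \<otimes>\<^bsub>G\<^esub> param G (t *\<^sub>R X))) 0"

definition ad :: "('g, 'e::real_vector) lie_data \<Rightarrow> 'e \<Rightarrow> 'e \<Rightarrow> 'e" where
  "ad G X Y = vf_bracket (functionals G) (left_field G X) (left_field G Y) 0"


section \<open>Right invariant metrics and curvature\<close>

definition bounded_inner_product ::
    "('e::real_vector \<Rightarrow> real) set \<Rightarrow> ('e \<Rightarrow> 'e \<Rightarrow> real) \<Rightarrow> bool" where
  "bounded_inner_product D ip \<longleftrightarrow>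
     bilinear ip \<and> (\<forall>x y. ip x y = ip y x) \<and> (\<forall>x. x \<noteq> 0 \<longrightarrow> ip x x > 0) \<and>
     (\<forall>S T. bounded_set D S \<and> bounded_set D T \<longrightarrow> bounded ((\<lambda>(x, y). ip x y) ` (S \<times> T)))"

definition has_transpose :: "('e \<Rightarrow> 'e \<Rightarrow> real) \<Rightarrow> ('e \<Rightarrow> 'e) \<Rightarrow> bool" where
  "has_transpose ip T \<longleftrightarrow> (\<forall>a. \<exists>z. \<forall>c. ip z c = ip a (T c))"

definition metric_transpose :: "('e \<Rightarrow> 'e \<Rightarrow> real) \<Rightarrow> ('e \<Rightarrow> 'e) \<Rightarrow> 'e \<Rightarrow> 'e" where
  "metric_transpose ip T a = (THE z. \<forall>c. ip z c = ip a (T c))"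

text \<open>
  A function \<open>X :: 'g \<Rightarrow> 'e\<close> stands for the vector field \<open>R\<^sub>X(x) = T\<rho>\<^sub>x X(x)\<close>,
  whose value at \<open>x\<close> is the velocity of \<open>t \<mapsto> param G (t *\<^sub>R X x) \<otimes> x\<close>.
  Then \<open>directional G X Y\<close> is \<open>dY.R\<^sub>X\<close>.
\<close>

definition directional ::
    "('g, 'e::real_vector) lie_data \<Rightarrow> ('g \<Rightarrow> 'e) \<Rightarrow> ('g \<Rightarrow> 'e) \<Rightarrow> 'g \<Rightarrow> 'e" where
  "directional G X Y x =
     velocity (functionals G) (\<lambda>t. Y (param G (t *\<^sub>R X x) \<otimes>\<^bsub>G\<^esub> x)) 0"

text \<open>
  The vector field \<open>R\<^sub>X\<close> in the right translated chart \<open>y \<mapsto> coord G (y \<otimes> inv x)\<close> around \<open>x\<close>,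
  centred at \<open>0\<close>; the coordinate \<open>w\<close> belongs to the point \<open>y = param G w \<otimes> x\<close>. In this chart
  the tangent vector \<open>R\<^sub>Z(x)\<close> has the coordinate \<open>Z(x)\<close>. So \<open>field_bracket\<close> satisfies
  \<open>[R\<^sub>X, R\<^sub>Y] = R\<^sub>Z\<close> with \<open>Z = field_bracket G X Y\<close>.
\<close>

definition right_field ::
    "('g, 'e::real_vector) lie_data \<Rightarrow> ('g \<Rightarrow> 'e) \<Rightarrow> 'g \<Rightarrow> 'e \<Rightarrow> 'e" where
  "right_field G X x w =
     velocity (functionals G)
       (\<lambda>t. coord G (param G (t *\<^sub>R X (param G w \<otimes>\<^bsub>G\<^esub> x)) \<otimes>\<^bsub>G\<^esub> param G w)) 0"

definition field_bracket ::
    "('g, 'e::real_vector) lie_data \<Rightarrow> ('g \<Rightarrow> 'e) \<Rightarrow> ('g \<Rightarrow> 'e) \<Rightarrow> 'g \<Rightarrow> 'e" where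
  "field_bracket G X Y x = vf_bracket (functionals G) (right_field G X x) (right_field G Y x) 0"

text \<open>The Levi-Civita derivative of the right invariant metric determined by \<open>ip\<close>, in terms of
  the functions that stand for vector fields.\<close>

definition nabla ::
    "('g, 'e::real_vector) lie_data \<Rightarrow> ('e \<Rightarrow> 'e \<Rightarrow> real) \<Rightarrow> ('g \<Rightarrow> 'e) \<Rightarrow> ('g \<Rightarrow> 'e) \<Rightarrow> 'g \<Rightarrow> 'e" where
  "nabla G ip X Y x =
     directional G X Y x
     + (1/2) *\<^sub>R metric_transpose ip (ad G (X x)) (Y x)
     + (1/2) *\<^sub>R metric_transpose ip (ad G (Y x)) (X x)
     - (1/2) *\<^sub>R ad G (X x) (Y x)"

definition curvature_field ::
    "('g, 'e::real_vector) lie_data \<Rightarrow> ('e \<Rightarrow> 'e \<Rightarrow> real) \<Rightarrow>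
      ('g \<Rightarrow> 'e) \<Rightarrow> ('g \<Rightarrow> 'e) \<Rightarrow> ('g \<Rightarrow> 'e) \<Rightarrow> 'g \<Rightarrow> 'e" where
  "curvature_field G ip U V W x =
     nabla G ip U (nabla G ip V W) x - nabla G ip V (nabla G ip U W) x
     - nabla G ip (field_bracket G U V) W x"

text \<open>
  As the curvature is a tensor field, its value at the identity can be computed from any fields
  extending the arguments. The constant functions are the right invariant extensions.
\<close>

definition curvature ::
    "('g, 'e::real_vector) lie_data \<Rightarrow> ('e \<Rightarrow> 'e \<Rightarrow> real) \<Rightarrow> 'e \<Rightarrow> 'e \<Rightarrow> 'e \<Rightarrow> 'e" where
  "curvature G ip X Y Z = curvature_field G ip (\<lambda>_. X) (\<lambda>_. Y) (\<lambda>_. Z) \<one>\<^bsub>G\<^esub>"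

definition sectional_curvature ::
    "('g, 'e::real_vector) lie_data \<Rightarrow> ('e \<Rightarrow> 'e \<Rightarrow> real) \<Rightarrow> 'e \<Rightarrow> 'e \<Rightarrow> real" where
  "sectional_curvature G ip X Y =
     ip (curvature G ip X Y Y) X / (ip X X * ip Y Y - (ip X Y)\<^sup>2)"


section \<open>Semidirect products\<close>

text \<open>\<open>AutoGroup H\<close> is the group of those automorphisms of \<open>H\<close> that are \<open>undefined\<close> off the
  carrier, so a homomorphism into it is an action by group automorphisms.\<close>

definition smooth_group_action ::
    "('g, 'e) lie_data \<Rightarrow> ('h, 'f) lie_data \<Rightarrow> ('g \<Rightarrow> 'h \<Rightarrow> 'h) \<Rightarrow> bool" where
  "smooth_group_action G H B \<longleftrightarrow>
     B \<in> hom G (AutoGroup H) \<and>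
     smooth_map (prod_manifold (manif G) (manif H)) (manif H) (\<lambda>(g, x). B g x)"

definition semidirect ::
    "('g, 'e) lie_data \<Rightarrow> ('h, 'f) lie_data \<Rightarrow> ('g \<Rightarrow> 'h \<Rightarrow> 'h) \<Rightarrow> ('g \<times> 'h, 'e \<times> 'f) lie_data" where
  "semidirect G H B =
     \<lparr>carrier = carrier G \<times> carrier H,
      monoid.mult = (\<lambda>(g\<^sub>1, h\<^sub>1) (g\<^sub>2, h\<^sub>2). (g\<^sub>1 \<otimes>\<^bsub>G\<^esub> g\<^sub>2, h\<^sub>1 \<otimes>\<^bsub>H\<^esub> B g\<^sub>1 h\<^sub>2)),
      one = (\<one>\<^bsub>G\<^esub>, \<one>\<^bsub>H\<^esub>),
      manif = prod_manifold (manif G) (manif H),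
      id_chart = (fst (id_chart G) \<times> fst (id_chart H),
                  map_prod (snd (id_chart G)) (snd (id_chart H)))\<rparr>"

definition action_diff ::
    "('h, 'f::real_vector) lie_data \<Rightarrow> ('g \<Rightarrow> 'h \<Rightarrow> 'h) \<Rightarrow> 'g \<Rightarrow> 'f \<Rightarrow> 'f" where
  \<comment> \<open>\<open>\<beta>(g) = T\<^sub>eB(g)\<close>\<close>
  "action_diff H B g Y =
     velocity (functionals H) (\<lambda>t. coord H (B g (param H (t *\<^sub>R Y)))) 0"

definition lie_action ::
    "('g, 'e::real_vector) lie_data \<Rightarrow> ('h, 'f::real_vector) lie_data \<Rightarrow> ('g \<Rightarrow> 'h \<Rightarrow> 'h) \<Rightarrow>
      'e \<Rightarrow> 'f \<Rightarrow> 'f" where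
  "lie_action G H B X Y =
     velocity (functionals H) (\<lambda>s. action_diff H B (param G (s *\<^sub>R X)) Y) 0"

definition prod_ip ::
    "('e \<Rightarrow> 'e \<Rightarrow> real) \<Rightarrow> ('f \<Rightarrow> 'f \<Rightarrow> real) \<Rightarrow> 'e \<times> 'f \<Rightarrow> 'e \<times> 'f \<Rightarrow> real" where
  "prod_ip ipG ipH = (\<lambda>(X\<^sub>1, Y\<^sub>1) (X\<^sub>2, Y\<^sub>2). ipG X\<^sub>1 X\<^sub>2 + ipH Y\<^sub>1 Y\<^sub>2)"

end

theory Submission
  imports Defs "HOL-Computational_Algebra.Polynomial"
begin

text \<open>
  Evaluated on right invariant fields, the numerator of the sectional curvature is
  \<open>1/4 |S|\<^sup>2 - 3/4 |[X, Y]|\<^sup>2 - \<langle>ad(X)\<^sup>T X, ad(Y)\<^sup>T Y\<rangle> - 1/2 \<langle>ad(X)\<^sup>T Y - ad(Y)\<^sup>T X, [X, Y]\<rangle>\<close>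
  with \<open>S = ad(X)\<^sup>T Y + ad(Y)\<^sup>T X\<close>, which uses the antisymmetry of the bracket only. For the
  semidirect product one has \<open>ad(X, Y)\<^sup>T (A, C) = (ad(X)\<^sup>T A - h(Y, C), ad(Y)\<^sup>T C + b(X)\<^sup>T C)\<close>, and
  expanding gives the formula up to the terms \<open>\<langle>h(Yi, Yj), [X1, X2]\<rangle>\<close>, which are rewritten with
  \<open>b([X, X']) = [b(X), b(X')]\<close>.

  The brackets and the action are iterated velocities, at \<open>0\<close>, of functions of two real variables
  that are only known to be smooth along smooth curves. So what is needed is a weak form of Boman's
  theorem: such a function has locally bounded partial derivatives (otherwise a smooth curve through
  a sequence of bad points gives a contradiction), and a finite difference argument then shows that
  its partial derivatives are smooth, with symmetric mixed derivatives.
\<close>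

section \<open>Smooth functions of a real variable\<close>

text \<open>A map in the convenient setting is known only through its restrictions to smooth curves,
  so at the start there is no joint derivative, no continuity and no bound. Every derivative
  therefore has to be read off from a function of one real variable, and finite differences do this:
  \<open>\<Sum>j\<le>k. w j * g s (j * s)\<close> samples \<open>g\<close> only on lines through the
  origin, hence is smooth in \<open>s\<close>, while its Taylor coefficients contain the mixed
  derivatives. As these coefficients are again derivatives along lines, the argument can be
  iterated.

  The most delicate use is \<open>b([X, X']) = [b(X), b(X')]\<close>. The curves in the group that
  have to be compared are not straight in coordinates, and
  \<open>w \<mapsto> \<beta>(param w) Y\<close> can be differentiated along curves only. Hadamard
  quotients help: a curve through \<open>0\<close> is written as \<open>r e(r)\<close>, and the
  difference of two curves with equal position and velocity at \<open>0\<close> as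
  \<open>r^2 e(r)\<close>, with a smooth curve \<open>e\<close>. The dependence on velocity and
  acceleration thus becomes a question about functions of two real variables.\<close>

fun ndiff :: "nat \<Rightarrow> real set \<Rightarrow> (real \<Rightarrow> real) \<Rightarrow> bool" where
  "ndiff 0 I f = True"
| "ndiff (Suc k) I f = (\<exists>f'. (\<forall>t\<in>I. (f has_real_derivative f' t) (at t)) \<and> ndiff k I f')"

lemma ndiff_SucE:
  assumes "ndiff (Suc k) I f"
  obtains f' where "\<And>t. t \<in> I \<Longrightarrow> (f has_real_derivative f' t) (at t)" "ndiff k I f'"
  using assms by auto

lemma ndiff_SucI:
  assumes "\<And>t. t \<in> I \<Longrightarrow> (f has_real_derivative f' t) (at t)" "ndiff k I f'"
  shows "ndiff (Suc k) I f"
  using assms by auto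

lemma ndiff_cong:
  assumes "open I" "ndiff k I f" "\<And>t. t \<in> I \<Longrightarrow> f t = g t"
  shows "ndiff k I g"
proof (cases k)
  case (Suc m)
  with assms(2) obtain f' where f': "\<And>t. t\<in>I \<Longrightarrow> (f has_real_derivative f' t) (at t)" "ndiff m I f'"
    by auto
  have "(g has_real_derivative f' t) (at t)" if "t \<in> I" for t
    using has_field_derivative_transform_within_open[OF f'(1)[OF that] assms(1) that] assms(3) by auto
  with f'(2) Suc show ?thesis by auto
qed auto

lemma smooth_real_on_deriv:
  assumes "smooth_real_on I f"
  shows "smooth_real_on I (deriv f)" and "smooth_real_on I ((deriv ^^ n) f)"
proof -
  have D: "smooth_real_on I (deriv f)" if "smooth_real_on I f" for f
    unfolding smooth_real_on_def
  proof safe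
    fix n t assume "t \<in> I"
    then have "(deriv ^^ Suc n) f differentiable (at t)"
      using that unfolding smooth_real_on_def by blast
    then show "(deriv ^^ n) (deriv f) differentiable (at t)"
      by (simp add: funpow_swap1)
  qed
  show "smooth_real_on I (deriv f)" by (rule D[OF assms])
  show "smooth_real_on I ((deriv ^^ n) f)" by (induction n) (auto intro: D assms)
qed

lemma smooth_real_on_DERIV:
  assumes "smooth_real_on I f" "t \<in> I"
  shows "(f has_real_derivative deriv f t) (at t)"
  using assms unfolding smooth_real_on_def
  by (metis DERIV_deriv_iff_real_differentiable funpow_0)

lemma smooth_real_on_DERIV_funpow:
  assumes "smooth_real_on I f" "t \<in> I"
  shows "((deriv ^^ n) f has_real_derivative (deriv ^^ Suc n) f t) (at t)"
  using smooth_real_on_DERIV[OF smooth_real_on_deriv(2)[OF assms(1), of n] assms(2)] by simp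

lemma smooth_real_on_ndiff: "smooth_real_on I f \<Longrightarrow> ndiff k I f"
proof (induction k arbitrary: f)
  case (Suc k)
  then show ?case
    using smooth_real_on_DERIV[of I f] smooth_real_on_deriv(1)[of I f] by auto
qed auto

text \<open>Iterating \<open>deriv\<close> on a compound function is unwieldy, as every step needs
  the derivative in a whole neighbourhood. \<open>ndiff\<close> names some derivative on
  \<open>I\<close> at each stage, so closure properties become inductions on the order; openness of
  \<open>I\<close> allows this derivative to be exchanged for \<open>deriv f\<close>.\<close>

lemma smooth_real_on_iff_ndiff:
  assumes "open I"
  shows "smooth_real_on I f \<longleftrightarrow> (\<forall>k. ndiff k I f)"
proof
  assume *: "\<forall>k. ndiff k I f"
  have "ndiff (Suc n) I f \<Longrightarrow> t \<in> I \<Longrightarrow> (deriv ^^ n) f differentiable (at t)" for n t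
  proof (induction n arbitrary: f)
    case 0
    then show ?case by (auto simp: real_differentiable_def)
  next
    case (Suc n)
    then obtain f' where f': "\<And>t. t\<in>I \<Longrightarrow> (f has_real_derivative f' t) (at t)" "ndiff (Suc n) I f'"
      by auto
    have "ndiff (Suc n) I (deriv f)"
      by (rule ndiff_cong[OF assms f'(2)]) (simp add: DERIV_imp_deriv[OF f'(1)])
    with Suc.IH[OF this Suc.prems(2)] show ?case by (simp add: funpow_swap1)
  qed
  with * show "smooth_real_on I f" unfolding smooth_real_on_def by blast
qed (auto intro: smooth_real_on_ndiff)

lemma higher_deriv_cong:
  fixes f g :: "real \<Rightarrow> real"
  assumes "open J" "\<And>t. t \<in> J \<Longrightarrow> f t = g t" "x \<in> J"
  shows "(deriv ^^ n) f x = (deriv ^^ n) g x"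
  using assms(2,3)
proof (induction n arbitrary: f g x)
  case (Suc n)
  have "deriv f t = deriv g t" if "t \<in> J" for t
    by (rule deriv_cong_ev) (use Suc.prems(1) that assms(1) eventually_nhds in blast)+
  from Suc.IH[OF this Suc.prems(2)] show ?case by (simp add: funpow_swap1)
qed auto

lemma smooth_real_on_local:
  assumes "\<And>t. t \<in> I \<Longrightarrow> \<exists>J g. open J \<and> t \<in> J \<and> smooth_real_on J g \<and> (\<forall>x\<in>J. f x = g x)"
  shows "smooth_real_on I f"
  unfolding smooth_real_on_def
proof safe
  fix n t assume "t \<in> I"
  then obtain J g where J: "open J" "t \<in> J" "smooth_real_on J g" "\<forall>x\<in>J. f x = g x"
    using assms by blast
  have "((deriv ^^ n) g has_real_derivative (deriv ^^ Suc n) g t) (at t)"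
    using smooth_real_on_DERIV_funpow J by blast
  moreover have "(deriv ^^ n) f x = (deriv ^^ n) g x" if "x \<in> J" for x
    by (rule higher_deriv_cong[OF J(1) _ that]) (use J(4) in auto)
  ultimately have "((deriv ^^ n) f has_real_derivative (deriv ^^ Suc n) g t) (at t)"
    using has_field_derivative_transform_within_open[OF _ J(1,2)] by metis
  then show "(deriv ^^ n) f differentiable (at t)" by (auto simp: real_differentiable_def)
qed

lemma smooth_real_on_subset: "smooth_real_on I f \<Longrightarrow> J \<subseteq> I \<Longrightarrow> smooth_real_on J f"
  by (auto simp: smooth_real_on_def)

lemma smooth_real_on_cong:
  assumes "open I" "smooth_real_on I f" "\<And>t. t \<in> I \<Longrightarrow> g t = f t"
  shows "smooth_real_on I g"
  by (rule smooth_real_on_local) (use assms in blast)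

lemma ndiff_le: "ndiff (Suc k) I f \<Longrightarrow> ndiff k I f"
  by (induction k arbitrary: f) auto

lemma ndiff_const: "ndiff k I (\<lambda>_. c)"
proof (induction k arbitrary: c)
  case (Suc k)
  show ?case by (rule ndiff_SucI[OF _ Suc[of 0]]) simp
qed auto

lemma ndiff_id: "ndiff k I (\<lambda>x. x)"
proof (cases k)
  case (Suc m)
  show ?thesis unfolding Suc by (rule ndiff_SucI[OF _ ndiff_const[of m I 1]]) simp
qed auto

lemma ndiff_add: "ndiff k I f \<Longrightarrow> ndiff k I g \<Longrightarrow> ndiff k I (\<lambda>x. f x + g x)"
proof (induction k arbitrary: f g)
  case (Suc k)
  from Suc.prems(1) obtain f' where f: "\<And>t. t\<in>I \<Longrightarrow> (f has_real_derivative f' t) (at t)" "ndiff k I f'"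
    by (rule ndiff_SucE) (rule that)
  from Suc.prems(2) obtain g' where g: "\<And>t. t\<in>I \<Longrightarrow> (g has_real_derivative g' t) (at t)" "ndiff k I g'"
    by (rule ndiff_SucE) (rule that)
  show ?case
    by (rule ndiff_SucI[rotated], rule Suc.IH[OF f(2) g(2)]) (intro DERIV_add f(1) g(1))
qed auto

lemma ndiff_mult: "ndiff k I f \<Longrightarrow> ndiff k I g \<Longrightarrow> ndiff k I (\<lambda>x. f x * g x)"
proof (induction k arbitrary: f g)
  case (Suc k)
  from Suc.prems(1) obtain f' where f: "\<And>t. t\<in>I \<Longrightarrow> (f has_real_derivative f' t) (at t)" "ndiff k I f'"
    by (rule ndiff_SucE) (rule that)
  from Suc.prems(2) obtain g' where g: "\<And>t. t\<in>I \<Longrightarrow> (g has_real_derivative g' t) (at t)" "ndiff k I g'"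
    by (rule ndiff_SucE) (rule that)
  have "ndiff k I (\<lambda>x. f' x * g x + g' x * f x)"
    by (rule ndiff_add; rule Suc.IH) (rule f(2) g(2) ndiff_le[OF Suc.prems(1)] ndiff_le[OF Suc.prems(2)])+
  then show ?case by (rule ndiff_SucI[rotated]) (intro DERIV_mult f(1) g(1))
qed auto

lemma ndiff_compose:
  "ndiff k J f \<Longrightarrow> ndiff k I g \<Longrightarrow> g ` I \<subseteq> J \<Longrightarrow> ndiff k I (\<lambda>x. f (g x))"
proof (induction k arbitrary: f g)
  case (Suc k)
  from Suc.prems(1) obtain f' where f: "\<And>t. t\<in>J \<Longrightarrow> (f has_real_derivative f' t) (at t)" "ndiff k J f'"
    by (rule ndiff_SucE) (rule that)
  from Suc.prems(2) obtain g' where g: "\<And>t. t\<in>I \<Longrightarrow> (g has_real_derivative g' t) (at t)" "ndiff k I g'"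
    by (rule ndiff_SucE) (rule that)
  have "ndiff k I (\<lambda>x. f' (g x) * g' x)"
    by (intro ndiff_mult Suc.IH[OF f(2) ndiff_le[OF Suc.prems(2)] Suc.prems(3)] g(2))
  moreover have "((\<lambda>x. f (g x)) has_real_derivative f' (g t) * g' t) (at t)" if "t \<in> I" for t
    by (rule DERIV_chain2[OF f(1) g(1)]) (use that Suc.prems(3) in auto)
  ultimately show ?case by (intro ndiff_SucI)
qed auto

lemma ndiff_inverse: "0 \<notin> I \<Longrightarrow> ndiff k I inverse"
proof (induction k)
  case (Suc k)
  have "ndiff k I (\<lambda>x. -1 * (inverse x * inverse x))"
    by (intro ndiff_mult ndiff_const Suc)
  moreover have "(inverse has_real_derivative -1 * (inverse t * inverse t)) (at t)" if "t \<in> I" for t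
    using that Suc.prems by (auto intro!: derivative_eq_intros)
  ultimately show ?case by (intro ndiff_SucI)
qed auto

lemma ndiff_sum:
  assumes "\<And>j. j \<in> A \<Longrightarrow> ndiff k I (f j)"
  shows "ndiff k I (\<lambda>x. \<Sum>j\<in>A. f j x)"
  using assms by (induction A rule: infinite_finite_induct) (auto intro: ndiff_const ndiff_add)

section \<open>Closure properties of smooth real functions\<close>

named_theorems smooth_intros

lemma smooth_const [smooth_intros]: "open I \<Longrightarrow> smooth_real_on I (\<lambda>_. c)"
  and smooth_id [smooth_intros]: "open I \<Longrightarrow> smooth_real_on I (\<lambda>x. x)"
  and smooth_add [smooth_intros]:
    "open I \<Longrightarrow> smooth_real_on I f \<Longrightarrow> smooth_real_on I g \<Longrightarrow> smooth_real_on I (\<lambda>x. f x + g x)"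
  and smooth_mult [smooth_intros]:
    "open I \<Longrightarrow> smooth_real_on I f \<Longrightarrow> smooth_real_on I g \<Longrightarrow> smooth_real_on I (\<lambda>x. f x * g x)"
  by (simp_all add: smooth_real_on_iff_ndiff ndiff_const ndiff_id ndiff_add ndiff_mult)

lemma smooth_sum [smooth_intros]:
  "open I \<Longrightarrow> (\<And>j. j \<in> A \<Longrightarrow> smooth_real_on I (f j)) \<Longrightarrow> smooth_real_on I (\<lambda>x. \<Sum>j\<in>A. f j x)"
  by (simp add: smooth_real_on_iff_ndiff ndiff_sum)

lemma smooth_minus [smooth_intros]:
  "open I \<Longrightarrow> smooth_real_on I f \<Longrightarrow> smooth_real_on I (\<lambda>x. - f x)"
  using smooth_mult[OF _ smooth_const[of I "-1"], of f] by simp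

lemma smooth_diff [smooth_intros]:
  "open I \<Longrightarrow> smooth_real_on I f \<Longrightarrow> smooth_real_on I g \<Longrightarrow> smooth_real_on I (\<lambda>x. f x - g x)"
  using smooth_add[OF _ _ smooth_minus, of I f g] by simp

lemma smooth_power [smooth_intros]:
  "open I \<Longrightarrow> smooth_real_on I f \<Longrightarrow> smooth_real_on I (\<lambda>x. f x ^ n)"
  by (induction n) (auto intro: smooth_const smooth_mult)

lemma smooth_compose:
  assumes "open I" "open J" "smooth_real_on J f" "smooth_real_on I g" "g ` I \<subseteq> J"
  shows "smooth_real_on I (\<lambda>x. f (g x))"
  using ndiff_compose[OF smooth_real_on_ndiff[OF assms(3)] smooth_real_on_ndiff[OF assms(4)] assms(5)]
  by (simp add: smooth_real_on_iff_ndiff[OF assms(1)])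

lemma smooth_inverse [smooth_intros]:
  assumes "open I" "smooth_real_on I f" "\<And>x. x \<in> I \<Longrightarrow> f x \<noteq> 0"
  shows "smooth_real_on I (\<lambda>x. inverse (f x))"
proof -
  have "smooth_real_on (-{0}) (inverse :: real \<Rightarrow> real)"
    by (simp add: smooth_real_on_iff_ndiff ndiff_inverse open_Compl)
  then show ?thesis
    by (intro smooth_compose[OF assms(1) _ _ assms(2), of "-{0}"]) (use assms(3) in \<open>auto simp: open_Compl\<close>)
qed

text \<open>Coinduction: a class of functions containing a derivative of each of its members
  consists of smooth functions. The classes used below carry a parameter that absorbs the
  differentiation, such as a polynomial, the shift of a series or a power under an integral.\<close>

lemma smooth_coinduct:
  assumes "open I" "C f"
    and step: "\<And>f. C f \<Longrightarrow> \<exists>f'. C f' \<and> (\<forall>t\<in>I. (f has_real_derivative f' t) (at t))"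
  shows "smooth_real_on I f"
proof -
  have "ndiff k I f" if "C f" for k f
    using that
  proof (induction k arbitrary: f)
    case (Suc k)
    then show ?case using step by (metis ndiff.simps(2))
  qed auto
  with assms show ?thesis by (simp add: smooth_real_on_iff_ndiff)
qed

lemma smooth_of_deriv:
  assumes "open I" "smooth_real_on I f'" "\<And>t. t \<in> I \<Longrightarrow> (f has_real_derivative f' t) (at t)"
  shows "smooth_real_on I f"
proof -
  have "ndiff k I f" for k
  proof (cases k)
    case (Suc m)
    then show ?thesis using ndiff_SucI[OF assms(3) smooth_real_on_ndiff[OF assms(2)]] by simp
  qed auto
  with assms(1) show ?thesis by (simp add: smooth_real_on_iff_ndiff)
qed

lemma smooth_arctan: "smooth_real_on UNIV (arctan :: real \<Rightarrow> real)"
proof (rule smooth_of_deriv)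
  show "smooth_real_on UNIV (\<lambda>x::real. inverse (1 + x\<^sup>2))"
    by (intro smooth_intros) (auto simp: add_nonneg_eq_0_iff)
qed (auto intro!: derivative_eq_intros)

lemma smooth_tan: "smooth_real_on {-pi/2<..<pi/2} (tan :: real \<Rightarrow> real)"
proof -
  have *: "(tan has_real_derivative (1 + tan t * tan t)) (at t)" if "t \<in> {-pi/2<..<pi/2}" for t :: real
  proof -
    have "cos t \<noteq> 0" using that cos_gt_zero_pi[of t] by auto
    then have "(tan has_real_derivative inverse ((cos t)\<^sup>2)) (at t)" by (rule DERIV_tan)
    then show ?thesis
      using tan_sec[OF \<open>cos t \<noteq> 0\<close>] by (metis power2_eq_square power_inverse)
  qed
  \<comment> \<open>The derivative \<open>1 + tan t * tan t\<close> is a polynomial in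
    \<open>tan\<close>, so the induction hypothesis for \<open>tan\<close> itself suffices.\<close>
  have "ndiff k {-pi/2<..<pi/2} tan" for k
  proof (induction k)
    case (Suc k)
    have "ndiff k {-pi/2<..<pi/2} (\<lambda>t. 1 + tan t * tan t)"
      by (intro ndiff_add ndiff_mult ndiff_const Suc)
    with * show ?case by (intro ndiff_SucI)
  qed auto
  then show ?thesis by (simp add: smooth_real_on_iff_ndiff)
qed

section \<open>Higher derivatives of affine substitutions and linear combinations\<close>

lemma higher_deriv_affine:
  assumes "open I" "smooth_real_on I f" "a * x + b \<in> I"
  shows "(deriv ^^ n) (\<lambda>x. f (a * x + b)) x = a ^ n * (deriv ^^ n) f (a * x + b)"
  using assms(3)
proof (induction n arbitrary: x)
  case (Suc n)
  let ?J = "(\<lambda>x. a * x + b) -` I"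
  have J: "open ?J" by (intro open_vimage assms continuous_intros)
  have "((\<lambda>x. a ^ n * (deriv ^^ n) f (a * x + b)) has_real_derivative
      a ^ n * ((deriv ^^ Suc n) f (a * x + b) * a)) (at x)"
    by (rule DERIV_cmult, rule DERIV_chain2[OF smooth_real_on_DERIV_funpow[OF assms(2)]])
       (use Suc.prems in \<open>auto intro!: derivative_eq_intros\<close>)
  then have "((deriv ^^ n) (\<lambda>x. f (a * x + b)) has_real_derivative
      a ^ n * ((deriv ^^ Suc n) f (a * x + b) * a)) (at x)"
    by (rule has_field_derivative_transform_within_open[OF _ J]) (use Suc in auto)
  then show ?case by (simp add: DERIV_imp_deriv)
qed auto

lemma higher_deriv_zero: "(deriv ^^ n) (\<lambda>_::real. 0::real) = (\<lambda>_. 0)"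
  by (induction n) auto

lemma higher_deriv_add:
  fixes f g :: "real \<Rightarrow> real"
  assumes "open I" "smooth_real_on I f" "smooth_real_on I g" "x \<in> I"
  shows "(deriv ^^ n) (\<lambda>x. f x + g x) x = (deriv ^^ n) f x + (deriv ^^ n) g x"
  using assms(4)
proof (induction n arbitrary: x)
  case (Suc n)
  have "((\<lambda>x. (deriv ^^ n) f x + (deriv ^^ n) g x) has_real_derivative
      (deriv ^^ Suc n) f x + (deriv ^^ Suc n) g x) (at x)"
    by (intro DERIV_add smooth_real_on_DERIV_funpow[OF assms(2)] smooth_real_on_DERIV_funpow[OF assms(3)] Suc)
  then have "((deriv ^^ n) (\<lambda>x. f x + g x) has_real_derivative
      (deriv ^^ Suc n) f x + (deriv ^^ Suc n) g x) (at x)"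
    by (rule has_field_derivative_transform_within_open[OF _ assms(1)]) (use Suc in auto)
  then show ?case by (simp add: DERIV_imp_deriv)
qed auto

lemma higher_deriv_cmult:
  fixes f :: "real \<Rightarrow> real"
  assumes "open I" "smooth_real_on I f" "x \<in> I"
  shows "(deriv ^^ n) (\<lambda>x. c * f x) x = c * (deriv ^^ n) f x"
  using assms(3)
proof (induction n arbitrary: x)
  case (Suc n)
  have "((\<lambda>x. c * (deriv ^^ n) f x) has_real_derivative c * (deriv ^^ Suc n) f x) (at x)"
    by (intro DERIV_cmult smooth_real_on_DERIV_funpow[OF assms(2)] Suc)
  then have "((deriv ^^ n) (\<lambda>x. c * f x) has_real_derivative c * (deriv ^^ Suc n) f x) (at x)"
    by (rule has_field_derivative_transform_within_open[OF _ assms(1)]) (use Suc in auto)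
  then show ?case by (simp add: DERIV_imp_deriv)
qed auto

lemma higher_deriv_sum:
  fixes f :: "'a \<Rightarrow> real \<Rightarrow> real"
  assumes "open I" "\<And>j. j \<in> A \<Longrightarrow> smooth_real_on I (f j)" "x \<in> I"
  shows "(deriv ^^ n) (\<lambda>x. \<Sum>j\<in>A. f j x) x = (\<Sum>j\<in>A. (deriv ^^ n) (f j) x)"
  using assms(2)
proof (induction A rule: infinite_finite_induct)
  case (insert a A)
  have "(deriv ^^ n) (\<lambda>x. f a x + (\<Sum>j\<in>A. f j x)) x
      = (deriv ^^ n) (f a) x + (deriv ^^ n) (\<lambda>x. \<Sum>j\<in>A. f j x) x"
    using insert.prems by (intro higher_deriv_add[OF assms(1) _ _ assms(3)] smooth_sum assms(1)) auto
  with insert show ?case by simp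
qed (simp_all add: higher_deriv_zero)

section \<open>Bump functions and smooth series\<close>

abbreviation "smooth \<equiv> smooth_real_on UNIV"

text \<open>Differentiation preserves the shape \<open>p(1/x) exp(-1/x)\<close> on the positive axis
  and replaces \<open>p\<close> by \<open>X^2 (p - p')\<close>. At \<open>0\<close> the difference
  quotient from the right again has this shape, with \<open>pCons 0 p\<close> for \<open>p\<close>,
  and tends to \<open>0\<close> because the exponential beats every polynomial.\<close>

lemma smooth_exp_inverse:
  "smooth (\<lambda>x::real. if x \<le> 0 then 0 else exp (- inverse x))"
proof -
  define F :: "real poly \<Rightarrow> real \<Rightarrow> real" where
    "F p x = (if x \<le> 0 then 0 else poly p (inverse x) * exp (- inverse x))" for p x
  have lim: "((\<lambda>y. poly p y * exp (- y)) \<longlongrightarrow> 0) at_top" for p :: "real poly"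
  proof -
    have "((\<lambda>y. \<Sum>i\<le>degree p. coeff p i * (y ^ i / exp y)) \<longlongrightarrow> (\<Sum>i\<le>degree p. coeff p i * 0)) at_top"
      by (intro tendsto_sum tendsto_mult tendsto_const tendsto_power_div_exp_0)
    moreover have "(\<Sum>i\<le>degree p. coeff p i * (y ^ i / exp y)) = poly p y * exp (- y)" for y
      by (simp add: poly_altdef sum_distrib_right exp_minus divide_inverse mult.assoc)
    ultimately show ?thesis by simp
  qed
  have step: "(F p has_real_derivative F ([:0,0,1:] * (p - pderiv p)) t) (at t)" for p t
  proof (cases t "0 :: real" rule: linorder_cases)
    case less
    have "((\<lambda>_. 0) has_real_derivative 0) (at t)" by simp
    then have "(F p has_real_derivative 0) (at t)"
      by (rule has_field_derivative_transform_within_open[of _ _ _ "{..<0}"]) (use less in \<open>auto simp: F_def\<close>)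
    then show ?thesis using less by (simp add: F_def)
  next
    case greater
    have "((\<lambda>x. poly p (inverse x) * exp (- inverse x)) has_real_derivative
       F ([:0,0,1:] * (p - pderiv p)) t) (at t)"
      using greater
      by (auto intro!: derivative_eq_intros DERIV_chain2[OF poly_DERIV] simp: F_def algebra_simps power2_eq_square)
    then show ?thesis
      by (rule has_field_derivative_transform_within_open[of _ _ _ "{0<..}"]) (use greater in \<open>auto simp: F_def\<close>)
  next
    case equal
    have "((\<lambda>h. F p h / h) \<longlongrightarrow> 0) (at_right 0)"
    proof -
      have "((\<lambda>h. poly (pCons 0 p) (inverse h) * exp (- inverse h)) \<longlongrightarrow> 0) (at_right 0)"
        by (rule filterlim_compose[OF lim filterlim_inverse_at_top_right])
      moreover have "\<forall>\<^sub>F h in at_right 0. F p h / h = poly (pCons 0 p) (inverse h) * exp (- inverse h)"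
        by (auto simp: F_def field_simps eventually_at intro!: exI[of _ 1])
      ultimately show ?thesis using tendsto_cong by force
    qed
    moreover have "((\<lambda>h. F p h / h) \<longlongrightarrow> 0) (at_left 0)"
      by (rule tendsto_eventually) (auto simp: F_def eventually_at intro!: exI[of _ 1])
    ultimately have "((\<lambda>h. F p h / h) \<longlongrightarrow> 0) (at 0)" by (simp add: filterlim_split_at)
    then show ?thesis using equal by (simp add: DERIV_def F_def)
  qed
  have "smooth (F 1)"
    by (rule smooth_coinduct[where C = "\<lambda>f. \<exists>p. f = F p"]) (use step in auto)
  moreover have "F 1 = (\<lambda>x::real. if x \<le> 0 then 0 else exp (- inverse x))"
    by (auto simp: F_def)
  ultimately show ?thesis by simp
qed

lemma smooth_bump_exists:
  obtains \<psi> :: "real \<Rightarrow> real" where "smooth \<psi>"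
    "\<And>x. 7/8 \<le> x \<Longrightarrow> x \<le> 9/8 \<Longrightarrow> \<psi> x = 1" "\<And>x. x \<le> 3/4 \<or> 5/4 \<le> x \<Longrightarrow> \<psi> x = 0"
proof -
  define e :: "real \<Rightarrow> real" where "e x = (if x \<le> 0 then 0 else exp (- inverse x))" for x
  have e: "smooth e"
    using smooth_exp_inverse unfolding e_def .
  have pos: "e x + e (1 - x) > 0" for x by (auto simp: e_def add_pos_pos)
  define u where "u x = e x * inverse (e x + e (1 - x))" for x
  have u: "smooth u" unfolding u_def
    using pos by (intro smooth_intros e smooth_compose[OF _ _ e]) (auto simp: less_le)
  \<comment> \<open>\<open>u\<close> is a smooth step, \<open>0\<close> up to \<open>0\<close> and
    \<open>1\<close> from \<open>1\<close> on. The two affine maps carry the transition zones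
    \<open>[3/4, 7/8]\<close> and \<open>[9/8, 5/4]\<close> onto \<open>[0, 1]\<close>, the second
    one reversed.\<close>
  define \<psi> where "\<psi> x = u (8 * x + (- 6)) * u (- 8 * x + 10)" for x
  have "smooth \<psi>" unfolding \<psi>_def
    by (intro smooth_intros smooth_compose[OF _ _ u]) auto
  moreover have "u x = 1" if "x \<ge> 1" for x using that pos[of x] by (auto simp: u_def e_def)
  moreover have "u x = 0" if "x \<le> 0" for x using that by (auto simp: u_def e_def)
  ultimately show ?thesis by (intro that[of \<psi>]) (auto simp: \<psi>_def)
qed

lemma bounded_higher_deriv_compact_support:
  fixes f :: "real \<Rightarrow> real"
  assumes "smooth f" "\<And>x. x \<notin> {a..b} \<Longrightarrow> f x = 0"
  shows "\<exists>M. \<forall>x. \<bar>(deriv ^^ k) f x\<bar> \<le> M"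
proof -
  have "continuous_on {a..b} ((deriv ^^ k) f)"
    using smooth_real_on_DERIV_funpow[OF assms(1)]
    by (meson DERIV_continuous_on has_field_derivative_at_within UNIV_I)
  then have "bounded ((deriv ^^ k) f ` {a..b})"
    by (intro compact_imp_bounded compact_continuous_image) auto
  then obtain M where M: "\<And>x. x \<in> {a..b} \<Longrightarrow> \<bar>(deriv ^^ k) f x\<bar> \<le> M"
    unfolding bounded_iff real_norm_def by (metis imageI)
  have "(deriv ^^ k) f x = 0" if "x \<notin> {a..b}" for x
    using higher_deriv_cong[of "- {a..b}" f "\<lambda>_. 0" x k] that assms(2)
    by (simp add: higher_deriv_zero open_Compl)
  with M have "\<bar>(deriv ^^ k) f x\<bar> \<le> max M 0" for x
    by (cases "x \<in> {a..b}") (auto simp: le_max_iff_disj)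
  then show ?thesis by blast
qed

text \<open>The bound on the \<open>k\<close>-th derivative is asked for from the index
  \<open>k\<close> on only, since finitely many terms do not affect convergence. In the class
  \<open>?P\<close> the shift \<open>m\<close> counts the differentiations already performed, which
  makes the class closed under termwise differentiation.\<close>

lemma smooth_suminf:
  fixes \<zeta> :: "nat \<Rightarrow> real \<Rightarrow> real"
  assumes "\<And>n. smooth (\<zeta> n)"
    and "\<And>n k x. k \<le> n \<Longrightarrow> \<bar>(deriv ^^ k) (\<zeta> n) x\<bar> \<le> (1/2) ^ n"
  shows "smooth (\<lambda>x. \<Sum>n. \<zeta> n x)"
proof -
  let ?P = "\<lambda>\<zeta> m. (\<forall>n. smooth (\<zeta> n)) \<and>
    (\<forall>n k x. k + m \<le> n \<longrightarrow> \<bar>(deriv ^^ k) (\<zeta> n) x\<bar> \<le> (1/2) ^ n)"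
  show ?thesis
  proof (rule smooth_coinduct[where C = "\<lambda>f. \<exists>\<zeta> m. ?P \<zeta> m \<and> f = (\<lambda>x. \<Sum>n. \<zeta> n x)"])
    show "\<exists>\<zeta>' m. ?P \<zeta>' m \<and> (\<lambda>x. \<Sum>n. \<zeta> n x) = (\<lambda>x. \<Sum>n. \<zeta>' n x)"
      using assms by (intro exI[of _ \<zeta>] exI[of _ 0]) auto
  next
    fix f assume "\<exists>\<zeta> m. ?P \<zeta> m \<and> f = (\<lambda>x. \<Sum>n. \<zeta> n x)"
    then obtain \<zeta> :: "nat \<Rightarrow> real \<Rightarrow> real" and m
      where P: "?P \<zeta> m" and f: "f = (\<lambda>x. \<Sum>n. \<zeta> n x)" by blast
    have geo: "summable (\<lambda>n. (1/2) ^ n :: real)" by (simp add: summable_geometric)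
    have sm: "smooth (\<zeta> n)" for n using P by blast
    have bd: "\<bar>(deriv ^^ k) (\<zeta> n) x\<bar> \<le> (1/2) ^ n" if "k + m \<le> n" for n k x using P that by blast
    have "?P (\<lambda>n. deriv (\<zeta> n)) (Suc m)"
    proof (intro conjI allI impI)
      fix n k x assume "k + Suc m \<le> n"
      then show "\<bar>(deriv ^^ k) (deriv (\<zeta> n)) x\<bar> \<le> (1/2) ^ n"
        using bd[of "Suc k" n x] by (simp add: funpow_swap1)
    qed (use smooth_real_on_deriv(1) sm in blast)
    moreover have "(f has_real_derivative (\<Sum>n. deriv (\<zeta> n) t)) (at t)" for t
      unfolding f
    proof (rule has_field_derivative_series'(2)[of UNIV])
      show "(\<zeta> n has_real_derivative deriv (\<zeta> n) x) (at x within UNIV)" for n x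
        using smooth_real_on_DERIV[OF sm] by simp
      have ev: "\<forall>\<^sub>F n in sequentially. \<forall>x\<in>UNIV. norm (deriv (\<zeta> n) x) \<le> (1/2) ^ n"
        unfolding eventually_sequentially using bd[of 1] by (intro exI[of _ "Suc m"]) auto
      show "uniformly_convergent_on UNIV (\<lambda>n x. \<Sum>i<n. deriv (\<zeta> i) x)"
        by (rule Weierstrass_m_test'_ev[OF ev geo])
      have "\<forall>\<^sub>F n in sequentially. norm (\<zeta> n 0) \<le> (1/2) ^ n"
        unfolding eventually_sequentially using bd[of 0] by (intro exI[of _ m]) auto
      then show "summable (\<lambda>n. \<zeta> n 0)" by (rule summable_comparison_test_ev[OF _ geo])
    qed auto
    ultimately show "\<exists>f'. (\<exists>\<zeta> m. ?P \<zeta> m \<and> f' = (\<lambda>x. \<Sum>n. \<zeta> n x)) \<and>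
        (\<forall>t\<in>UNIV. (f has_real_derivative f' t) (at t))"
      by (intro exI[of _ "\<lambda>x. \<Sum>n. deriv (\<zeta> n) x"] conjI exI[of _ "\<lambda>n. deriv (\<zeta> n)"] exI[of _ "Suc m"])
         auto
  qed auto
qed

text \<open>The curve is at \<open>(x n, y n)\<close> at time \<open>\<tau> n\<close> and moves
  there on a vertical segment with speed \<open>\<epsilon> n\<close>. So \<open>k\<close>
  differentiations of a function along it see only the second variable and produce the known factor
  \<open>\<epsilon> n ^ k\<close>.\<close>

definition vertical_curve :: "(nat \<Rightarrow> real) \<Rightarrow> (nat \<Rightarrow> real) \<Rightarrow> (nat \<Rightarrow> real) \<Rightarrow> (nat \<Rightarrow> real) \<Rightarrow> bool" where
  "vertical_curve \<epsilon> \<tau> x y \<longleftrightarrow> (\<exists>\<sigma> \<theta>. smooth \<sigma> \<and> smooth \<theta> \<and> \<sigma> 0 = 0 \<and> \<theta> 0 = 0 \<and>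
        (\<forall>n. \<exists>J. open J \<and> \<tau> n \<in> J \<and> (\<forall>r\<in>J. \<sigma> r = x n \<and> \<theta> r = y n + \<epsilon> n * (r - \<tau> n))))"

text \<open>The special curve lemma of convenient calculus in the plane: points that tend to \<open>0\<close> fast
  enough lie on a smooth curve, which moreover passes them vertically and not too slowly.\<close>

lemma smooth_curve_through_sequence:
  obtains \<epsilon> \<tau> :: "nat \<Rightarrow> real" where "\<And>n. \<epsilon> n > 0" "\<tau> \<longlonglongrightarrow> 0"
    "\<forall>x y. (\<forall>n. \<bar>x n\<bar> \<le> \<epsilon> n \<and> \<bar>y n\<bar> \<le> \<epsilon> n) \<longrightarrow>
      vertical_curve \<epsilon> \<tau> x y"
proof -
  obtain \<psi> :: "real \<Rightarrow> real" where \<psi>: "smooth \<psi>"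
    "\<And>x. 7/8 \<le> x \<Longrightarrow> x \<le> 9/8 \<Longrightarrow> \<psi> x = 1" "\<And>x. x \<le> 3/4 \<or> 5/4 \<le> x \<Longrightarrow> \<psi> x = 0"
    by (rule smooth_bump_exists) (rule that)
  define \<tau> :: "nat \<Rightarrow> real" where "\<tau> n = (1/2) ^ n" for n
  define \<phi> where "\<phi> n r = \<psi> (2 ^ n * r)" for n :: nat and r
  define \<zeta> where "\<zeta> n r = (r - \<tau> n) * \<phi> n r" for n r
  have \<phi>: "smooth (\<phi> n)" for n unfolding \<phi>_def
    by (intro smooth_compose[OF _ _ \<psi>(1)] smooth_intros) auto
  have \<zeta>: "smooth (\<zeta> n)" for n unfolding \<zeta>_def
    by (intro smooth_intros \<phi>) auto
  have supp: "\<phi> n r = 0" "\<zeta> n r = 0" if "r \<notin> {0..2}" for n r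
  proof -
    have "2 ^ n * r \<le> 3/4 \<or> 5/4 \<le> 2 ^ n * r"
    proof (cases "r < 0")
      case True
      then have "2 ^ n * r \<le> 0" by (simp add: mult_nonneg_nonpos)
      then show ?thesis by simp
    next
      case False
      then have "1 * 2 \<le> 2 ^ n * r" using that by (intro mult_mono) auto
      then show ?thesis by simp
    qed
    then show "\<phi> n r = 0" "\<zeta> n r = 0" using \<psi>(3) by (auto simp: \<phi>_def \<zeta>_def)
  qed
  have "\<exists>M. \<forall>k x. \<bar>(deriv ^^ k) (\<phi> n) x\<bar> \<le> M k" for n
  proof -
    have "\<exists>M. \<forall>x. \<bar>(deriv ^^ k) (\<phi> n) x\<bar> \<le> M" for k
      using bounded_higher_deriv_compact_support[OF \<phi>, of 0 2] supp(1) by blast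
    then show ?thesis by metis
  qed
  then obtain M where M: "\<And>n k x. \<bar>(deriv ^^ k) (\<phi> n) x\<bar> \<le> M n k" by metis
  have "\<exists>M. \<forall>k x. \<bar>(deriv ^^ k) (\<zeta> n) x\<bar> \<le> M k" for n
  proof -
    have "\<exists>M. \<forall>x. \<bar>(deriv ^^ k) (\<zeta> n) x\<bar> \<le> M" for k
      using bounded_higher_deriv_compact_support[OF \<zeta>, of 0 2] supp(2) by blast
    then show ?thesis by metis
  qed
  then obtain M' where M': "\<And>n k x. \<bar>(deriv ^^ k) (\<zeta> n) x\<bar> \<le> M' n k" by metis
  have M0: "0 \<le> M n k" "0 \<le> M' n k" for n k
    using M[of k n 0] M'[of k n 0] by linarith+
  define L where "L n = 1 + (\<Sum>k\<le>n. M n k + M' n k)" for n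
  have L: "M n k \<le> L n" "M' n k \<le> L n" if "k \<le> n" for n k
  proof -
    have "M n k + M' n k \<le> (\<Sum>k\<le>n. M n k + M' n k)"
      using that M0 by (intro member_le_sum) auto
    then show "M n k \<le> L n" "M' n k \<le> L n" using M0[of n k] by (auto simp: L_def)
  qed
  have L1: "L n \<ge> 1" for n by (auto simp: L_def M0 sum_nonneg)
  \<comment> \<open>\<open>L n\<close> dominates the derivatives up to order \<open>n\<close> of
    both bumps of index \<open>n\<close>. Coefficients of size at most \<open>\<epsilon> n\<close>
    then contribute at most \<open>2 * \<epsilon> n * L n = (1/2) ^ n\<close>, as
    \<open>smooth_suminf\<close> requires.\<close>
  define \<epsilon> where "\<epsilon> n = (1/2) ^ n / (2 * L n)" for n
  have \<epsilon>: "\<epsilon> n > 0" for n using L1[of n] by (auto simp: \<epsilon>_def)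
  \<comment> \<open>Near \<open>\<tau> n\<close> only the bump of index \<open>n\<close> is active,
    because the scales differ by a factor of at least 2: for \<open>m < n\<close> one has
    \<open>2 ^ m * r \<le> 9/16 < 3/4\<close>, and for \<open>m > n\<close> one has
    \<open>2 ^ m * r \<ge> 7/4 > 5/4\<close>.\<close>
  have only: "m = n" if "7/8 \<le> 2 ^ n * r" "2 ^ n * r \<le> 9/8" "\<phi> m r \<noteq> 0" for m n r
  proof (rule linorder_cases[of m n])
    have *: "3/4 < 2 ^ m * r" "2 ^ m * r < 5/4" using \<psi>(3)[of "2 ^ m * r"] that(3) by (force simp: \<phi>_def)+
    have "0 < 2 ^ n * r" using that(1) by linarith
    then have r: "r > 0" by (rule zero_less_mult_pos) simp
    show "m = n" if "m < n"
    proof -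
      have "(2::real) ^ Suc m \<le> 2 ^ n" using that by (intro power_increasing) auto
      then have "2 ^ Suc m * r \<le> 2 ^ n * r" using r by (intro mult_right_mono) auto
      with * \<open>2 ^ n * r \<le> 9/8\<close> show ?thesis by simp
    qed
    show "m = n" if "n < m"
    proof -
      have "(2::real) ^ Suc n \<le> 2 ^ m" using that by (intro power_increasing) auto
      then have "2 ^ Suc n * r \<le> 2 ^ m * r" using r by (intro mult_right_mono) auto
      with * \<open>7/8 \<le> 2 ^ n * r\<close> show ?thesis by simp
    qed
  qed
  have smooth: "smooth (\<lambda>r. \<Sum>n. x n * \<phi> n r + y n * \<zeta> n r)"
    if "\<And>n. \<bar>x n\<bar> \<le> \<epsilon> n" "\<And>n. \<bar>y n\<bar> \<le> \<epsilon> n" for x y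
  proof (rule smooth_suminf)
    show "smooth (\<lambda>r. x n * \<phi> n r + y n * \<zeta> n r)" for n
      by (intro smooth_intros \<phi> \<zeta>) auto
    fix n k :: nat and r :: real assume "k \<le> n"
    have "(deriv ^^ k) (\<lambda>r. x n * \<phi> n r + y n * \<zeta> n r) r
        = x n * (deriv ^^ k) (\<phi> n) r + y n * (deriv ^^ k) (\<zeta> n) r"
      using higher_deriv_add[of UNIV "\<lambda>r. x n * \<phi> n r" "\<lambda>r. y n * \<zeta> n r" r k]
      by (simp add: higher_deriv_cmult[of UNIV] smooth_mult smooth_const \<phi> \<zeta>)
    also have "\<bar>\<dots>\<bar> \<le> \<bar>x n\<bar> * \<bar>(deriv ^^ k) (\<phi> n) r\<bar> + \<bar>y n\<bar> * \<bar>(deriv ^^ k) (\<zeta> n) r\<bar>"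
      by (simp add: abs_mult[symmetric])
    also have "\<dots> \<le> \<epsilon> n * L n + \<epsilon> n * L n"
      using M[of k n r] M'[of k n r] L[OF \<open>k \<le> n\<close>] L1[of n] \<epsilon>[of n] that[of n]
      by (intro add_mono mult_mono) auto
    also have "\<dots> = (1/2) ^ n" using L1[of n] by (simp add: \<epsilon>_def)
    finally show "\<bar>(deriv ^^ k) (\<lambda>r. x n * \<phi> n r + y n * \<zeta> n r) r\<bar> \<le> (1/2) ^ n" .
  qed
  show ?thesis
  proof (rule that[of \<epsilon> \<tau>])
    show "\<tau> \<longlonglongrightarrow> 0" unfolding \<tau>_def by (rule LIMSEQ_realpow_zero) auto
    show "\<forall>x y. (\<forall>n. \<bar>x n\<bar> \<le> \<epsilon> n \<and> \<bar>y n\<bar> \<le> \<epsilon> n) \<longrightarrow>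
      vertical_curve \<epsilon> \<tau> x y"
    proof (intro allI impI)
      fix x y assume "\<forall>n. \<bar>x n\<bar> \<le> \<epsilon> n \<and> \<bar>y n\<bar> \<le> \<epsilon> n"
      then have xy: "\<And>n. \<bar>x n\<bar> \<le> \<epsilon> n" "\<And>n. \<bar>y n\<bar> \<le> \<epsilon> n" by auto
      \<comment> \<open>The summand with coefficient \<open>0\<close> gives \<open>\<sigma>\<close>
        the form of \<open>\<theta>\<close>, so that one smoothness statement covers both. It also
        makes \<open>\<sigma>\<close> constant near \<open>\<tau> n\<close>.\<close>
      define \<sigma> where "\<sigma> r = (\<Sum>n. x n * \<phi> n r + 0 * \<zeta> n r)" for r
      define \<theta> where "\<theta> r = (\<Sum>n. y n * \<phi> n r + \<epsilon> n * \<zeta> n r)" for r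
      have \<phi>0: "\<phi> n 0 = 0" "\<zeta> n 0 = 0" for n using \<psi>(3) by (auto simp: \<phi>_def \<zeta>_def)
      have loc: "\<exists>J. open J \<and> \<tau> n \<in> J \<and> (\<forall>r\<in>J. \<sigma> r = x n \<and> \<theta> r = y n + \<epsilon> n * (r - \<tau> n))" for n
      proof (intro exI[of _ "(\<lambda>r. 2 ^ n * r) -` {7/8<..<9/8}"] conjI ballI)
        show "open ((\<lambda>r::real. 2 ^ n * r) -` {7/8<..<9/8})" by (intro open_vimage continuous_intros)
        show "\<tau> n \<in> (\<lambda>r. 2 ^ n * r) -` {7/8<..<9/8}" by (auto simp: \<tau>_def power_mult_distrib[symmetric])
        fix r :: real assume "r \<in> (\<lambda>r. 2 ^ n * r) -` {7/8<..<9/8}"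
        then have r: "7/8 \<le> 2 ^ n * r" "2 ^ n * r \<le> 9/8" by auto
        then have *: "\<phi> n r = 1" "\<And>m. m \<noteq> n \<Longrightarrow> \<phi> m r = 0" using \<psi>(2) only[OF r] by (auto simp: \<phi>_def)
        show "\<sigma> r = x n" unfolding \<sigma>_def
          by (subst suminf_finite[of "{n}"]) (use * in \<open>auto simp: \<zeta>_def\<close>)
        show "\<theta> r = y n + \<epsilon> n * (r - \<tau> n)" unfolding \<theta>_def
          by (subst suminf_finite[of "{n}"]) (use * in \<open>auto simp: \<zeta>_def\<close>)
      qed
      show "vertical_curve \<epsilon> \<tau> x y"
      proof -
        have "smooth \<sigma>" unfolding \<sigma>_def
          by (rule smooth) (use xy(1) \<epsilon> in \<open>auto simp: less_imp_le\<close>)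
        moreover have "smooth \<theta>" unfolding \<theta>_def
          by (rule smooth) (use xy(2) \<epsilon> in \<open>auto simp: less_imp_le\<close>)
        moreover have "\<sigma> 0 = 0" "\<theta> 0 = 0" by (simp_all add: \<sigma>_def \<theta>_def \<phi>0)
        ultimately show ?thesis using loc unfolding vertical_curve_def by blast
      qed
    qed
  qed (rule \<epsilon>)
qed

section \<open>Functions that are smooth along smooth curves\<close>

lemma smooth_real_on_continuous_on: "smooth_real_on I f \<Longrightarrow> continuous_on I f"
  by (meson DERIV_continuous_on has_field_derivative_at_within smooth_real_on_DERIV)

text \<open>Smoothness notions here quantify over curves on all of the real line, but many curves
  are defined only near a point. The arctangent, scaled by \<open>e / pi\<close> to stay within
  distance \<open>e\<close> of \<open>r0\<close>, compresses the line into \<open>J\<close>, and the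
  tangent is its smooth inverse near \<open>r0\<close>.\<close>

lemma local_reparametrization:
  assumes "open J" "r0 \<in> J"
  obtains \<gamma> \<kappa> :: "real \<Rightarrow> real" and N \<epsilon> where
    "smooth \<gamma>" "range \<gamma> \<subseteq> J" "\<gamma> 0 = r0"
    "open N" "r0 \<in> N" "N \<subseteq> J" "smooth_real_on N \<kappa>" "\<kappa> r0 = 0" "\<And>s. s \<in> N \<Longrightarrow> \<gamma> (\<kappa> s) = s"
    "(\<kappa> has_real_derivative \<epsilon>) (at r0)"
proof -
  obtain e where e: "e > 0" "ball r0 e \<subseteq> J" using assms openE by blast
  define \<epsilon> where "\<epsilon> = e / pi"
  have \<epsilon>: "\<epsilon> > 0" using e by (simp add: \<epsilon>_def)
  define \<gamma> where "\<gamma> r = r0 + \<epsilon> * arctan r" for r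
  define \<kappa> where "\<kappa> s = tan (inverse \<epsilon> * s + (- r0 * inverse \<epsilon>))" for s
  define N where "N = (\<lambda>s. inverse \<epsilon> * s + (- r0 * inverse \<epsilon>)) -` {-pi/2<..<pi/2}"
  have "\<bar>\<epsilon> * arctan r\<bar> < e" for r
  proof -
    have "\<bar>arctan r\<bar> < pi" using arctan_bounded[of r] by linarith
    then have "\<epsilon> * \<bar>arctan r\<bar> < \<epsilon> * pi" using \<epsilon> by simp
    then show ?thesis using e(1) by (simp add: abs_mult \<epsilon>_def)
  qed
  then have range: "range \<gamma> \<subseteq> J" using e(2) by (force simp: \<gamma>_def dist_real_def)
  have N: "open N" unfolding N_def by (intro open_vimage continuous_intros open_greaterThanLessThan)
  have \<gamma>\<kappa>: "\<gamma> (\<kappa> s) = s" if "s \<in> N" for s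
    using that \<epsilon> by (simp add: \<gamma>_def \<kappa>_def N_def arctan_tan field_simps)
  show ?thesis
  proof (rule that[of \<gamma> N \<kappa> "inverse \<epsilon>"])
    show "smooth \<gamma>" unfolding \<gamma>_def by (intro smooth_intros smooth_arctan) auto
    show "N \<subseteq> J"
    proof
      fix s assume "s \<in> N"
      then have "s = \<gamma> (\<kappa> s)" using \<gamma>\<kappa> by simp
      then show "s \<in> J" using range by (metis rangeI subsetD)
    qed
    have "smooth_real_on N (\<lambda>s. inverse \<epsilon> * s + (- r0 * inverse \<epsilon>))"
      by (intro smooth_intros N)
    then show "smooth_real_on N \<kappa>" unfolding \<kappa>_def
      by (rule smooth_compose[OF N open_greaterThanLessThan smooth_tan]) (auto simp: N_def)
    have "(tan has_real_derivative inverse ((cos (inverse \<epsilon> * r0 + - r0 * inverse \<epsilon>))\<^sup>2))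
        (at (inverse \<epsilon> * r0 + - r0 * inverse \<epsilon>))"
      by (rule DERIV_tan) simp
    then show "(\<kappa> has_real_derivative inverse \<epsilon>) (at r0)" unfolding \<kappa>_def
      by (rule DERIV_chain2[THEN DERIV_cong]) (auto intro!: derivative_eq_intros)
  qed (use range N \<gamma>\<kappa> in \<open>auto simp: \<gamma>_def \<kappa>_def N_def\<close>)
qed

lemma open_Collect_mem_continuous:
  assumes "open N" "continuous_on N \<kappa>" "open S"
  shows "open {s \<in> N. \<kappa> s \<in> S}"
  using continuous_open_preimage[OF assms(2,1,3)] by (simp add: vimage_def Int_def)

text \<open>Near each parameter \<open>c\<close> is the composite of
  \<open>c \<circ> \<gamma>\<close>, which is defined on the whole line and covered by the
  hypothesis, with the smooth local inverse \<open>\<kappa>\<close> of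
  \<open>\<gamma>\<close>.\<close>

lemma smooth_localize:
  fixes c :: "real \<Rightarrow> 'a" and \<Phi> :: "'a \<Rightarrow> real"
  assumes "open J"
    and "\<And>\<gamma>. smooth \<gamma> \<Longrightarrow> range \<gamma> \<subseteq> J \<Longrightarrow>
      open {r. c (\<gamma> r) \<in> W} \<and> smooth_real_on {r. c (\<gamma> r) \<in> W} (\<lambda>r. \<Phi> (c (\<gamma> r)))"
  shows "open {r \<in> J. c r \<in> W}" and "smooth_real_on {r \<in> J. c r \<in> W} (\<lambda>r. \<Phi> (c r))"
proof -
  have *: "\<exists>T g. open T \<and> r0 \<in> T \<and> T \<subseteq> {r \<in> J. c r \<in> W} \<and> smooth_real_on T g \<and> (\<forall>x\<in>T. \<Phi> (c x) = g x)"
    if "r0 \<in> {r \<in> J. c r \<in> W}" for r0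
  proof -
    have "r0 \<in> J" using that by simp
    obtain \<gamma> \<kappa> N \<epsilon> where \<gamma>: "smooth \<gamma>" "range \<gamma> \<subseteq> J" "\<gamma> 0 = r0"
      and N: "open N" "r0 \<in> N" "N \<subseteq> J" "smooth_real_on N \<kappa>" "\<kappa> r0 = 0" "\<And>s. s \<in> N \<Longrightarrow> \<gamma> (\<kappa> s) = s"
      by (rule local_reparametrization[OF assms(1) \<open>r0 \<in> J\<close>]) (rule that)
    define S where "S = {r. c (\<gamma> r) \<in> W}"
    have S: "open S" "smooth_real_on S (\<lambda>r. \<Phi> (c (\<gamma> r)))" using assms(2)[OF \<gamma>(1,2)] by (auto simp: S_def)
    define T where "T = {s \<in> N. \<kappa> s \<in> S}"
    have T: "open T" unfolding T_def
      by (rule open_Collect_mem_continuous[OF N(1) smooth_real_on_continuous_on[OF N(4)] S(1)])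
    have "smooth_real_on T (\<lambda>s. \<Phi> (c (\<gamma> (\<kappa> s))))"
      by (rule smooth_compose[OF T S(1) S(2) smooth_real_on_subset[OF N(4)]]) (auto simp: T_def)
    then show ?thesis using T N(2,3,5,6) that \<gamma>(3)
      by (intro exI[of _ T] exI[of _ "\<lambda>s. \<Phi> (c (\<gamma> (\<kappa> s)))"]) (auto simp: T_def S_def)
  qed
  show "open {r \<in> J. c r \<in> W}" by (subst open_subopen) (use * in blast)
  show "smooth_real_on {r \<in> J. c r \<in> W} (\<lambda>r. \<Phi> (c r))"
    by (rule smooth_real_on_local) (use * in blast)
qed

text \<open>Curves may leave \<open>W\<close>. Demanding that the parameters inside \<open>W\<close>
  form an open set replaces openness of \<open>W\<close> by a condition that can be tested along
  curves and is inherited by domains defined through charts of infinite-dimensional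
  manifolds.\<close>

definition smooth_along2 :: "(real \<times> real) set \<Rightarrow> (real \<Rightarrow> real \<Rightarrow> real) \<Rightarrow> bool" where
  "smooth_along2 W g \<longleftrightarrow> (\<forall>a b. smooth a \<and> smooth b \<longrightarrow>
     open {r. (a r, b r) \<in> W} \<and> smooth_real_on {r. (a r, b r) \<in> W} (\<lambda>r. g (a r) (b r)))"

lemma smooth_along2D:
  assumes "smooth_along2 W g" "smooth a" "smooth b"
  shows "open {r. (a r, b r) \<in> W}" "smooth_real_on {r. (a r, b r) \<in> W} (\<lambda>r. g (a r) (b r))"
  using assms unfolding smooth_along2_def by blast+

lemma smooth_along2_slice:
  assumes "smooth_along2 W g"
  shows "open {t. (s, t) \<in> W}" "smooth_real_on {t. (s, t) \<in> W} (g s)"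
    "open {t. (t, s) \<in> W}" "smooth_real_on {t. (t, s) \<in> W} (\<lambda>t. g t s)"
  using smooth_along2D[OF assms smooth_const smooth_id, of s]
    smooth_along2D[OF assms smooth_id smooth_const, of s] by auto

lemma smooth_along2_affine:
  assumes "smooth_along2 W g"
  shows "smooth_along2 {(s, t). (s0 + \<alpha> * s + \<beta> * t, t0 + \<gamma> * s + \<delta> * t) \<in> W}
    (\<lambda>s t. g (s0 + \<alpha> * s + \<beta> * t) (t0 + \<gamma> * s + \<delta> * t))"
  unfolding smooth_along2_def
proof (intro allI impI)
  fix a b :: "real \<Rightarrow> real"
  assume "smooth a \<and> smooth b"
  then have "smooth (\<lambda>r. s0 + \<alpha> * a r + \<beta> * b r)" "smooth (\<lambda>r. t0 + \<gamma> * a r + \<delta> * b r)"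
    by (auto intro!: smooth_intros)
  from smooth_along2D[OF assms this]
  show "open {r. (a r, b r) \<in> {(s, t). (s0 + \<alpha> * s + \<beta> * t, t0 + \<gamma> * s + \<delta> * t) \<in> W}} \<and>
     smooth_real_on {r. (a r, b r) \<in> {(s, t). (s0 + \<alpha> * s + \<beta> * t, t0 + \<gamma> * s + \<delta> * t) \<in> W}}
      (\<lambda>r. g (s0 + \<alpha> * a r + \<beta> * b r) (t0 + \<gamma> * a r + \<delta> * b r))"
    by simp
qed

lemma smooth_along2_swap:
  assumes "smooth_along2 W g"
  shows "smooth_along2 {(s, t). (t, s) \<in> W} (\<lambda>s t. g t s)"
  using smooth_along2_affine[OF assms, of 0 0 1 0 1 0] by simp

text \<open>If the bound fails, the bad points can be chosen on a smooth curve as in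
  \<open>smooth_curve_through_sequence\<close>, along which \<open>g\<close> would not be smooth.\<close>

lemma smooth_along2_bounded_deriv:
  assumes g: "smooth_along2 W g" and "(0, 0) \<in> W"
  shows "\<exists>\<delta>>0. \<exists>M. \<forall>s t. \<bar>s\<bar> < \<delta> \<longrightarrow> \<bar>t\<bar> < \<delta> \<longrightarrow> (s, t) \<in> W \<and> \<bar>(deriv ^^ k) (g s) t\<bar> \<le> M"
proof (rule ccontr)
  assume neg: "\<not> ?thesis"
  obtain \<epsilon> \<tau> :: "nat \<Rightarrow> real" where \<epsilon>: "\<And>n. \<epsilon> n > 0" and \<tau>: "\<tau> \<longlonglongrightarrow> 0" and
    curve: "\<forall>x y. (\<forall>n. \<bar>x n\<bar> \<le> \<epsilon> n \<and> \<bar>y n\<bar> \<le> \<epsilon> n) \<longrightarrow>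
      vertical_curve \<epsilon> \<tau> x y"
    by (rule smooth_curve_through_sequence) (rule that)
  \<comment> \<open>The negated claim is used with \<open>\<delta> = \<epsilon> n\<close> and the
    bound \<open>n / \<epsilon> n ^ k\<close>. The factor \<open>\<epsilon> n ^ k\<close> picked up
    on the vertical segment cancels the denominator, so the \<open>k\<close>-th derivative along the
    curve exceeds \<open>n\<close> at \<open>\<tau> n\<close>. Bad points outside \<open>W\<close>
    are excluded for large \<open>n\<close>, as \<open>\<tau> n\<close> then lies in the open set
    \<open>S\<close>.\<close>
  have "\<exists>s t. \<bar>s\<bar> < \<epsilon> n \<and> \<bar>t\<bar> < \<epsilon> n \<and> \<not> ((s, t) \<in> W \<and> \<bar>(deriv ^^ k) (g s) t\<bar> \<le> real n / \<epsilon> n ^ k)" for n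
    using neg \<epsilon>[of n] by blast
  then obtain x y where xy: "\<And>n. \<bar>x n\<bar> < \<epsilon> n" "\<And>n. \<bar>y n\<bar> < \<epsilon> n"
    and bad: "\<And>n. \<not> ((x n, y n) \<in> W \<and> \<bar>(deriv ^^ k) (g (x n)) (y n)\<bar> \<le> real n / \<epsilon> n ^ k)"
    by metis
  obtain \<sigma> \<theta> where sm: "smooth \<sigma>" "smooth \<theta>" and "\<sigma> 0 = 0" "\<theta> 0 = 0"
    and loc: "\<And>n. \<exists>J. open J \<and> \<tau> n \<in> J \<and> (\<forall>r\<in>J. \<sigma> r = x n \<and> \<theta> r = y n + \<epsilon> n * (r - \<tau> n))"
    using curve[rule_format, of x y] xy unfolding vertical_curve_def by (auto simp: less_imp_le)
  define S where "S = {r. (\<sigma> r, \<theta> r) \<in> W}"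
  define G where "G r = g (\<sigma> r) (\<theta> r)" for r
  have S: "open S" and G: "smooth_real_on S G"
    using smooth_along2D[OF g sm] by (auto simp: S_def G_def[abs_def])
  have "0 \<in> S" using assms(2) \<open>\<sigma> 0 = 0\<close> \<open>\<theta> 0 = 0\<close> by (simp add: S_def)
  have "isCont ((deriv ^^ k) G) 0"
    using smooth_real_on_DERIV_funpow[OF G \<open>0 \<in> S\<close>] DERIV_isCont by blast
  then have "(\<lambda>n. (deriv ^^ k) G (\<tau> n)) \<longlonglongrightarrow> (deriv ^^ k) G 0"
    using \<tau> by (rule isCont_tendsto_compose)
  then have "\<forall>\<^sub>F n in sequentially. (deriv ^^ k) G (\<tau> n) \<in> ball ((deriv ^^ k) G 0) 1"
    by (rule topological_tendstoD) auto
  moreover have "\<forall>\<^sub>F n in sequentially. \<tau> n \<in> S"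
    using topological_tendstoD[OF \<tau> S \<open>0 \<in> S\<close>] .
  moreover have "\<forall>\<^sub>F n in sequentially. real n > \<bar>(deriv ^^ k) G 0\<bar> + 1"
    using filterlim_real_sequentially by (simp add: filterlim_at_top_dense)
  ultimately have "\<forall>\<^sub>F n in sequentially. \<bar>(deriv ^^ k) G (\<tau> n) - (deriv ^^ k) G 0\<bar> < 1 \<and> \<tau> n \<in> S \<and> real n > \<bar>(deriv ^^ k) G 0\<bar> + 1"
    by eventually_elim (auto simp: dist_real_def)
  then obtain n where n: "\<bar>(deriv ^^ k) G (\<tau> n) - (deriv ^^ k) G 0\<bar> < 1" "\<tau> n \<in> S" "real n > \<bar>(deriv ^^ k) G 0\<bar> + 1"
    using eventually_happens'[OF sequentially_bot] by blast
  obtain J where J: "open J" "\<tau> n \<in> J" "\<forall>r\<in>J. \<sigma> r = x n \<and> \<theta> r = y n + \<epsilon> n * (r - \<tau> n)"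
    using loc by blast
  have *: "\<sigma> (\<tau> n) = x n" "\<theta> (\<tau> n) = y n" using J by auto
  then have W: "(x n, y n) \<in> W" using n(2) by (simp add: S_def)
  have "(deriv ^^ k) G (\<tau> n) = (deriv ^^ k) (\<lambda>r. g (x n) (\<epsilon> n * r + (y n - \<epsilon> n * \<tau> n))) (\<tau> n)"
  proof (rule higher_deriv_cong[OF J(1) _ J(2)])
    fix r assume "r \<in> J"
    then have "\<sigma> r = x n" "\<theta> r = \<epsilon> n * r + (y n - \<epsilon> n * \<tau> n)"
      using J(3) by (auto simp: right_diff_distrib)
    then show "G r = g (x n) (\<epsilon> n * r + (y n - \<epsilon> n * \<tau> n))" by (simp add: G_def)
  qed
  also have "\<dots> = \<epsilon> n ^ k * (deriv ^^ k) (g (x n)) (\<epsilon> n * \<tau> n + (y n - \<epsilon> n * \<tau> n))"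
    by (rule higher_deriv_affine[OF smooth_along2_slice(1,2)[OF g]]) (use W in auto)
  finally have eq: "(deriv ^^ k) G (\<tau> n) = \<epsilon> n ^ k * (deriv ^^ k) (g (x n)) (y n)" by simp
  have "\<bar>(deriv ^^ k) (g (x n)) (y n)\<bar> > real n / \<epsilon> n ^ k" using bad[of n] W by auto
  then have "\<bar>(deriv ^^ k) G (\<tau> n)\<bar> > real n"
    using \<epsilon>[of n] unfolding eq by (simp add: abs_mult pos_divide_less_eq mult.commute)
  with n(1,3) show False by linarith
qed

section \<open>Taylor expansions in one variable\<close>

lemma maclaurin_bound:
  fixes f :: "real \<Rightarrow> real"
  assumes "smooth_real_on I f" "{-\<bar>x\<bar>..\<bar>x\<bar>} \<subseteq> I" "\<And>t. \<bar>t\<bar> \<le> \<bar>x\<bar> \<Longrightarrow> \<bar>(deriv ^^ n) f t\<bar> \<le> M"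
  shows "\<bar>f x - (\<Sum>m<n. (deriv ^^ m) f 0 / fact m * x ^ m)\<bar> \<le> M * \<bar>x\<bar> ^ n"
proof -
  have I: "t \<in> I" if "\<bar>t\<bar> \<le> \<bar>x\<bar>" for t
    using that by (intro subsetD[OF assms(2)]) (simp add: abs_le_iff minus_le_iff)
  have "\<exists>t. \<bar>t\<bar> \<le> \<bar>x\<bar> \<and> f x = (\<Sum>m<n. (deriv ^^ m) f 0 / fact m * x ^ m) + (deriv ^^ n) f t / fact n * x ^ n"
    by (rule Maclaurin_bi_le[where diff = "\<lambda>m. (deriv ^^ m) f"])
       (auto simp del: funpow.simps intro!: smooth_real_on_DERIV_funpow[OF assms(1)] I)
  then obtain t where t: "\<bar>t\<bar> \<le> \<bar>x\<bar>"
    "f x = (\<Sum>m<n. (deriv ^^ m) f 0 / fact m * x ^ m) + (deriv ^^ n) f t / fact n * x ^ n" by blast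
  have "\<bar>(deriv ^^ n) f t\<bar> / fact n \<le> M / 1"
    using assms(3)[OF t(1)] by (intro frac_le) (auto simp: fact_ge_1)
  then have "\<bar>(deriv ^^ n) f t\<bar> / fact n * \<bar>x\<bar> ^ n \<le> M * \<bar>x\<bar> ^ n"
    by (intro mult_right_mono) auto
  then have "\<bar>(deriv ^^ n) f t / fact n * x ^ n\<bar> \<le> M * \<bar>x\<bar> ^ n"
    by (simp add: abs_mult power_abs)
  with t(2) show ?thesis by simp
qed

lemma taylor_tendsto:
  fixes A :: "real \<Rightarrow> real"
  assumes "open N" "0 \<in> N" "smooth_real_on N A"
  shows "((\<lambda>s. (A s - (\<Sum>m<n. (deriv ^^ m) A 0 / fact m * s ^ m)) / s ^ n) \<longlongrightarrow> (deriv ^^ n) A 0 / fact n) (at 0)"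
proof -
  obtain e where e: "e > 0" "cball 0 e \<subseteq> N" using assms open_contains_cball by blast
  have "continuous_on (cball 0 e) ((deriv ^^ Suc n) A)"
    using smooth_real_on_continuous_on[OF smooth_real_on_deriv(2)[OF assms(3)]] e(2) continuous_on_subset by blast
  then have "bounded ((deriv ^^ Suc n) A ` cball 0 e)"
    by (intro compact_imp_bounded compact_continuous_image) auto
  then obtain M where M: "\<And>t. t \<in> cball 0 e \<Longrightarrow> \<bar>(deriv ^^ Suc n) A t\<bar> \<le> M"
    unfolding bounded_iff real_norm_def by (metis imageI)
  define P where "P s = (\<Sum>m<n. (deriv ^^ m) A 0 / fact m * s ^ m)" for s
  have bound: "\<bar>(A s - P s) / s ^ n - (deriv ^^ n) A 0 / fact n\<bar> \<le> M * \<bar>s\<bar>" if "s \<noteq> 0" "\<bar>s\<bar> < e" for s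
  proof -
    have "\<bar>A s - (\<Sum>m<Suc n. (deriv ^^ m) A 0 / fact m * s ^ m)\<bar> \<le> M * \<bar>s\<bar> ^ Suc n"
      by (rule maclaurin_bound[OF assms(3)]) (use e(2) that M in \<open>auto simp: subset_iff dist_real_def\<close>)
    then have "\<bar>A s - P s - (deriv ^^ n) A 0 / fact n * s ^ n\<bar> \<le> M * \<bar>s\<bar> * \<bar>s\<bar> ^ n"
      by (simp add: P_def algebra_simps)
    then have "\<bar>A s - P s - (deriv ^^ n) A 0 / fact n * s ^ n\<bar> / \<bar>s\<bar> ^ n \<le> M * \<bar>s\<bar>"
      using that by (simp add: pos_divide_le_eq)
    also have "\<bar>A s - P s - (deriv ^^ n) A 0 / fact n * s ^ n\<bar> / \<bar>s\<bar> ^ n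
        = \<bar>(A s - P s) / s ^ n - (deriv ^^ n) A 0 / fact n\<bar>"
      unfolding power_abs[symmetric] abs_divide[symmetric] using that by (simp add: diff_divide_distrib)
    finally show ?thesis .
  qed
  have "((\<lambda>s. (A s - P s) / s ^ n - (deriv ^^ n) A 0 / fact n) \<longlongrightarrow> 0) (at 0)"
  proof (rule Lim_null_comparison)
    show "\<forall>\<^sub>F s in at 0. norm ((A s - P s) / s ^ n - (deriv ^^ n) A 0 / fact n) \<le> M * \<bar>s\<bar>"
      using bound e(1) by (auto simp: eventually_at intro!: exI[of _ e])
    show "((\<lambda>s. M * \<bar>s\<bar>) \<longlongrightarrow> 0) (at 0)" by (auto intro!: tendsto_eq_intros)
  qed
  then show ?thesis unfolding P_def[symmetric] by (rule LIM_zero_cancel)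
qed

text \<open>The constant coefficient is the limit of the polynomial at \<open>0\<close>, hence zero;
  then a factor \<open>s\<close> cancels and the degree drops.\<close>

lemma polynomial_little_o_zero:
  fixes c :: "nat \<Rightarrow> real"
  assumes "((\<lambda>s. (\<Sum>m\<le>k. c m * s ^ m) / s ^ k) \<longlongrightarrow> 0) (at 0)" "m \<le> k"
  shows "c m = 0"
  using assms
proof (induction k arbitrary: c m)
  case 0
  then show ?case by (simp add: tendsto_const_iff)
next
  case (Suc k)
  let ?p = "\<lambda>s. \<Sum>m\<le>Suc k. c m * s ^ m"
  have "((\<lambda>s. ?p s / s ^ Suc k * s ^ Suc k) \<longlongrightarrow> 0 * 0 ^ Suc k) (at 0)"
    by (intro tendsto_mult Suc.prems(1) tendsto_power tendsto_ident_at)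
  moreover have "\<forall>\<^sub>F s in at 0. ?p s / s ^ Suc k * s ^ Suc k = ?p s"
    by (auto simp: eventually_at intro!: exI[of _ 1])
  ultimately have "(?p \<longlongrightarrow> 0) (at 0)"
    using tendsto_cong by force
  moreover have "(?p \<longlongrightarrow> (\<Sum>m\<le>Suc k. c m * 0 ^ m)) (at 0)"
    by (intro tendsto_intros)
  moreover have "(\<Sum>m\<le>Suc k. c m * 0 ^ m) = c 0"
    by (subst sum.atMost_Suc_shift) simp
  ultimately have c0: "c 0 = 0" using LIM_unique by metis
  have "?p s / s ^ Suc k = (\<Sum>m\<le>k. c (Suc m) * s ^ m) / s ^ k" if "s \<noteq> 0" for s
  proof -
    have "?p s = s * (\<Sum>m\<le>k. c (Suc m) * s ^ m)"
      by (subst sum.atMost_Suc_shift) (simp add: c0 sum_distrib_left mult_ac)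
    then show ?thesis using that by simp
  qed
  then have "\<forall>\<^sub>F s in at 0. ?p s / s ^ Suc k = (\<Sum>m\<le>k. c (Suc m) * s ^ m) / s ^ k"
    by (auto simp: eventually_at intro!: exI[of _ 1])
  with Suc.prems(1) have lim: "((\<lambda>s. (\<Sum>m\<le>k. c (Suc m) * s ^ m) / s ^ k) \<longlongrightarrow> 0) (at 0)"
    using tendsto_cong by force
  show ?case
  proof (cases m)
    case (Suc m')
    with Suc.IH[OF lim, of m'] Suc.prems(2) show ?thesis by simp
  qed (simp add: c0)
qed

text \<open>Subtracting the Taylor polynomial of degree \<open>k\<close> from
  \<open>a * s ^ k\<close> leaves a polynomial of degree at most \<open>k\<close> that is
  \<open>o(s^k)\<close>, and so has no nonzero coefficient. This reads derivatives off from an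
  asymptotic expansion obtained by other means.\<close>

lemma taylor_unique:
  fixes A :: "real \<Rightarrow> real"
  assumes "open N" "0 \<in> N" "smooth_real_on N A"
    and lim: "((\<lambda>s. (A s - a * s ^ k) / s ^ k) \<longlongrightarrow> 0) (at 0)"
  shows "\<And>m. m < k \<Longrightarrow> (deriv ^^ m) A 0 = 0" and "(deriv ^^ k) A 0 = fact k * a"
proof -
  define c where "c m = (deriv ^^ m) A 0 / fact m - (if m = k then a else 0)" for m
  have "((\<lambda>s. (A s - a * s ^ k) / s ^ k - ((A s - (\<Sum>m<k. (deriv ^^ m) A 0 / fact m * s ^ m)) / s ^ k
       - (deriv ^^ k) A 0 / fact k)) \<longlongrightarrow> 0 - ((deriv ^^ k) A 0 / fact k - (deriv ^^ k) A 0 / fact k)) (at 0)"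
    by (intro tendsto_intros lim taylor_tendsto[OF assms(1-3)])
  moreover have "(A s - a * s ^ k) / s ^ k - ((A s - (\<Sum>m<k. (deriv ^^ m) A 0 / fact m * s ^ m)) / s ^ k
       - (deriv ^^ k) A 0 / fact k) = (\<Sum>m\<le>k. c m * s ^ m) / s ^ k" if "s \<noteq> 0" for s
  proof -
    have "(\<Sum>m\<le>k. c m * s ^ m) = (\<Sum>m<k. (deriv ^^ m) A 0 / fact m * s ^ m) + ((deriv ^^ k) A 0 / fact k - a) * s ^ k"
      by (simp add: lessThan_Suc_atMost[symmetric] c_def)
    moreover have "(x - a * S) / S - ((x - L) / S - d) = (L + (d - a) * S) / S" if "S \<noteq> 0" for x S L d
      using that by (simp add: field_simps)
    ultimately show ?thesis using that by simp
  qed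
  then have "\<forall>\<^sub>F s in at 0. (A s - a * s ^ k) / s ^ k - ((A s - (\<Sum>m<k. (deriv ^^ m) A 0 / fact m * s ^ m)) / s ^ k
       - (deriv ^^ k) A 0 / fact k) = (\<Sum>m\<le>k. c m * s ^ m) / s ^ k"
    by (auto simp: eventually_at intro!: exI[of _ 1])
  ultimately have "((\<lambda>s. (\<Sum>m\<le>k. c m * s ^ m) / s ^ k) \<longlongrightarrow> 0) (at 0)"
    using tendsto_cong by force
  from polynomial_little_o_zero[OF this] have c: "c m = 0" if "m \<le> k" for m using that .
  show "(deriv ^^ m) A 0 = 0" if "m < k" for m using c[of m] that by (simp add: c_def)
  show "(deriv ^^ k) A 0 = fact k * a" using c[of k] by (simp add: c_def field_simps)
qed

text \<open>Weights \<open>w\<close> for which \<open>\<Sum>j\<le>k. w j * f (j * t)\<close> approximates \<open>t ^ k\<close> times the \<open>k\<close>-th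
  derivative of \<open>f\<close> at \<open>0\<close>.\<close>

definition fd_weights :: "nat \<Rightarrow> (nat \<Rightarrow> real) \<Rightarrow> bool" where
  "fd_weights k w \<longleftrightarrow> (\<forall>i\<le>k. (\<Sum>j\<le>k. w j * real j ^ i) = (if i = k then fact k else 0))"

text \<open>The leading error coefficient: besides \<open>t ^ k\<close> times the
  \<open>k\<close>-th derivative, the weighted sum contains this number times
  \<open>t ^ Suc k\<close> times the next derivative, up to terms of order
  \<open>k + 2\<close>.\<close>

definition fd_error :: "nat \<Rightarrow> (nat \<Rightarrow> real) \<Rightarrow> real" where
  "fd_error k w = (\<Sum>j\<le>k. w j * real j ^ Suc k) / fact (Suc k)"

text \<open>Iterated forward differences: \<open>w'\<close> applied to \<open>f\<close> is
  \<open>w\<close> applied to \<open>f(x + 1) - f(x)\<close>. Expanding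
  \<open>(j + 1) ^ i - j ^ i\<close> by the binomial theorem leaves powers below \<open>i\<close>,
  of which only the \<open>k\<close>-th survives; for \<open>i = k + 1\<close> it contributes
  \<open>(k + 1) * k!\<close>.\<close>

lemma fd_weights_exists: "\<exists>w. fd_weights k w"
proof (induction k)
  case 0
  show ?case by (intro exI[of _ "\<lambda>_. 1"]) (simp add: fd_weights_def)
next
  case (Suc k)
  then obtain w where w: "\<And>i. i \<le> k \<Longrightarrow> (\<Sum>j\<le>k. w j * real j ^ i) = (if i = k then fact k else 0)"
    unfolding fd_weights_def by blast
  define w' where "w' j = (if j = 0 then 0 else w (j - 1)) - (if j \<le> k then w j else 0)" for j
  have "(\<Sum>j\<le>Suc k. w' j * real j ^ i) = (if i = Suc k then fact (Suc k) else 0)" if i: "i \<le> Suc k" for i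
  proof -
    have "(\<Sum>j\<le>Suc k. w' j * real j ^ i) = (\<Sum>j\<le>Suc k. (if j = 0 then 0 else w (j - 1)) * real j ^ i)
        - (\<Sum>j\<le>Suc k. (if j \<le> k then w j else 0) * real j ^ i)"
      by (simp add: w'_def left_diff_distrib sum_subtractf del: sum.atMost_Suc)
    also have "(\<Sum>j\<le>Suc k. (if j = 0 then 0 else w (j - 1)) * real j ^ i) = (\<Sum>j\<le>k. w j * (real j + 1) ^ i)"
      by (subst sum.atMost_Suc_shift) (simp add: add.commute)
    also have "\<dots> = (\<Sum>j\<le>k. \<Sum>l\<le>i. w j * (of_nat (i choose l) * real j ^ l))"
      by (simp add: binomial_ring sum_distrib_left)
    also have "\<dots> = (\<Sum>l\<le>i. of_nat (i choose l) * (\<Sum>j\<le>k. w j * real j ^ l))"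
      by (subst sum.swap) (simp add: sum_distrib_left mult_ac)
    also have "\<dots> = (\<Sum>l<i. of_nat (i choose l) * (\<Sum>j\<le>k. w j * real j ^ l)) + (\<Sum>j\<le>k. w j * real j ^ i)"
      by (simp add: lessThan_Suc_atMost[symmetric])
    also have "(\<Sum>l<i. of_nat (i choose l) * (\<Sum>j\<le>k. w j * real j ^ l)) = (\<Sum>l<i. if l = k then of_nat (i choose l) * fact k else 0)"
      using i by (intro sum.cong) (auto simp: w)
    also have "\<dots> = (if i = Suc k then fact (Suc k) else 0)"
      using i by (auto simp: sum.delta)
    also have "(\<Sum>j\<le>Suc k. (if j \<le> k then w j else 0) * real j ^ i) = (\<Sum>j\<le>k. w j * real j ^ i)"
      by simp
    finally show ?thesis by simp
  qed
  then show ?case unfolding fd_weights_def by blast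
qed

lemma fd_approximation:
  fixes f :: "real \<Rightarrow> real"
  assumes w: "fd_weights k w" and f: "smooth_real_on I f" and I: "\<And>x. \<bar>x\<bar> < \<delta> \<Longrightarrow> x \<in> I"
    and M: "\<And>x. \<bar>x\<bar> < \<delta> \<Longrightarrow> \<bar>(deriv ^^ n) f x\<bar> \<le> M" and t: "real k * \<bar>t\<bar> < \<delta>"
  shows "\<bar>(\<Sum>j\<le>k. w j * f (real j * t)) -
      (\<Sum>m<n. (deriv ^^ m) f 0 * t ^ m * ((\<Sum>j\<le>k. w j * real j ^ m) / fact m))\<bar>
    \<le> (\<Sum>j\<le>k. \<bar>w j\<bar> * real j ^ n) * M * \<bar>t\<bar> ^ n"
proof -
  have "(\<Sum>m<n. (deriv ^^ m) f 0 * t ^ m * ((\<Sum>j\<le>k. w j * real j ^ m) / fact m))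
      = (\<Sum>m<n. \<Sum>j\<le>k. w j * ((deriv ^^ m) f 0 / fact m * (real j * t) ^ m))"
    by (simp add: sum_distrib_left sum_divide_distrib power_mult_distrib mult_ac)
  also have "\<dots> = (\<Sum>j\<le>k. w j * (\<Sum>m<n. (deriv ^^ m) f 0 / fact m * (real j * t) ^ m))"
    by (subst sum.swap) (simp add: sum_distrib_left)
  finally have "(\<Sum>j\<le>k. w j * f (real j * t)) -
      (\<Sum>m<n. (deriv ^^ m) f 0 * t ^ m * ((\<Sum>j\<le>k. w j * real j ^ m) / fact m))
    = (\<Sum>j\<le>k. w j * (f (real j * t) - (\<Sum>m<n. (deriv ^^ m) f 0 / fact m * (real j * t) ^ m)))"
    by (simp add: right_diff_distrib sum_subtractf)
  also have "\<bar>\<dots>\<bar> \<le> (\<Sum>j\<le>k. \<bar>w j\<bar> * (M * \<bar>real j * t\<bar> ^ n))"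
  proof (rule order_trans[OF sum_abs], rule sum_mono)
    fix j assume "j \<in> {..k}"
    then have "\<bar>real j * t\<bar> \<le> real k * \<bar>t\<bar>" by (simp add: abs_mult mult_right_mono)
    with t have j: "\<bar>x\<bar> < \<delta>" if "\<bar>x\<bar> \<le> \<bar>real j * t\<bar>" for x using that by linarith
    have "\<bar>f (real j * t) - (\<Sum>m<n. (deriv ^^ m) f 0 / fact m * (real j * t) ^ m)\<bar> \<le> M * \<bar>real j * t\<bar> ^ n"
      by (rule maclaurin_bound[OF f]) (auto intro!: I M j)
    then show "\<bar>w j * (f (real j * t) - (\<Sum>m<n. (deriv ^^ m) f 0 / fact m * (real j * t) ^ m))\<bar>
        \<le> \<bar>w j\<bar> * (M * \<bar>real j * t\<bar> ^ n)"
      by (simp add: abs_mult mult_left_mono)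
  qed
  also have "\<dots> = (\<Sum>j\<le>k. \<bar>w j\<bar> * real j ^ n) * M * \<bar>t\<bar> ^ n"
    by (simp add: abs_mult power_mult_distrib sum_distrib_left sum_distrib_right mult_ac)
  finally show ?thesis .
qed

lemma fd_approximation1:
  fixes f :: "real \<Rightarrow> real"
  assumes w: "fd_weights k w" and f: "smooth_real_on I f" and I: "\<And>x. \<bar>x\<bar> < \<delta> \<Longrightarrow> x \<in> I"
    and M: "\<And>x. \<bar>x\<bar> < \<delta> \<Longrightarrow> \<bar>(deriv ^^ Suc k) f x\<bar> \<le> M" and t: "real k * \<bar>t\<bar> < \<delta>"
  shows "\<bar>(\<Sum>j\<le>k. w j * f (real j * t)) - t ^ k * (deriv ^^ k) f 0\<bar>
    \<le> (\<Sum>j\<le>k. \<bar>w j\<bar> * real j ^ Suc k) * M * \<bar>t\<bar> ^ Suc k"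
proof -
  have "(\<Sum>m<Suc k. (deriv ^^ m) f 0 * t ^ m * ((\<Sum>j\<le>k. w j * real j ^ m) / fact m))
     = (\<Sum>m<Suc k. if m = k then t ^ k * (deriv ^^ k) f 0 else 0)"
    using w by (intro sum.cong refl) (simp add: fd_weights_def)
  then have "(\<Sum>m<Suc k. (deriv ^^ m) f 0 * t ^ m * ((\<Sum>j\<le>k. w j * real j ^ m) / fact m)) = t ^ k * (deriv ^^ k) f 0"
    by simp
  with fd_approximation[OF w f I M t] show ?thesis by simp
qed

lemma fd_approximation2:
  fixes f :: "real \<Rightarrow> real"
  assumes w: "fd_weights k w" and f: "smooth_real_on I f" and I: "\<And>x. \<bar>x\<bar> < \<delta> \<Longrightarrow> x \<in> I"
    and M: "\<And>x. \<bar>x\<bar> < \<delta> \<Longrightarrow> \<bar>(deriv ^^ Suc (Suc k)) f x\<bar> \<le> M" and t: "real k * \<bar>t\<bar> < \<delta>"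
  shows "\<bar>(\<Sum>j\<le>k. w j * f (real j * t)) - t ^ k * (deriv ^^ k) f 0
      - fd_error k w * t ^ Suc k * (deriv ^^ Suc k) f 0\<bar>
    \<le> (\<Sum>j\<le>k. \<bar>w j\<bar> * real j ^ Suc (Suc k)) * M * \<bar>t\<bar> ^ Suc (Suc k)"
proof -
  have "(\<Sum>m<Suc k. (deriv ^^ m) f 0 * t ^ m * ((\<Sum>j\<le>k. w j * real j ^ m) / fact m))
     = (\<Sum>m<Suc k. if m = k then t ^ k * (deriv ^^ k) f 0 else 0)"
    using w by (intro sum.cong refl) (simp add: fd_weights_def)
  then have eq: "(\<Sum>m<Suc k. (deriv ^^ m) f 0 * t ^ m * ((\<Sum>j\<le>k. w j * real j ^ m) / fact m)) = t ^ k * (deriv ^^ k) f 0"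
    by simp
  have "(\<Sum>m<Suc (Suc k). (deriv ^^ m) f 0 * t ^ m * ((\<Sum>j\<le>k. w j * real j ^ m) / fact m))
     = t ^ k * (deriv ^^ k) f 0 + fd_error k w * t ^ Suc k * (deriv ^^ Suc k) f 0"
    by (subst sum.lessThan_Suc, subst eq) (simp only: mult_ac fd_error_def)
  with fd_approximation[OF w f I M t] show ?thesis
    by (simp only: diff_diff_eq)
qed

text \<open>For fixed \<open>t\<close> the difference \<open>A s t\<close> is a finite sum of values
  on horizontal lines and so continuous in \<open>s\<close>. By the local bound on the next
  derivative it approximates \<open>t ^ k * \<phi> s\<close> with an error of order
  \<open>k + 1\<close> in \<open>t\<close>, uniformly in \<open>s\<close>. So \<open>t\<close> is
  fixed first, and only then \<open>s\<close> tends to \<open>0\<close>.\<close>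

lemma smooth_along2_deriv_tendsto:
  assumes g: "smooth_along2 W g" and W: "(0, 0) \<in> W"
  shows "((\<lambda>s. (deriv ^^ k) (g s) 0) \<longlongrightarrow> (deriv ^^ k) (g 0) 0) (at 0)"
proof -
  obtain w where w: "fd_weights k w" using fd_weights_exists by blast
  obtain \<delta> M where \<delta>: "\<delta> > 0" and
    D: "\<And>s t. \<bar>s\<bar> < \<delta> \<Longrightarrow> \<bar>t\<bar> < \<delta> \<Longrightarrow> (s, t) \<in> W \<and> \<bar>(deriv ^^ Suc k) (g s) t\<bar> \<le> M"
    using smooth_along2_bounded_deriv[OF assms, of "Suc k"] by blast
  define C where "C = \<bar>(\<Sum>j\<le>k. \<bar>w j\<bar> * real j ^ Suc k) * M\<bar> + 1"
  have C: "C > 0" by (simp add: C_def)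
  define \<phi> where "\<phi> s = (deriv ^^ k) (g s) 0" for s
  define A where "A s t = (\<Sum>j\<le>k. w j * g s (real j * t))" for s t
  have fd: "\<bar>A s t - t ^ k * \<phi> s\<bar> \<le> C * \<bar>t\<bar> ^ Suc k" if "\<bar>s\<bar> < \<delta>" "real k * \<bar>t\<bar> < \<delta>" for s t
  proof -
    have "\<bar>A s t - t ^ k * \<phi> s\<bar> \<le> (\<Sum>j\<le>k. \<bar>w j\<bar> * real j ^ Suc k) * M * \<bar>t\<bar> ^ Suc k"
      unfolding A_def \<phi>_def
      by (rule fd_approximation1[OF w smooth_along2_slice(2)[OF g] _ _ that(2)]) (use D that(1) in auto)
    also have "\<dots> \<le> C * \<bar>t\<bar> ^ Suc k" by (intro mult_right_mono) (auto simp: C_def)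
    finally show ?thesis .
  qed
  have "(\<phi> \<longlongrightarrow> \<phi> 0) (at 0)"
  proof (rule tendstoI)
    fix e :: real assume e: "e > 0"
    \<comment> \<open>The first bound makes the approximation error at most
      \<open>e / 4 * t ^ k\<close> at \<open>s\<close> and at \<open>0\<close>; the second keeps all
      sampling points \<open>j * t\<close> within distance \<open>\<delta>\<close>.\<close>
    define t where "t = min (e / (4 * C)) (\<delta> / (real k + 1))"
    have t: "t > 0" using e C \<delta> by (auto simp: t_def)
    have kt: "real k * \<bar>t\<bar> < \<delta>"
    proof -
      have "real k * \<bar>t\<bar> < (real k + 1) * t" using t by (simp add: distrib_right)
      also have "\<dots> \<le> (real k + 1) * (\<delta> / (real k + 1))" by (intro mult_left_mono) (auto simp: t_def)
      finally show ?thesis by simp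
    qed
    have "t \<le> e / (4 * C)" by (simp add: t_def)
    then have Ct: "C * t \<le> e / 4" using C by (simp add: field_simps)
    have "((\<lambda>s. A s t) \<longlongrightarrow> A 0 t) (at 0)"
      unfolding A_def
    proof (intro tendsto_sum tendsto_mult tendsto_const)
      fix j assume "j \<in> {..k}"
      then have "real j * t \<le> real k * t" using t by (simp add: mult_right_mono)
      moreover have "real k * t < \<delta>" using kt t by simp
      ultimately have "real j * t < \<delta>" by linarith
      with t have j: "\<bar>real j * t\<bar> < \<delta>" by (simp add: abs_mult)
      have "((\<lambda>s. g s (real j * t)) has_real_derivative deriv (\<lambda>s. g s (real j * t)) 0) (at 0)"
        by (rule smooth_real_on_DERIV[OF smooth_along2_slice(4)[OF g]]) (use D[of 0] \<delta> j in auto)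
      then show "((\<lambda>s. g s (real j * t)) \<longlongrightarrow> g 0 (real j * t)) (at 0)"
        using DERIV_isCont isCont_def by blast
    qed
    then have "\<forall>\<^sub>F s in at 0. dist (A s t) (A 0 t) < e / 2 * t ^ k"
      by (rule tendstoD) (use e t in auto)
    moreover have "\<forall>\<^sub>F s in at 0. \<bar>s\<bar> < \<delta>" using \<delta> by (auto simp: eventually_at intro!: exI[of _ \<delta>])
    ultimately show "\<forall>\<^sub>F s in at 0. dist (\<phi> s) (\<phi> 0) < e"
    proof eventually_elim
      case (elim s)
      have "t ^ k * \<phi> s - t ^ k * \<phi> 0 = (A s t - A 0 t) - (A s t - t ^ k * \<phi> s) + (A 0 t - t ^ k * \<phi> 0)"
        by simp
      moreover have "\<bar>A s t - t ^ k * \<phi> s\<bar> \<le> e / 4 * t ^ k" "\<bar>A 0 t - t ^ k * \<phi> 0\<bar> \<le> e / 4 * t ^ k"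
      proof -
        have "C * \<bar>t\<bar> ^ Suc k \<le> e / 4 * t ^ k" using t mult_right_mono[OF Ct, of "t ^ k"] by (simp add: mult_ac)
        with fd[OF elim(2) kt] fd[OF _ kt, of 0] \<delta>
        show "\<bar>A s t - t ^ k * \<phi> s\<bar> \<le> e / 4 * t ^ k" "\<bar>A 0 t - t ^ k * \<phi> 0\<bar> \<le> e / 4 * t ^ k" by auto
      qed
      ultimately have "\<bar>t ^ k * \<phi> s - t ^ k * \<phi> 0\<bar> < e * t ^ k"
        using elim(1) unfolding dist_real_def by linarith
      moreover have "\<bar>t ^ k * \<phi> s - t ^ k * \<phi> 0\<bar> = t ^ k * \<bar>\<phi> s - \<phi> 0\<bar>"
        unfolding right_diff_distrib[symmetric] using t by (simp add: abs_mult)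
      ultimately have "t ^ k * \<bar>\<phi> s - \<phi> 0\<bar> < t ^ k * e" by (simp only: mult.commute)
      then show ?case using t by (simp add: dist_real_def)
    qed
  qed
  then show ?thesis by (simp add: \<phi>_def[abs_def])
qed

text \<open>On the line \<open>t = s\<close>, the finite difference \<open>\<Sum>j\<le>k. w j * g s (j * t)\<close> is a smooth function
  of one variable; comparing its Taylor expansion with the one in \<open>t\<close> gives the derivative in \<open>s\<close> of
  the \<open>k\<close>-th derivative in \<open>t\<close>.\<close>

lemma smooth_along2_DERIV_deriv_0:
  assumes g: "smooth_along2 W g" and W: "(0, 0) \<in> W" and w: "fd_weights k w"
  shows "(deriv ^^ k) (\<lambda>s. \<Sum>j\<le>k. w j * g s (real j * s)) 0 = fact k * (deriv ^^ k) (g 0) 0"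
    and "((\<lambda>s. (deriv ^^ k) (g s) 0) has_real_derivative
       (\<Sum>j\<le>k. w j * (deriv ^^ Suc k) (\<lambda>u. g u (real j * u)) 0) / fact (Suc k)
       - fd_error k w * (deriv ^^ Suc k) (g 0) 0) (at 0)"
proof -
  obtain \<delta> M where \<delta>: "\<delta> > 0" and
    D: "\<And>s t. \<bar>s\<bar> < \<delta> \<Longrightarrow> \<bar>t\<bar> < \<delta> \<Longrightarrow> (s, t) \<in> W \<and> \<bar>(deriv ^^ Suc (Suc k)) (g s) t\<bar> \<le> M"
    using smooth_along2_bounded_deriv[OF g W, of "Suc (Suc k)"] by blast
  define \<eta> where "\<eta> = \<delta> / (real k + 1)"
  have \<eta>: "\<eta> > 0" "\<eta> \<le> \<delta>" using \<delta> by (auto simp: \<eta>_def field_simps)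
  have k\<eta>: "real k * \<bar>s\<bar> < \<delta>" if "\<bar>s\<bar> < \<eta>" for s
  proof -
    have "real k * \<bar>s\<bar> \<le> (real k + 1) * \<bar>s\<bar>" by (simp add: distrib_right)
    also have "\<dots> < (real k + 1) * \<eta>" using that by (intro mult_strict_left_mono) auto
    finally show ?thesis by (simp add: \<eta>_def)
  qed
  define N where "N = ball (0::real) \<eta>"
  have N: "open N" "0 \<in> N" using \<eta> by (auto simp: N_def)
  have gj: "smooth_real_on N (\<lambda>s. g s (real j * s))" if "j \<le> k" for j
  proof (rule smooth_real_on_subset)
    show "smooth_real_on {r. (r, real j * r) \<in> W} (\<lambda>s. g s (real j * s))"
      by (rule smooth_along2D(2)[OF g]) (auto intro!: smooth_intros)
    show "N \<subseteq> {r. (r, real j * r) \<in> W}"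
    proof
      fix r assume "r \<in> N"
      then have r: "\<bar>r\<bar> < \<eta>" by (simp add: N_def dist_real_def)
      have "\<bar>real j * r\<bar> \<le> real k * \<bar>r\<bar>" using that by (simp add: abs_mult mult_right_mono)
      then have "\<bar>real j * r\<bar> < \<delta>" using k\<eta>[OF r] by linarith
      then show "r \<in> {r. (r, real j * r) \<in> W}" using D[of r "real j * r"] r \<eta> by auto
    qed
  qed
  define A where "A s = (\<Sum>j\<le>k. w j * g s (real j * s))" for s
  have A: "smooth_real_on N A" unfolding A_def
    by (intro smooth_intros N gj) auto
  define \<phi> where "\<phi> s = (deriv ^^ k) (g s) 0" for s
  define \<phi>' where "\<phi>' s = (deriv ^^ Suc k) (g s) 0" for s
  define \<kappa> where "\<kappa> = fd_error k w"
  have \<phi>lim: "(\<phi> \<longlongrightarrow> \<phi> 0) (at 0)" and \<phi>'lim: "(\<phi>' \<longlongrightarrow> \<phi>' 0) (at 0)"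
    unfolding \<phi>_def \<phi>'_def by (rule smooth_along2_deriv_tendsto[OF g W])+
  \<comment> \<open>The remainder of the expansion in \<open>t\<close>, taken at
    \<open>t = s\<close> and divided by \<open>s ^ Suc k\<close>. The uniform bound on the
    derivative of order \<open>k + 2\<close> makes it tend to \<open>0\<close>.\<close>
  define E where "E s = (A s - s ^ k * \<phi> s - \<kappa> * s ^ Suc k * \<phi>' s) / s ^ Suc k" for s
  define C where "C = (\<Sum>j\<le>k. \<bar>w j\<bar> * real j ^ Suc (Suc k)) * M"
  have E: "(E \<longlongrightarrow> 0) (at 0)"
  proof (rule Lim_null_comparison)
    have "\<bar>E s\<bar> \<le> C * \<bar>s\<bar>" if "\<bar>s\<bar> < \<eta>" "s \<noteq> 0" for s
    proof -
      have "\<bar>A s - s ^ k * \<phi> s - \<kappa> * s ^ Suc k * \<phi>' s\<bar> \<le> C * \<bar>s\<bar> ^ Suc (Suc k)"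
        unfolding A_def \<phi>_def \<phi>'_def \<kappa>_def C_def
        by (rule fd_approximation2[OF w smooth_along2_slice(2)[OF g] _ _ k\<eta>[OF that(1)]])
           (use D \<eta> that(1) in auto)
      then have "\<bar>A s - s ^ k * \<phi> s - \<kappa> * s ^ Suc k * \<phi>' s\<bar> \<le> C * \<bar>s\<bar> * \<bar>s\<bar> ^ Suc k"
        by (simp add: mult_ac)
      then have "\<bar>A s - s ^ k * \<phi> s - \<kappa> * s ^ Suc k * \<phi>' s\<bar> / \<bar>s\<bar> ^ Suc k \<le> C * \<bar>s\<bar>"
        using that(2) by (subst pos_divide_le_eq) auto
      then show ?thesis unfolding E_def by (simp only: abs_divide power_abs)
    qed
    then show "\<forall>\<^sub>F s in at 0. norm (E s) \<le> C * \<bar>s\<bar>"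
      using \<eta>(1) by (auto simp: eventually_at intro!: exI[of _ \<eta>])
    show "((\<lambda>s. C * \<bar>s\<bar>) \<longlongrightarrow> 0) (at 0)" by (auto intro!: tendsto_eq_intros)
  qed
  \<comment> \<open>Continuity of \<open>\<phi>\<close> alone shows that \<open>A\<close> is
    \<open>\<phi> 0 * s ^ k\<close> up to \<open>o(s^k)\<close>, which fixes the derivatives of
    \<open>A\<close> up to order \<open>k\<close>.\<close>
  have "((\<lambda>s. E s * s + (\<phi> s - \<phi> 0) + \<kappa> * s * \<phi>' s) \<longlongrightarrow> 0 * 0 + (\<phi> 0 - \<phi> 0) + \<kappa> * 0 * \<phi>' 0) (at 0)"
    by (intro tendsto_intros E \<phi>lim \<phi>'lim)
  moreover have "\<forall>\<^sub>F s in at 0. E s * s + (\<phi> s - \<phi> 0) + \<kappa> * s * \<phi>' s = (A s - \<phi> 0 * s ^ k) / s ^ k"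
    by (auto simp: eventually_at E_def field_simps intro!: exI[of _ 1])
  ultimately have "((\<lambda>s. (A s - \<phi> 0 * s ^ k) / s ^ k) \<longlongrightarrow> 0) (at 0)"
    using tendsto_cong by force
  note u = taylor_unique[OF N A this]
  show "(deriv ^^ k) (\<lambda>s. \<Sum>j\<le>k. w j * g s (real j * s)) 0 = fact k * (deriv ^^ k) (g 0) 0"
    using u(2) by (simp add: \<phi>_def A_def[abs_def])
  have "(\<Sum>m<Suc k. (deriv ^^ m) A 0 / fact m * s ^ m) = \<phi> 0 * s ^ k" for s
  proof -
    have "(\<Sum>m<Suc k. (deriv ^^ m) A 0 / fact m * s ^ m) = (\<Sum>m<Suc k. if m = k then \<phi> 0 * s ^ k else 0)"
      by (intro sum.cong refl) (use u in auto)
    then show ?thesis by simp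
  qed
  with taylor_tendsto[OF N A, of "Suc k"]
  have L: "((\<lambda>s. (A s - \<phi> 0 * s ^ k) / s ^ Suc k) \<longlongrightarrow> (deriv ^^ Suc k) A 0 / fact (Suc k)) (at 0)"
    by (simp only:)
  \<comment> \<open>By the definition of \<open>E\<close>, this expression is the difference
    quotient of \<open>\<phi>\<close> at \<open>0\<close>. The existence of its limit thus follows
    from the Taylor expansion of \<open>A\<close> to one order more.\<close>
  have "((\<lambda>s. (A s - \<phi> 0 * s ^ k) / s ^ Suc k - E s - \<kappa> * \<phi>' s) \<longlongrightarrow> (deriv ^^ Suc k) A 0 / fact (Suc k) - 0 - \<kappa> * \<phi>' 0) (at 0)"
    by (intro tendsto_intros E \<phi>'lim L)
  moreover have "\<forall>\<^sub>F s in at 0. (A s - \<phi> 0 * s ^ k) / s ^ Suc k - E s - \<kappa> * \<phi>' s = (\<phi> (0 + s) - \<phi> 0) / s"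
    by (auto simp: eventually_at E_def field_simps intro!: exI[of _ 1])
  ultimately have "(\<phi> has_real_derivative (deriv ^^ Suc k) A 0 / fact (Suc k) - \<kappa> * \<phi>' 0) (at 0)"
    unfolding DERIV_def using tendsto_cong by force
  moreover have "(deriv ^^ Suc k) A 0 = (\<Sum>j\<le>k. w j * (deriv ^^ Suc k) (\<lambda>u. g u (real j * u)) 0)"
    unfolding A_def
    by (subst higher_deriv_sum[OF N(1) _ N(2)])
       (auto intro!: smooth_intros N gj sum.cong higher_deriv_cmult[OF N(1) _ N(2)] simp del: funpow.simps)
  ultimately show "((\<lambda>s. (deriv ^^ k) (g s) 0) has_real_derivative
       (\<Sum>j\<le>k. w j * (deriv ^^ Suc k) (\<lambda>u. g u (real j * u)) 0) / fact (Suc k)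
       - fd_error k w * (deriv ^^ Suc k) (g 0) 0) (at 0)"
    by (simp only: \<phi>_def[abs_def] \<phi>'_def \<kappa>_def)
qed

text \<open>The derivative in \<open>s\<close> is a combination of derivatives of order
  \<open>k + 1\<close> of \<open>g\<close> and of its shears
  \<open>G j s u = g (s + u) (j * u)\<close>. Shears stay smooth along curves, so the induction
  closes when \<open>g\<close>, \<open>W\<close> and \<open>k\<close> are all left
  arbitrary.\<close>

lemma smooth_along2_ndiff_deriv:
  "smooth_along2 W g \<Longrightarrow> ndiff n {s. (s, 0) \<in> W} (\<lambda>s. (deriv ^^ k) (g s) 0)"
proof (induction n arbitrary: k W g)
  case (Suc n)
  obtain w where w: "fd_weights k w" using fd_weights_exists by blast
  define W' where "W' j = {(s, u). (0 + 1 * s + 1 * u, 0 + 0 * s + real j * u) \<in> W}" for j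
  define G where "G j s u = g (0 + 1 * s + 1 * u) (0 + 0 * s + real j * u)" for j s u
  have G: "smooth_along2 (W' j) (G j)" for j
    unfolding W'_def G_def by (rule smooth_along2_affine[OF Suc.prems])
  show ?case
  proof (rule ndiff_SucI)
    fix s assume s: "s \<in> {s. (s, 0) \<in> W}"
    have sa: "smooth_along2 {(u, t). (s + 1 * u + 0 * t, 0 + 0 * u + 1 * t) \<in> W}
        (\<lambda>u t. g (s + 1 * u + 0 * t) (0 + 0 * u + 1 * t))"
      by (rule smooth_along2_affine[OF Suc.prems])
    have "((\<lambda>u. (deriv ^^ k) (g (s + u)) 0) has_real_derivative
       (\<Sum>j\<le>k. w j * (deriv ^^ Suc k) (G j s) 0) / fact (Suc k)
       - fd_error k w * (deriv ^^ Suc k) (g s) 0) (at 0)"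
      using smooth_along2_DERIV_deriv_0(2)[OF sa _ w] s by (simp add: G_def[abs_def] del: funpow.simps)
    then show "((\<lambda>s. (deriv ^^ k) (g s) 0) has_real_derivative
       (\<Sum>j\<le>k. w j * (deriv ^^ Suc k) (G j s) 0) * inverse (fact (Suc k))
       + (- (fd_error k w)) * (deriv ^^ Suc k) (g s) 0) (at s)"
      using DERIV_shift[of "\<lambda>s. (deriv ^^ k) (g s) 0" _ 0 s] by (simp add: add.commute divide_inverse del: funpow.simps)
  next
    have "ndiff n {s. (s, 0) \<in> W} (\<lambda>s. (deriv ^^ Suc k) (G j s) 0)" for j
      using Suc.IH[OF G, of j "Suc k"] by (simp add: W'_def del: funpow.simps)
    then show "ndiff n {s. (s, 0) \<in> W} (\<lambda>s. (\<Sum>j\<le>k. w j * (deriv ^^ Suc k) (G j s) 0) * inverse (fact (Suc k))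
       + (- (fd_error k w)) * (deriv ^^ Suc k) (g s) 0)"
      by (intro ndiff_add ndiff_mult ndiff_sum ndiff_const Suc.IH[OF Suc.prems])
  qed
qed auto

theorem smooth_along2_partial_deriv:
  assumes "smooth_along2 W g"
  shows "smooth_real_on {s. (s, 0) \<in> W} (\<lambda>s. deriv (g s) 0)"
  unfolding smooth_real_on_iff_ndiff[OF smooth_along2_slice(3)[OF assms]]
  using smooth_along2_ndiff_deriv[OF assms, of _ 1] by simp

section \<open>First and second order formulas on the diagonal\<close>

lemma fd_weights_1: "fd_weights 1 (\<lambda>j. if j = 0 then -1 else 1)"
  by (auto simp: fd_weights_def le_Suc_eq)

lemma smooth_along2_diagonal_smooth:
  assumes g: "smooth_along2 W g"
  shows "smooth_real_on {s. (s, s) \<in> W} (\<lambda>s. g s s)"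
  using smooth_along2D(2)[OF g smooth_id smooth_id] by simp

text \<open>The forward difference \<open>g s s - g s 0\<close> is differentiable at
  \<open>0\<close> with derivative \<open>deriv (g 0) 0\<close>, by the first finite difference
  formula with \<open>k = 1\<close>.\<close>

lemma smooth_along2_chain_rule:
  assumes g: "smooth_along2 W g" and W: "(0, 0) \<in> W"
  shows "((\<lambda>s. g s s) has_real_derivative deriv (\<lambda>s. g s 0) 0 + deriv (g 0) 0) (at 0)"
proof -
  have d: "((\<lambda>s. g s s) has_real_derivative deriv (\<lambda>s. g s s) 0) (at 0)"
    by (rule smooth_real_on_DERIV[OF smooth_along2_diagonal_smooth[OF g]]) (use W in simp)
  moreover have s0: "((\<lambda>s. g s 0) has_real_derivative deriv (\<lambda>s. g s 0) 0) (at 0)"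
    by (rule smooth_real_on_DERIV[OF smooth_along2_slice(4)[OF g]]) (use W in simp)
  ultimately have "((\<lambda>s. - g s 0 + g s s) has_real_derivative - deriv (\<lambda>s. g s 0) 0 + deriv (\<lambda>s. g s s) 0) (at 0)"
    by (intro DERIV_add DERIV_minus)
  then have "deriv (\<lambda>s. - g s 0 + g s s) 0 = - deriv (\<lambda>s. g s 0) 0 + deriv (\<lambda>s. g s s) 0"
    by (rule DERIV_imp_deriv)
  moreover have "deriv (\<lambda>s. - g s 0 + g s s) 0 = deriv (g 0) 0"
    using smooth_along2_DERIV_deriv_0(1)[OF g W fd_weights_1] by simp
  ultimately have "deriv (\<lambda>s. g s s) 0 = deriv (\<lambda>s. g s 0) 0 + deriv (g 0) 0" by linarith
  with d show ?thesis by (simp only:)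
qed

text \<open>Polarization: the mixed derivative is expressed through second derivatives along the
  diagonal and the two axes. The expression is symmetric in the two variables, hence so are the
  mixed derivatives. The axis term in \<open>g 0\<close> comes from the error coefficient
  \<open>1/2\<close> of the forward difference.\<close>

lemma smooth_along2_mixed_deriv:
  assumes g: "smooth_along2 W g" and W: "(0, 0) \<in> W"
  shows "((\<lambda>s. deriv (g s) 0) has_real_derivative
      ((deriv ^^ 2) (\<lambda>s. g s s) 0 - (deriv ^^ 2) (\<lambda>s. g s 0) 0 - (deriv ^^ 2) (g 0) 0) / 2) (at 0)"
proof -
  have "((\<lambda>s. deriv (g s) 0) has_real_derivative
      (- (deriv ^^ 2) (\<lambda>s. g s 0) 0 + (deriv ^^ 2) (\<lambda>s. g s s) 0) / 2 - 1/2 * (deriv ^^ 2) (g 0) 0) (at 0)"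
    using smooth_along2_DERIV_deriv_0(2)[OF g W fd_weights_1]
    by (simp add: numeral_2_eq_2 fd_error_def)
  then show ?thesis by (rule DERIV_cong) (simp add: field_simps)
qed

section \<open>Curves in convenient vector spaces\<close>

text \<open>The part of convenience that makes velocities unique. It is kept apart because it is
  what gets established for the product functionals of the semidirect product.\<close>

definition separating :: "('e::real_vector \<Rightarrow> real) set \<Rightarrow> bool" where
  "separating D \<longleftrightarrow> (\<forall>l\<in>D. linear l) \<and> (\<forall>x. (\<forall>l\<in>D. l x = 0) \<longrightarrow> x = 0)"

lemma convenient_linear: "convenient D \<Longrightarrow> l \<in> D \<Longrightarrow> linear l"
  by (simp add: convenient_def)

lemma convenient_complete: "convenient D \<Longrightarrow> smooth_curve_on D UNIV c \<Longrightarrow> \<exists>v. has_velocity D c v t"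
  by (simp add: convenient_def)

lemma convenient_mem:
  "convenient D \<Longrightarrow> linear l \<Longrightarrow>
    (\<And>c. smooth_curve_on D UNIV c \<Longrightarrow> smooth (\<lambda>t. l (c t))) \<Longrightarrow> l \<in> D"
  by (simp add: convenient_def)

lemma convenient_imp_separating: "convenient D \<Longrightarrow> separating D"
  by (auto simp: convenient_def separating_def)

lemma separating_eqI:
  assumes "separating D" "\<And>l. l \<in> D \<Longrightarrow> l x = l y"
  shows "x = y"
proof -
  have "l (x - y) = 0" if "l \<in> D" for l
    using assms that by (simp add: separating_def linear_diff)
  then have "x - y = 0" using assms(1) unfolding separating_def by blast
  then show ?thesis by simp
qed

lemma velocity_eqI:
  assumes "separating D" "has_velocity D c v t"
  shows "velocity D c t = v"
  unfolding velocity_def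
proof (rule the_equality)
  show "has_velocity D c v t" by (rule assms(2))
  fix v' assume "has_velocity D c v' t"
  then show "v' = v" using assms
    by (intro separating_eqI[OF assms(1)]) (auto simp: has_velocity_def intro: DERIV_unique)
qed

lemma has_velocity_cong:
  assumes "open N" "t \<in> N" "\<And>s. s \<in> N \<Longrightarrow> c s = d s"
  shows "has_velocity D c v t \<longleftrightarrow> has_velocity D d v t"
proof -
  have "((\<lambda>s. l (c s)) has_real_derivative l v) (at t) \<longleftrightarrow> ((\<lambda>s. l (d s)) has_real_derivative l v) (at t)" for l
    by (rule DERIV_cong_ev[OF refl _ refl]) (use assms in \<open>auto simp: eventually_nhds\<close>)
  then show ?thesis unfolding has_velocity_def by simp
qed

lemma velocity_cong:
  assumes "open N" "t \<in> N" "\<And>s. s \<in> N \<Longrightarrow> c s = d s"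
  shows "velocity D c t = velocity D d t"
  unfolding velocity_def using has_velocity_cong[OF assms] by simp

lemma has_velocity_const: "separating D \<Longrightarrow> has_velocity D (\<lambda>_. c) 0 t"
  by (auto simp: has_velocity_def separating_def linear_0)

lemma has_velocity_add:
  assumes "separating D" "has_velocity D c v t" "has_velocity D d w t"
  shows "has_velocity D (\<lambda>s. c s + d s) (v + w) t"
  using assms by (auto simp: has_velocity_def separating_def linear_add intro!: DERIV_add)

lemma has_velocity_scale_line: 
  assumes "separating D"
  shows "has_velocity D (\<lambda>s. a + s *\<^sub>R x) x t"
  unfolding has_velocity_def
proof
  fix l assume "l \<in> D"
  then have "linear l" using assms by (simp add: separating_def)
  then have "(\<lambda>s. l (a + s *\<^sub>R x)) = (\<lambda>s. l a + s * l x)" by (simp add: linear_add linear_scale)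
  then show "((\<lambda>s. l (a + s *\<^sub>R x)) has_real_derivative l x) (at t)"
    by (auto intro!: derivative_eq_intros)
qed

section \<open>Smooth curves and their velocities\<close>

lemma smooth_curve_on_subset:
  assumes "smooth_curve_on D I c" "J \<subseteq> I"
  shows "smooth_curve_on D J c"
  unfolding smooth_curve_on_def
proof
  fix l assume "l \<in> D"
  with assms(1) have "smooth_real_on I (\<lambda>t. l (c t))" unfolding smooth_curve_on_def by blast
  then show "smooth_real_on J (\<lambda>t. l (c t))" using assms(2) by (rule smooth_real_on_subset)
qed

lemma smooth_curve_on_cong:
  assumes "open I" "smooth_curve_on D I c" "\<And>t. t \<in> I \<Longrightarrow> d t = c t"
  shows "smooth_curve_on D I d"
  unfolding smooth_curve_on_def
proof
  fix l assume "l \<in> D"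
  show "smooth_real_on I (\<lambda>t. l (d t))"
    by (rule smooth_real_on_cong[OF assms(1), of "\<lambda>t. l (c t)"])
       (use assms \<open>l \<in> D\<close> in \<open>auto simp: smooth_curve_on_def\<close>)
qed

lemma smooth_curve_on_compose:
  assumes "open I" "open J" "smooth_curve_on D J c" "smooth_real_on I a" "a ` I \<subseteq> J"
  shows "smooth_curve_on D I (\<lambda>t. c (a t))"
  unfolding smooth_curve_on_def
proof
  fix l assume "l \<in> D"
  with assms(3) have "smooth_real_on J (\<lambda>t. l (c t))" unfolding smooth_curve_on_def by blast
  then show "smooth_real_on I (\<lambda>t. l (c (a t)))"
    by (rule smooth_compose[OF assms(1,2) _ assms(4,5)])
qed

lemma smooth_curve_on_add:
  assumes "separating D" "open I" "smooth_curve_on D I c" "smooth_curve_on D I d"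
  shows "smooth_curve_on D I (\<lambda>t. c t + d t)"
  using assms by (auto simp: smooth_curve_on_def separating_def linear_add intro!: smooth_add)

lemma smooth_curve_on_diff:
  assumes "separating D" "open I" "smooth_curve_on D I c" "smooth_curve_on D I d"
  shows "smooth_curve_on D I (\<lambda>t. c t - d t)"
  using assms by (auto simp: smooth_curve_on_def separating_def linear_diff intro!: smooth_diff)

lemma smooth_curve_on_scale:
  assumes "separating D" "open I" "smooth_real_on I a" "smooth_curve_on D I c"
  shows "smooth_curve_on D I (\<lambda>t. a t *\<^sub>R c t)"
  using assms by (auto simp: smooth_curve_on_def separating_def linear_scale intro!: smooth_mult)

lemma smooth_curve_on_const: "open I \<Longrightarrow> smooth_curve_on D I (\<lambda>_. x)"
  by (auto simp: smooth_curve_on_def intro: smooth_const)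

text \<open>Completeness speaks of curves on the whole line. After reparametrization it yields a
  velocity of \<open>c \<circ> \<gamma>\<close>, and the chain rule for \<open>\<kappa>\<close>
  transports it back to \<open>c\<close>.\<close>

lemma convenient_has_velocity:
  assumes D: "convenient D" and "open J" "smooth_curve_on D J c" "t \<in> J"
  shows "has_velocity D c (velocity D c t) t"
proof -
  obtain \<gamma> \<kappa> N \<epsilon> where \<gamma>: "smooth \<gamma>" "range \<gamma> \<subseteq> J" "\<gamma> 0 = t"
    and N: "open N" "t \<in> N" "N \<subseteq> J" "smooth_real_on N \<kappa>" "\<kappa> t = 0" "\<And>s. s \<in> N \<Longrightarrow> \<gamma> (\<kappa> s) = s"
    and \<kappa>: "(\<kappa> has_real_derivative \<epsilon>) (at t)"
    by (rule local_reparametrization[OF assms(2,4)]) (rule that)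
  have "smooth_curve_on D UNIV (\<lambda>r. c (\<gamma> r))"
    by (rule smooth_curve_on_compose[OF _ assms(2,3) \<gamma>(1,2)]) simp
  then obtain v where v: "has_velocity D (\<lambda>r. c (\<gamma> r)) v 0"
    using convenient_complete[OF D] by blast
  have "has_velocity D (\<lambda>s. c (\<gamma> (\<kappa> s))) (\<epsilon> *\<^sub>R v) t"
    unfolding has_velocity_def
  proof
    fix l assume l: "l \<in> D"
    then have "((\<lambda>r. l (c (\<gamma> r))) has_real_derivative l v) (at (\<kappa> t))"
      using v N(5) by (simp add: has_velocity_def)
    from DERIV_chain2[OF this \<kappa>]
    show "((\<lambda>s. l (c (\<gamma> (\<kappa> s)))) has_real_derivative l (\<epsilon> *\<^sub>R v)) (at t)"
      by (simp add: linear_scale[OF convenient_linear[OF D l]] mult.commute)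
  qed
  then have "has_velocity D c (\<epsilon> *\<^sub>R v) t"
    using has_velocity_cong[OF N(1,2), of c "\<lambda>s. c (\<gamma> (\<kappa> s))"] N(6) by simp
  with velocity_eqI[OF convenient_imp_separating[OF D] this] show ?thesis by simp
qed

lemma functional_velocity:
  assumes D: "convenient D" and "open J" "smooth_curve_on D J c" "t \<in> J" "l \<in> D"
  shows "l (velocity D c t) = deriv (\<lambda>s. l (c s)) t"
  using convenient_has_velocity[OF assms(1-4)] assms(5)
  by (auto simp: has_velocity_def dest!: DERIV_imp_deriv)

lemma smooth_curve_on_velocity:
  assumes D: "convenient D" and "open J" "smooth_curve_on D J c"
  shows "smooth_curve_on D J (velocity D c)"
  unfolding smooth_curve_on_def
proof
  fix l assume l: "l \<in> D"
  have "smooth_real_on J (deriv (\<lambda>s. l (c s)))"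
    by (rule smooth_real_on_deriv(1)) (use assms(3) l in \<open>auto simp: smooth_curve_on_def\<close>)
  then show "smooth_real_on J (\<lambda>t. l (velocity D c t))"
    by (rule smooth_real_on_cong[OF assms(2)]) (rule functional_velocity[OF assms _ l])
qed

lemma functional_velocity2:
  assumes D: "convenient D" and J: "open J" and c: "smooth_curve_on D J c" and "t \<in> J" and l: "l \<in> D"
  shows "l (velocity D (velocity D c) t) = (deriv ^^ 2) (\<lambda>r. l (c r)) t"
proof -
  have "l (velocity D (velocity D c) t) = deriv (\<lambda>r. l (velocity D c r)) t"
    by (rule functional_velocity[OF D J smooth_curve_on_velocity[OF D J c] \<open>t \<in> J\<close> l])
  also have "\<dots> = deriv (deriv (\<lambda>r. l (c r))) t"
    using higher_deriv_cong[OF J functional_velocity[OF D J c _ l] \<open>t \<in> J\<close>, where n = 1] by simp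
  finally show ?thesis by (simp add: numeral_2_eq_2)
qed

definition smooth_along :: "('e \<Rightarrow> real) set \<Rightarrow> 'e set \<Rightarrow> ('e \<Rightarrow> real) \<Rightarrow> bool" where
  "smooth_along D W \<Phi> \<longleftrightarrow> (\<forall>c. smooth_curve_on D UNIV c \<longrightarrow>
     open {r. c r \<in> W} \<and> smooth_real_on {r. c r \<in> W} (\<lambda>r. \<Phi> (c r)))"

lemma smooth_along_local:
  assumes "smooth_along D W \<Phi>" "open J" "smooth_curve_on D J c"
  shows "open {r \<in> J. c r \<in> W}" "smooth_real_on {r \<in> J. c r \<in> W} (\<lambda>r. \<Phi> (c r))"
proof -
  have "open {r. c (\<gamma> r) \<in> W} \<and> smooth_real_on {r. c (\<gamma> r) \<in> W} (\<lambda>r. \<Phi> (c (\<gamma> r)))"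
    if "smooth \<gamma>" "range \<gamma> \<subseteq> J" for \<gamma>
    using assms(1) smooth_curve_on_compose[OF open_UNIV assms(2,3) that]
    unfolding smooth_along_def by blast
  from smooth_localize[where c = c and W = W and \<Phi> = \<Phi>, OF assms(2) this]
  show "open {r \<in> J. c r \<in> W}" "smooth_real_on {r \<in> J. c r \<in> W} (\<lambda>r. \<Phi> (c r))" by blast+
qed

text \<open>The bridge from the modelling space to the plane: a smooth planar curve becomes a smooth
  curve in the space under \<open>(s, t) \<mapsto> c s + t e(s)\<close>, so the results on two real
  variables apply to \<open>\<Phi>\<close>.\<close>

lemma smooth_along_plane:
  assumes D: "separating D" and \<Phi>: "smooth_along D W \<Phi>" and J: "open J"
    and c: "smooth_curve_on D J c" and e: "smooth_curve_on D J e"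
  shows "smooth_along2 {(s, t). s \<in> J \<and> c s + t *\<^sub>R e s \<in> W} (\<lambda>s t. \<Phi> (c s + t *\<^sub>R e s))"
  unfolding smooth_along2_def
proof (intro allI impI)
  fix a b :: "real \<Rightarrow> real"
  assume ab: "smooth a \<and> smooth b"
  define I where "I = a -` J"
  have "continuous_on UNIV a" using ab smooth_real_on_continuous_on by blast
  then have I: "open I" unfolding I_def by (rule open_vimage[OF J])
  have ca: "smooth_curve_on D I (\<lambda>r. c (a r))" "smooth_curve_on D I (\<lambda>r. e (a r))"
    by (rule smooth_curve_on_compose[OF I J c] smooth_curve_on_compose[OF I J e];
        use ab in \<open>auto simp: I_def intro: smooth_real_on_subset[OF _ subset_UNIV]\<close>)+
  have "smooth_curve_on D I (\<lambda>r. c (a r) + b r *\<^sub>R e (a r))"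
    by (intro smooth_curve_on_add smooth_curve_on_scale D I ca) (use ab in \<open>auto intro: smooth_real_on_subset[OF _ subset_UNIV]\<close>)
  from smooth_along_local[OF \<Phi> I this]
  show "open {r. (a r, b r) \<in> {(s, t). s \<in> J \<and> c s + t *\<^sub>R e s \<in> W}} \<and>
      smooth_real_on {r. (a r, b r) \<in> {(s, t). s \<in> J \<and> c s + t *\<^sub>R e s \<in> W}} (\<lambda>r. \<Phi> (c (a r) + b r *\<^sub>R e (a r)))"
    by (simp add: I_def)
qed

definition smooth_family :: "('e \<Rightarrow> real) set \<Rightarrow> (real \<times> real) set \<Rightarrow> (real \<Rightarrow> real \<Rightarrow> 'e) \<Rightarrow> bool" where
  "smooth_family D W f \<longleftrightarrow> (\<forall>l\<in>D. smooth_along2 W (\<lambda>s t. l (f s t)))"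

definition mixed :: "('e \<Rightarrow> real) set \<Rightarrow> (real \<Rightarrow> real \<Rightarrow> 'e) \<Rightarrow> 'e" where
  "mixed D f = velocity D (\<lambda>s. velocity D (f s) 0) 0"

text \<open>Openness of the domain is stated in \<open>smooth_family\<close> separately for each
  functional, so extracting it needs some member of \<open>D\<close>. The zero functional also
  embeds each factor's functionals into those of a product.\<close>

lemma zero_functional_mem: "convenient D \<Longrightarrow> (\<lambda>_. 0) \<in> D"
proof -
  assume D: "convenient D"
  have "linear (\<lambda>_::'a. 0::real)" by (rule linearI) auto
  moreover have "smooth (\<lambda>_. 0)" by (intro smooth_intros) auto
  ultimately show ?thesis by (intro convenient_mem[OF D])
qed

lemma smooth_family_slice:
  assumes "convenient D" "smooth_family D W f"
  shows "open {t. (s, t) \<in> W}" "smooth_curve_on D {t. (s, t) \<in> W} (f s)"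
    "open {t. (t, s) \<in> W}" "smooth_curve_on D {t. (t, s) \<in> W} (\<lambda>t. f t s)"
  using assms(2) zero_functional_mem[OF assms(1)] smooth_along2_slice
  unfolding smooth_family_def smooth_curve_on_def by blast+

lemma smooth_family_swap:
  "smooth_family D W f \<Longrightarrow> smooth_family D {(s, t). (t, s) \<in> W} (\<lambda>s t. f t s)"
  unfolding smooth_family_def using smooth_along2_swap by blast

lemma smooth_family_diagonal:
  assumes "convenient D" "smooth_family D W f"
  shows "open {s. (s, s) \<in> W}" "smooth_curve_on D {s. (s, s) \<in> W} (\<lambda>s. f s s)"
  using assms(2) zero_functional_mem[OF assms(1)] smooth_along2_diagonal_smooth
    smooth_along2D(1)[OF _ smooth_id smooth_id]
  unfolding smooth_family_def smooth_curve_on_def by blast+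

lemma functional_inner_velocity:
  assumes "convenient D" "smooth_family D W f" "(s, 0) \<in> W" "l \<in> D"
  shows "l (velocity D (f s) 0) = deriv (\<lambda>t. l (f s t)) 0"
  using functional_velocity[OF assms(1) smooth_family_slice(1,2)[OF assms(1,2)] _ assms(4)] assms(3) by simp

lemma smooth_inner_velocity:
  assumes D: "convenient D" and f: "smooth_family D W f"
  shows "smooth_curve_on D {s. (s, 0) \<in> W} (\<lambda>s. velocity D (f s) 0)"
  unfolding smooth_curve_on_def
proof
  fix l assume l: "l \<in> D"
  have "smooth_real_on {s. (s, 0) \<in> W} (\<lambda>s. deriv (\<lambda>t. l (f s t)) 0)"
    using smooth_along2_partial_deriv f l unfolding smooth_family_def by blast
  then show "smooth_real_on {s. (s, 0) \<in> W} (\<lambda>s. l (velocity D (f s) 0))"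
    by (rule smooth_real_on_cong[OF smooth_family_slice(3)[OF assms]])
       (use functional_inner_velocity[OF D f _ l] in simp)
qed

lemma has_velocity_mixed:
  assumes D: "convenient D" and f: "smooth_family D W f" and W: "(0, 0) \<in> W"
  shows "has_velocity D (\<lambda>s. velocity D (f s) 0) (mixed D f) 0"
  unfolding mixed_def
  by (rule convenient_has_velocity[OF D smooth_family_slice(3)[OF D f] smooth_inner_velocity[OF D f]])
     (use W in simp)

lemma functional_mixed:
  assumes D: "convenient D" and f: "smooth_family D W f" and W: "(0, 0) \<in> W" and l: "l \<in> D"
  shows "l (mixed D f) = ((deriv ^^ 2) (\<lambda>s. l (f s s)) 0 - (deriv ^^ 2) (\<lambda>s. l (f s 0)) 0
    - (deriv ^^ 2) (\<lambda>t. l (f 0 t)) 0) / 2"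
proof -
  have g: "smooth_along2 W (\<lambda>s t. l (f s t))" using f l by (simp add: smooth_family_def)
  have "((\<lambda>s. l (velocity D (f s) 0)) has_real_derivative l (mixed D f)) (at 0)"
    using has_velocity_mixed[OF D f W] l by (simp add: has_velocity_def)
  then have "((\<lambda>s. deriv (\<lambda>t. l (f s t)) 0) has_real_derivative l (mixed D f)) (at 0)"
    by (rule has_field_derivative_transform_within_open[OF _ smooth_family_slice(3)[OF D f, of 0]])
       (use W functional_inner_velocity[OF D f _ l] in auto)
  then show ?thesis using smooth_along2_mixed_deriv[OF g W] by (rule DERIV_unique)
qed

lemma mixed_swap:
  assumes D: "convenient D" and f: "smooth_family D W f" and W: "(0, 0) \<in> W"
  shows "mixed D (\<lambda>s t. f t s) = mixed D f"
proof (rule separating_eqI[OF convenient_imp_separating[OF D]])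
  fix l assume l: "l \<in> D"
  show "l (mixed D (\<lambda>s t. f t s)) = l (mixed D f)"
    using functional_mixed[OF D f W l] functional_mixed[OF D smooth_family_swap[OF f] _ l] W by simp
qed

lemma smooth_family_chain_rule:
  assumes D: "convenient D" and f: "smooth_family D W f" and W: "(0, 0) \<in> W"
  shows "velocity D (\<lambda>s. f s s) 0 = velocity D (\<lambda>s. f s 0) 0 + velocity D (f 0) 0"
proof (rule separating_eqI[OF convenient_imp_separating[OF D]])
  fix l assume l: "l \<in> D"
  have g: "smooth_along2 W (\<lambda>s t. l (f s t))" using f l by (simp add: smooth_family_def)
  have "l (velocity D (\<lambda>s. f s s) 0) = deriv (\<lambda>s. l (f s s)) 0"
    using functional_velocity[OF D smooth_family_diagonal[OF D f] _ l, of 0] W by simp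
  also have "\<dots> = deriv (\<lambda>s. l (f s 0)) 0 + deriv (\<lambda>t. l (f 0 t)) 0"
    by (rule DERIV_imp_deriv[OF smooth_along2_chain_rule[OF g W]])
  also have "\<dots> = l (velocity D (\<lambda>s. f s 0) 0) + l (velocity D (f 0) 0)"
    using functional_velocity[OF D smooth_family_slice(3,4)[OF D f] _ l] functional_inner_velocity[OF D f W l] W by simp
  finally show "l (velocity D (\<lambda>s. f s s) 0) = l (velocity D (\<lambda>s. f s 0) 0 + velocity D (f 0) 0)"
    by (simp add: linear_add[OF convenient_linear[OF D l]])
qed

subsection \<open>Hadamard quotients\<close>

text \<open>Differentiation under the integral sends \<open>\<integral>u^k \<psi>(u r) du\<close> to
  the integral with \<open>k + 1\<close> and \<open>\<psi>'\<close>, so these moment integrals form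
  a class for coinduction. The interval is symmetric about \<open>0\<close> so that
  \<open>u * r\<close> remains in it.\<close>

lemma smooth_integral_scaled:
  fixes \<epsilon> :: real
  defines "J \<equiv> {-\<epsilon><..<\<epsilon>}"
  assumes "smooth_real_on J \<psi>"
  shows "smooth_real_on J (\<lambda>r. integral {0..1} (\<lambda>u. \<psi> (u * r)))"
proof (rule smooth_coinduct[where C = "\<lambda>f. \<exists>\<psi> k. smooth_real_on J \<psi> \<and>
    f = (\<lambda>r. integral (cbox 0 1) (\<lambda>u. u ^ k * \<psi> (u * r)))"])
  show "\<exists>\<psi>' k. smooth_real_on J \<psi>' \<and> (\<lambda>r. integral {0..1} (\<lambda>u. \<psi> (u * r))) =
      (\<lambda>r. integral (cbox 0 1) (\<lambda>u. u ^ k * \<psi>' (u * r)))"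
    using assms by (intro exI[of _ \<psi>] exI[of _ 0]) auto
next
  fix f assume "\<exists>\<psi> k. smooth_real_on J \<psi> \<and> f = (\<lambda>r. integral (cbox 0 1) (\<lambda>u. u ^ k * \<psi> (u * r)))"
  then obtain \<psi> k where \<psi>: "smooth_real_on J \<psi>"
    and f: "f = (\<lambda>r. integral (cbox 0 1) (\<lambda>u. u ^ k * \<psi> (u * r)))" by blast
  have J: "u * r \<in> J" if "r \<in> J" "u \<in> cbox 0 1" for u r :: real
  proof -
    have "\<bar>u * r\<bar> \<le> 1 * \<bar>r\<bar>" unfolding abs_mult using that by (intro mult_right_mono) auto
    then show ?thesis using that(1) by (auto simp: J_def)
  qed
  have cont: "continuous_on (cbox 0 1) (\<lambda>u. u ^ k * \<psi> (u * r))" if "r \<in> J" for r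
    by (intro continuous_intros continuous_on_compose2[OF smooth_real_on_continuous_on[OF \<psi>]])
       (use J that in auto)
  have "(f has_real_derivative integral (cbox 0 1) (\<lambda>u. u ^ Suc k * deriv \<psi> (u * r))) (at r within J)"
    if "r \<in> J" for r
    unfolding f
  proof (rule leibniz_rule_field_derivative)
    fix x t :: real assume xt: "x \<in> J" "t \<in> cbox 0 1"
    have "((\<lambda>x. t ^ k * \<psi> (t * x)) has_real_derivative t ^ k * (deriv \<psi> (t * x) * t)) (at x within J)"
      by (rule DERIV_cmult, rule DERIV_chain2[where f = \<psi> and g = "\<lambda>x. t * x", OF smooth_real_on_DERIV[OF \<psi> J[OF xt]]])
         (auto intro!: derivative_eq_intros)
    then show "((\<lambda>x. t ^ k * \<psi> (t * x)) has_real_derivative t ^ Suc k * deriv \<psi> (t * x)) (at x within J)"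
      by (simp add: mult_ac)
  next
    show "(\<lambda>u. u ^ k * \<psi> (u * x)) integrable_on cbox 0 1" if "x \<in> J" for x
      by (rule integrable_continuous[OF cont[OF that]])
    have "continuous_on (J \<times> cbox 0 1) (\<lambda>p. snd p ^ Suc k * deriv \<psi> (snd p * fst p))"
      by (intro continuous_intros continuous_on_compose2[OF smooth_real_on_continuous_on[OF smooth_real_on_deriv(1)[OF \<psi>]]])
         (use J in auto)
    then show "continuous_on (J \<times> cbox 0 1) (\<lambda>(x, t). t ^ Suc k * deriv \<psi> (t * x))"
      by (simp add: case_prod_unfold)
  qed (use that in \<open>auto simp: J_def\<close>)
  then have "(f has_real_derivative integral (cbox 0 1) (\<lambda>u. u ^ Suc k * deriv \<psi> (u * r))) (at r)"
    if "r \<in> J" for r using that by (simp add: J_def at_within_open[of _ "{-\<epsilon><..<\<epsilon>}"])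
  then show "\<exists>f'. (\<exists>\<psi> k. smooth_real_on J \<psi> \<and> f' = (\<lambda>r. integral (cbox 0 1) (\<lambda>u. u ^ k * \<psi> (u * r)))) \<and>
      (\<forall>t\<in>J. (f has_real_derivative f' t) (at t))"
    using smooth_real_on_deriv(1)[OF \<psi>]
    by (intro exI[of _ "\<lambda>r. integral (cbox 0 1) (\<lambda>u. u ^ Suc k * deriv \<psi> (u * r))"] conjI
        exI[of _ "deriv \<psi>"] exI[of _ "Suc k"]) auto
qed (simp add: J_def)

text \<open>By the fundamental theorem of calculus,
  \<open>\<phi>(r) = r \<integral>\<phi>'(u r) du\<close> over the unit interval, so the integral is
  the quotient, including its value at \<open>0\<close>.\<close>

lemma smooth_hadamard_quotient:
  fixes \<epsilon> :: real
  defines "J \<equiv> {-\<epsilon><..<\<epsilon>}"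
  assumes \<phi>: "smooth_real_on J \<phi>" and "\<phi> 0 = 0"
  shows "smooth_real_on J (\<lambda>r. if r = 0 then deriv \<phi> 0 else \<phi> r / r)"
proof (rule smooth_real_on_cong)
  show "smooth_real_on J (\<lambda>r. integral {0..1} (\<lambda>u. deriv \<phi> (u * r)))"
    using smooth_integral_scaled smooth_real_on_deriv(1)[OF \<phi>] unfolding J_def by blast
  fix r assume r: "r \<in> J"
  have J: "u * r \<in> J" if "u \<in> {0..1}" for u :: real
  proof -
    have "\<bar>u * r\<bar> \<le> 1 * \<bar>r\<bar>" unfolding abs_mult using that by (intro mult_right_mono) auto
    then show ?thesis using r by (auto simp: J_def)
  qed
  have "((\<lambda>u. deriv \<phi> (u * r) * r) has_integral (\<phi> (1 * r) - \<phi> (0 * r))) {0..1}"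
  proof (rule fundamental_theorem_of_calculus)
    fix u :: real assume "u \<in> {0..1}"
    then have "((\<lambda>u. \<phi> (u * r)) has_real_derivative deriv \<phi> (u * r) * r) (at u within {0..1})"
      by (intro DERIV_chain2[where f = \<phi> and g = "\<lambda>u. u * r", OF smooth_real_on_DERIV[OF \<phi> J]])
         (auto intro!: derivative_eq_intros)
    then show "((\<lambda>u. \<phi> (u * r)) has_vector_derivative deriv \<phi> (u * r) * r) (at u within {0..1})"
      by (simp add: has_real_derivative_iff_has_vector_derivative)
  qed simp
  then have "((\<lambda>u. deriv \<phi> (u * r) * r) has_integral \<phi> r) {0..1}"
    using \<open>\<phi> 0 = 0\<close> by simp
  then have "integral {0..1} (\<lambda>u. deriv \<phi> (u * r)) * r = \<phi> r"
    unfolding integral_mult_left[symmetric] by (rule integral_unique)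
  then show "(if r = 0 then deriv \<phi> 0 else \<phi> r / r) = integral {0..1} (\<lambda>u. deriv \<phi> (u * r))"
    by (auto simp: field_simps)
qed (simp add: J_def)

text \<open>The quotient is taken in the space itself, with the velocity, which exists by
  completeness, as its value at \<open>0\<close>; its smoothness is then a statement about each
  functional separately.\<close>

lemma hadamard_curve:
  fixes \<epsilon> :: real
  defines "J \<equiv> {-\<epsilon><..<\<epsilon>}"
  assumes D: "convenient D" and \<epsilon>: "\<epsilon> > 0" and c: "smooth_curve_on D J c" "c 0 = 0"
  shows "\<exists>e. smooth_curve_on D J e \<and> e 0 = velocity D c 0 \<and> (\<forall>r. c r = r *\<^sub>R e r)"
proof -
  define e where "e r = (if r = 0 then velocity D c 0 else (1 / r) *\<^sub>R c r)" for r
  have J: "open J" "0 \<in> J" using \<epsilon> by (auto simp: J_def)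
  have "smooth_curve_on D J e" unfolding smooth_curve_on_def
  proof
    fix l assume l: "l \<in> D"
    then have lin: "linear l" by (rule convenient_linear[OF D])
    have "smooth_real_on J (\<lambda>r. if r = 0 then deriv (\<lambda>r. l (c r)) 0 else l (c r) / r)"
      unfolding J_def using smooth_hadamard_quotient[of \<epsilon> "\<lambda>r. l (c r)"] c l lin
      by (auto simp: J_def smooth_curve_on_def linear_0)
    then show "smooth_real_on J (\<lambda>r. l (e r))"
      by (rule smooth_real_on_cong[OF J(1)])
         (auto simp: e_def functional_velocity[OF D J(1) c(1) J(2) l] linear_scale[OF lin])
  qed
  moreover have "c r = r *\<^sub>R e r" for r using c(2) by (simp add: e_def)
  ultimately show ?thesis by (intro exI[of _ e]) (simp add: e_def)
qed

text \<open>With \<open>c r = r e(r)\<close>, the composite is the diagonal of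
  \<open>(s, t) \<mapsto> \<Phi>(t e(s))\<close>. On \<open>t = 0\<close> this map is constant, so
  the chain rule leaves only the derivative in \<open>t\<close>, in the direction
  \<open>e 0\<close>.\<close>

lemma smooth_along_first_order:
  fixes \<epsilon> :: real
  defines "J \<equiv> {-\<epsilon><..<\<epsilon>}"
  assumes D: "convenient D" and \<Phi>: "smooth_along D W \<Phi>" and W: "0 \<in> W"
    and \<epsilon>: "\<epsilon> > 0" and c: "smooth_curve_on D J c" "c 0 = 0"
  shows "((\<lambda>r. \<Phi> (c r)) has_real_derivative deriv (\<lambda>t. \<Phi> (t *\<^sub>R velocity D c 0)) 0) (at 0)"
proof -
  have sep: "separating D" by (rule convenient_imp_separating[OF D])
  have J: "open J" "0 \<in> J" using \<epsilon> by (auto simp: J_def)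
  obtain e where e: "smooth_curve_on D J e" "e 0 = velocity D c 0" "\<And>r. c r = r *\<^sub>R e r"
    using hadamard_curve[OF D \<epsilon> c(1)[unfolded J_def] c(2)] unfolding J_def[symmetric] by blast
  have g: "smooth_along2 {(s, t). s \<in> J \<and> 0 + t *\<^sub>R e s \<in> W} (\<lambda>s t. \<Phi> (0 + t *\<^sub>R e s))"
    by (rule smooth_along_plane[OF sep \<Phi> J(1) smooth_curve_on_const[OF J(1)] e(1)])
  show ?thesis using smooth_along2_chain_rule[OF g] J W e by simp
qed

text \<open>Curves with equal position and velocity at \<open>0\<close> satisfy
  \<open>c r = d r + r^2 e(r)\<close>, and \<open>e 0\<close> is half the difference of their
  accelerations. So the composites differ by \<open>g r (r^2) - g r 0\<close>, where
  \<open>g s t = \<Phi>(d s + t e(s))\<close>, which is \<open>r^2\<close> times the derivative of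
  \<open>g 0\<close> at \<open>0\<close> to second order.\<close>

lemma smooth_along_second_order:
  fixes \<epsilon> :: real
  defines "J \<equiv> {-\<epsilon><..<\<epsilon>}"
  assumes D: "convenient D" and \<Phi>: "smooth_along D W \<Phi>" and \<epsilon>: "\<epsilon> > 0"
    and c: "smooth_curve_on D J c" and d: "smooth_curve_on D J d"
    and eq: "c 0 = d 0" "velocity D c 0 = velocity D d 0" and W: "c 0 \<in> W"
  shows "(deriv ^^ 2) (\<lambda>r. \<Phi> (c r)) 0 - (deriv ^^ 2) (\<lambda>r. \<Phi> (d r)) 0
    = 2 * deriv (\<lambda>t. \<Phi> (d 0 + t *\<^sub>R ((1/2) *\<^sub>R (velocity D (velocity D c) 0 - velocity D (velocity D d) 0)))) 0"
proof -
  have sep: "separating D" by (rule convenient_imp_separating[OF D])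
  have J: "open J" "0 \<in> J" using \<epsilon> by (auto simp: J_def)
  have diff: "smooth_curve_on D J (\<lambda>r. c r - d r)" by (rule smooth_curve_on_diff[OF sep J(1) c d])
  obtain e1 where e1: "smooth_curve_on D J e1" "e1 0 = velocity D (\<lambda>r. c r - d r) 0" "\<And>r. c r - d r = r *\<^sub>R e1 r"
    using hadamard_curve[OF D \<epsilon> diff[unfolded J_def]] eq(1) unfolding J_def[symmetric] by auto
  have hv: "has_velocity D c (velocity D c 0) 0" "has_velocity D d (velocity D d 0) 0"
    by (rule convenient_has_velocity[OF D J(1) c J(2)] convenient_has_velocity[OF D J(1) d J(2)])+
  have "has_velocity D (\<lambda>r. c r - d r) 0 0"
    using hv eq(2) sep by (auto simp: has_velocity_def separating_def linear_diff linear_0 intro!: derivative_eq_intros)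
  then have "e1 0 = 0" using velocity_eqI[OF sep] e1(2) by simp
  then obtain e where e: "smooth_curve_on D J e" "\<And>r. e1 r = r *\<^sub>R e r"
    using hadamard_curve[OF D \<epsilon> e1(1)[unfolded J_def]] unfolding J_def[symmetric] by blast
  have cd: "c r = d r + r\<^sup>2 *\<^sub>R e r" for r
    using e1(3)[of r] e(2)[of r] by (simp add: power2_eq_square algebra_simps)
  have e0: "e 0 = (1/2) *\<^sub>R (velocity D (velocity D c) 0 - velocity D (velocity D d) 0)"
  proof (rule separating_eqI[OF sep])
    fix l assume l: "l \<in> D"
    then have lin: "linear l" using sep by (simp add: separating_def)
    have sm: "smooth_real_on J (\<lambda>r. l (c r))" "smooth_real_on J (\<lambda>r. l (d r))" "smooth_real_on J (\<lambda>r. l (e r))"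
      using c d e(1) l by (auto simp: smooth_curve_on_def)
    have "isCont (\<lambda>r. l (e r)) 0" using smooth_real_on_DERIV[OF sm(3) J(2)] DERIV_isCont by blast
    then have "((\<lambda>r. l (e r) - l (e 0)) \<longlongrightarrow> l (e 0) - l (e 0)) (at 0)"
      unfolding isCont_def by (intro tendsto_diff tendsto_const)
    moreover have "\<forall>\<^sub>F r in at 0. l (e r) - l (e 0) = ((l (c r) - l (d r)) - l (e 0) * r ^ 2) / r ^ 2"
      by (auto simp: eventually_at cd linear_add[OF lin] linear_scale[OF lin] field_simps intro!: exI[of _ 1])
    ultimately have "((\<lambda>r. ((l (c r) - l (d r)) - l (e 0) * r ^ 2) / r ^ 2) \<longlongrightarrow> 0) (at 0)"
      using tendsto_cong by force
    from taylor_unique(2)[OF J smooth_diff[OF J(1) sm(1,2)] this]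
    have "2 * l (e 0) = (deriv ^^ 2) (\<lambda>r. l (c r) + (- 1) * l (d r)) 0" by simp
    also have "\<dots> = (deriv ^^ 2) (\<lambda>r. l (c r)) 0 + (-1) * (deriv ^^ 2) (\<lambda>r. l (d r)) 0"
      by (simp only: higher_deriv_add[OF J(1) sm(1) smooth_mult[OF J(1) smooth_const[OF J(1)] sm(2)] J(2)]
          higher_deriv_cmult[OF J(1) sm(2) J(2)])
    finally show "l (e 0) = l ((1/2) *\<^sub>R (velocity D (velocity D c) 0 - velocity D (velocity D d) 0))"
      by (simp add: linear_scale[OF lin] linear_diff[OF lin] functional_velocity2[OF D J(1) _ J(2) l] c d)
  qed
  define W' where "W' = {(s, t). s \<in> J \<and> d s + t *\<^sub>R e s \<in> W}"
  define g where "g s t = \<Phi> (d s + t *\<^sub>R e s)" for s t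
  have g: "smooth_along2 W' g"
    unfolding W'_def g_def by (rule smooth_along_plane[OF sep \<Phi> J(1) d e(1)])
  have W0: "(0, 0) \<in> W'" using J(2) W eq(1) by (simp add: W'_def)
  obtain \<delta> M where \<delta>: "\<delta> > 0" and
    bound: "\<And>s t. \<bar>s\<bar> < \<delta> \<Longrightarrow> \<bar>t\<bar> < \<delta> \<Longrightarrow> (s, t) \<in> W' \<and> \<bar>(deriv ^^ 2) (g s) t\<bar> \<le> M"
    using smooth_along2_bounded_deriv[OF g W0, of 2] by blast
  define \<phi> where "\<phi> s = deriv (g s) 0" for s
  have \<phi>: "(\<phi> \<longlongrightarrow> \<phi> 0) (at 0)"
    using smooth_along2_deriv_tendsto[OF g W0, of 1] by (simp add: \<phi>_def[abs_def])
  define N where "N = {r \<in> J. c r \<in> W} \<inter> {r \<in> J. d r \<in> W}"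
  have N: "open N" "0 \<in> N" using smooth_along_local(1)[OF \<Phi> J(1)] c d W eq(1) J(2) by (auto simp: N_def)
  have sm: "smooth_real_on N (\<lambda>r. \<Phi> (c r))" "smooth_real_on N (\<lambda>r. \<Phi> (d r))"
    by (rule smooth_real_on_subset[OF smooth_along_local(2)[OF \<Phi> J(1) c]]
          smooth_real_on_subset[OF smooth_along_local(2)[OF \<Phi> J(1) d]]; simp add: N_def)+
  define q where "q r = \<Phi> (c r) - \<Phi> (d r)" for r
  have q: "q r = g r (r\<^sup>2) - g r 0" for r by (simp add: q_def g_def cd)
  \<comment> \<open>Taylor expansion in the second variable only, at \<open>t = r^2\<close>. The
    bound \<open>M\<close> is uniform in \<open>r\<close>, so the error is of order 4; restricting
    to \<open>\<bar>r\<bar> < 1\<close> ensures that \<open>r^2\<close> also lies below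
    \<open>\<delta>\<close>.\<close>
  have "((\<lambda>r. (q r - \<phi> r * r ^ 2) / r ^ 2) \<longlongrightarrow> 0) (at 0)"
  proof (rule Lim_null_comparison)
    have "\<bar>(q r - \<phi> r * r ^ 2) / r ^ 2\<bar> \<le> M * r\<^sup>2" if r: "\<bar>r\<bar> < min 1 \<delta>" "r \<noteq> 0" for r
    proof -
      have "\<bar>r\<bar> * \<bar>r\<bar> \<le> 1 * \<bar>r\<bar>" using r by (intro mult_right_mono) auto
      then have r2: "\<bar>r\<^sup>2\<bar> < \<delta>" using r by (simp add: power2_eq_square abs_mult)
      have "\<bar>g r (r\<^sup>2) - (\<Sum>m<2. (deriv ^^ m) (g r) 0 / fact m * (r\<^sup>2) ^ m)\<bar> \<le> M * \<bar>r\<^sup>2\<bar> ^ 2"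
        by (rule maclaurin_bound[OF smooth_along2_slice(2)[OF g]]) (use bound r r2 in auto)
      then have "\<bar>q r - \<phi> r * r ^ 2\<bar> \<le> M * r\<^sup>2 * r\<^sup>2"
        by (simp add: q \<phi>_def numeral_2_eq_2 mult_ac)
      then show ?thesis using r(2) by (simp add: abs_divide pos_divide_le_eq)
    qed
    then show "\<forall>\<^sub>F r in at 0. norm ((q r - \<phi> r * r ^ 2) / r ^ 2) \<le> M * r\<^sup>2"
      using \<delta> by (auto simp: eventually_at intro!: exI[of _ "min 1 \<delta>"])
    show "((\<lambda>r. M * r\<^sup>2) \<longlongrightarrow> 0) (at 0)" by (auto intro!: tendsto_eq_intros)
  qed
  then have "((\<lambda>r. (q r - \<phi> r * r ^ 2) / r ^ 2 + (\<phi> r - \<phi> 0)) \<longlongrightarrow> 0 + (\<phi> 0 - \<phi> 0)) (at 0)"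
    by (intro tendsto_intros \<phi>)
  moreover have "\<forall>\<^sub>F r in at 0. (q r - \<phi> r * r ^ 2) / r ^ 2 + (\<phi> r - \<phi> 0) = (q r - \<phi> 0 * r ^ 2) / r ^ 2"
    by (auto simp: eventually_at field_simps intro!: exI[of _ 1])
  ultimately have "((\<lambda>r. (q r - \<phi> 0 * r ^ 2) / r ^ 2) \<longlongrightarrow> 0) (at 0)"
    using tendsto_cong by force
  from taylor_unique(2)[OF N smooth_diff[OF N(1) sm, folded q_def] this]
  have "2 * \<phi> 0 = (deriv ^^ 2) (\<lambda>r. \<Phi> (c r) + (- 1) * \<Phi> (d r)) 0" by (simp add: q_def[abs_def])
  also have "\<dots> = (deriv ^^ 2) (\<lambda>r. \<Phi> (c r)) 0 + (-1) * (deriv ^^ 2) (\<lambda>r. \<Phi> (d r)) 0"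
    by (simp only: higher_deriv_add[OF N(1) sm(1) smooth_mult[OF N(1) smooth_const[OF N(1)] sm(2)] N(2)]
        higher_deriv_cmult[OF N(1) sm(2) N(2)])
  finally show ?thesis by (simp add: \<phi>_def g_def[abs_def] e0)
qed

section \<open>Local smooth curves in manifolds\<close>

lemma smooth_curve_on_local:
  assumes "\<And>t. t \<in> I \<Longrightarrow> \<exists>T d. open T \<and> t \<in> T \<and> smooth_curve_on D T d \<and> (\<forall>x\<in>T. c x = d x)"
  shows "smooth_curve_on D I c"
  unfolding smooth_curve_on_def
proof
  fix l assume "l \<in> D"
  show "smooth_real_on I (\<lambda>t. l (c t))"
  proof (rule smooth_real_on_local)
    fix t assume "t \<in> I"
    then obtain T d where T: "open T" "t \<in> T" "smooth_curve_on D T d" "\<forall>x\<in>T. c x = d x"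
      using assms by blast
    then have "smooth_real_on T (\<lambda>x. l (d x))" using \<open>l \<in> D\<close> unfolding smooth_curve_on_def by blast
    with T show "\<exists>J g. open J \<and> t \<in> J \<and> smooth_real_on J g \<and> (\<forall>x\<in>J. l (c x) = g x)"
      by (intro exI[of _ T] exI[of _ "\<lambda>x. l (d x)"]) auto
  qed
qed

lemma cinf_open_local:
  assumes "cinf_open D P" "open J" "smooth_curve_on D J c"
  shows "open {r \<in> J. c r \<in> P}"
proof -
  have o: "open {r. c (\<gamma> r) \<in> P}" if "smooth \<gamma>" "range \<gamma> \<subseteq> J" for \<gamma>
    using assms(1) smooth_curve_on_compose[OF open_UNIV assms(2,3) that]
    unfolding cinf_open_def vimage_def by blast
  have "open {r. c (\<gamma> r) \<in> P} \<and> smooth_real_on {r. c (\<gamma> r) \<in> P} (\<lambda>r. 0)"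
    if "smooth \<gamma>" "range \<gamma> \<subseteq> J" for \<gamma>
    using o[OF that] smooth_const by blast
  \<comment> \<open>With the zero function for \<open>\<Phi>\<close> the smoothness half of the
    localization is trivial and its openness half remains.\<close>
  then show ?thesis by (intro smooth_localize(1)[OF assms(2), where \<Phi> = "\<lambda>_. 0"])
qed

lemma smooth_on_open_local:
  assumes "smooth_on_open D P D' f" "open J" "smooth_curve_on D J c" "c ` J \<subseteq> P"
  shows "smooth_curve_on D' J (\<lambda>r. f (c r))"
  unfolding smooth_curve_on_def
proof
  fix l assume l: "l \<in> D'"
  have *: "open {r. c (\<gamma> r) \<in> UNIV} \<and> smooth_real_on {r. c (\<gamma> r) \<in> UNIV} (\<lambda>r. l (f (c (\<gamma> r))))"
    if \<gamma>: "smooth \<gamma>" "range \<gamma> \<subseteq> J" for \<gamma>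
  proof -
    have "smooth_curve_on D' UNIV (\<lambda>t. f (c (\<gamma> t)))"
      using assms(1,4) smooth_curve_on_compose[OF open_UNIV assms(2,3) \<gamma>] \<gamma>(2)
      unfolding smooth_on_open_def by (auto simp: image_subset_iff)
    then show ?thesis using l by (simp add: smooth_curve_on_def)
  qed
  show "smooth_real_on J (\<lambda>r. l (f (c r)))"
    using smooth_localize(2)[OF assms(2), where c = c and W = UNIV and \<Phi> = "\<lambda>x. l (f x)", OF *] by simp
qed

definition smooth_curve_in_on :: "('m, 'e) manifold \<Rightarrow> real set \<Rightarrow> (real \<Rightarrow> 'm) \<Rightarrow> bool" where
  "smooth_curve_in_on M I c \<longleftrightarrow> (\<forall>t\<in>I. \<exists>U u J. (U, u) \<in> snd M \<and> open J \<and> t \<in> J \<and> c ` J \<subseteq> U \<and>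
     smooth_curve_on (fst M) J (\<lambda>s. u (c s)))"

lemma smooth_curve_in_iff: "smooth_curve_in M c \<longleftrightarrow> smooth_curve_in_on M UNIV c"
  unfolding smooth_curve_in_def smooth_curve_in_on_def by (simp add: Bex_def split_paired_Ex)

lemma smooth_curve_in_onE:
  assumes "smooth_curve_in_on M I c" "t \<in> I"
  obtains U u J where "(U, u) \<in> snd M" "open J" "t \<in> J" "c ` J \<subseteq> U"
    "smooth_curve_on (fst M) J (\<lambda>s. u (c s))"
  using assms unfolding smooth_curve_in_on_def by blast

lemma smooth_curve_in_on_subset: "smooth_curve_in_on M I c \<Longrightarrow> J \<subseteq> I \<Longrightarrow> smooth_curve_in_on M J c"
  unfolding smooth_curve_in_on_def by (meson subsetD)

lemma open_vimage_smooth: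
  assumes "open I" "open J" "smooth_real_on I a"
  shows "open {r \<in> I. a r \<in> J}"
  by (rule open_Collect_mem_continuous[OF assms(1) smooth_real_on_continuous_on[OF assms(3)] assms(2)])

lemma smooth_curve_in_on_compose:
  assumes "smooth_curve_in_on M J c" "open I" "smooth_real_on I a" "a ` I \<subseteq> J"
  shows "smooth_curve_in_on M I (\<lambda>r. c (a r))"
  unfolding smooth_curve_in_on_def
proof
  fix t assume t: "t \<in> I"
  then obtain U u K where K: "(U, u) \<in> snd M" "open K" "a t \<in> K" "c ` K \<subseteq> U"
    "smooth_curve_on (fst M) K (\<lambda>s. u (c s))"
    using smooth_curve_in_onE[OF assms(1), of "a t"] assms(4) by (metis imageI subsetD)
  define T where "T = {r \<in> I. a r \<in> K}"
  have T: "open T" unfolding T_def by (rule open_vimage_smooth[OF assms(2) K(2) assms(3)])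
  have "smooth_curve_on (fst M) T (\<lambda>s. u (c (a s)))"
    by (rule smooth_curve_on_compose[OF T K(2,5) smooth_real_on_subset[OF assms(3)]]) (auto simp: T_def)
  then show "\<exists>U u J. (U, u) \<in> snd M \<and> open J \<and> t \<in> J \<and> (\<lambda>r. c (a r)) ` J \<subseteq> U \<and>
      smooth_curve_on (fst M) J (\<lambda>s. u (c (a s)))"
    using K T t by (intro exI[of _ U] exI[of _ u] exI[of _ T]) (auto simp: T_def)
qed

lemma smooth_map_local:
  assumes "smooth_map M N f" "open I" "smooth_curve_in_on M I c"
  shows "smooth_curve_in_on N I (\<lambda>r. f (c r))"
  unfolding smooth_curve_in_on_def
proof
  fix t assume t: "t \<in> I"
  obtain \<gamma> \<kappa> K \<epsilon> where \<gamma>: "smooth \<gamma>" "range \<gamma> \<subseteq> I" "\<gamma> 0 = t"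
    and K: "open K" "t \<in> K" "K \<subseteq> I" "smooth_real_on K \<kappa>" "\<kappa> t = 0" "\<And>s. s \<in> K \<Longrightarrow> \<gamma> (\<kappa> s) = s"
    by (rule local_reparametrization[OF assms(2) t]) (rule that)
  have "smooth_curve_in_on M UNIV (\<lambda>r. c (\<gamma> r))"
    by (rule smooth_curve_in_on_compose[OF assms(3) open_UNIV \<gamma>(1,2)])
  then have "smooth_curve_in_on N UNIV (\<lambda>r. f (c (\<gamma> r)))"
    using assms(1) unfolding smooth_map_def smooth_curve_in_iff by blast
  from smooth_curve_in_onE[OF this UNIV_I]
  obtain V v J where J: "(V, v) \<in> snd N" "open J" "0 \<in> J" "(\<lambda>r. f (c (\<gamma> r))) ` J \<subseteq> V"
    "smooth_curve_on (fst N) J (\<lambda>s. v (f (c (\<gamma> s))))" .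
  define T where "T = {s \<in> K. \<kappa> s \<in> J}"
  have T: "open T" unfolding T_def by (rule open_vimage_smooth[OF K(1) J(2) K(4)])
  have "smooth_curve_on (fst N) T (\<lambda>s. v (f (c (\<gamma> (\<kappa> s)))))"
    by (rule smooth_curve_on_compose[OF T J(2,5) smooth_real_on_subset[OF K(4)]]) (auto simp: T_def)
  then have "smooth_curve_on (fst N) T (\<lambda>s. v (f (c s)))"
    by (rule smooth_curve_on_cong[OF T]) (use K(6) in \<open>auto simp: T_def\<close>)
  moreover have "(\<lambda>s. f (c s)) ` T \<subseteq> V"
  proof clarify
    fix s assume "s \<in> T"
    then have "s \<in> K" "\<kappa> s \<in> J" by (auto simp: T_def)
    then have "f (c (\<gamma> (\<kappa> s))) \<in> V" using J(4) by blast
    then show "f (c s) \<in> V" using K(6)[OF \<open>s \<in> K\<close>] by simp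
  qed
  ultimately show "\<exists>V v J. (V, v) \<in> snd N \<and> open J \<and> t \<in> J \<and> (\<lambda>r. f (c r)) ` J \<subseteq> V \<and>
      smooth_curve_on (fst N) J (\<lambda>s. v (f (c s)))"
    using J(1,3) T K(2,5) by (intro exI[of _ V] exI[of _ v] exI[of _ T]) (auto simp: T_def)
qed

text \<open>The chart witnessing smoothness near a parameter may differ from the given one; the
  transition map between them carries smooth curves to smooth curves.\<close>

lemma smooth_curve_in_chart:
  assumes M: "is_manifold M" and I: "open I" and c: "smooth_curve_in_on M I c" and V: "(V, v) \<in> snd M"
  shows "open {r \<in> I. c r \<in> V}" and "smooth_curve_on (fst M) {r \<in> I. c r \<in> V} (\<lambda>r. v (c r))"
proof -
  have *: "\<exists>T d. open T \<and> t \<in> T \<and> T \<subseteq> {r \<in> I. c r \<in> V} \<and> smooth_curve_on (fst M) T d \<and> (\<forall>x\<in>T. v (c x) = d x)"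
    if t: "t \<in> I" "c t \<in> V" for t
  proof -
    obtain U u J where J: "(U, u) \<in> snd M" "open J" "t \<in> J" "c ` J \<subseteq> U"
      "smooth_curve_on (fst M) J (\<lambda>s. u (c s))"
      using smooth_curve_in_onE[OF c t(1)] .
    have inj: "inj_on u U" using M J(1) unfolding is_manifold_def by blast
    have P: "cinf_open (fst M) (u ` (U \<inter> V))"
      "smooth_on_open (fst M) (u ` (U \<inter> V)) (fst M) (\<lambda>x. v (inv_into U u x))"
      using M J(1) V unfolding is_manifold_def by blast+
    define J1 where "J1 = J \<inter> I"
    have J1: "open J1" "smooth_curve_on (fst M) J1 (\<lambda>s. u (c s))"
      using J I by (auto simp: J1_def intro: smooth_curve_on_subset[OF J(5)])
    define T where "T = {r \<in> J1. u (c r) \<in> u ` (U \<inter> V)}"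
    have T: "open T" unfolding T_def by (rule cinf_open_local[OF P(1) J1])
    have sub: "c r \<in> V" if "r \<in> T" for r
      using that J(4) inj unfolding T_def J1_def inj_on_def by blast
    have "smooth_curve_on (fst M) T (\<lambda>r. v (inv_into U u (u (c r))))"
      by (rule smooth_on_open_local[OF P(2) T smooth_curve_on_subset[OF J1(2)]]) (auto simp: T_def)
    moreover have "v (inv_into U u (u (c r))) = v (c r)" if "r \<in> T" for r
      using that J(4) inj by (subst inv_into_f_f) (auto simp: T_def J1_def)
    moreover have "t \<in> T" using J(3,4) t by (auto simp: T_def J1_def)
    moreover have "T \<subseteq> {r \<in> I. c r \<in> V}" using sub by (auto simp: T_def J1_def)
    ultimately show ?thesis using T
      by (intro exI[of _ T] exI[of _ "\<lambda>r. v (inv_into U u (u (c r)))"]) auto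
  qed
  show "open {r \<in> I. c r \<in> V}" by (subst open_subopen) (use * in blast)
  show "smooth_curve_on (fst M) {r \<in> I. c r \<in> V} (\<lambda>r. v (c r))"
    by (rule smooth_curve_on_local) (use * in blast)
qed

lemma smooth_curve_in_on_inv_chart:
  assumes "(U, u) \<in> snd M" "open J" "smooth_curve_on (fst M) J x" "x ` J \<subseteq> u ` U"
  shows "smooth_curve_in_on M J (\<lambda>r. inv_into U u (x r))"
proof -
  have "smooth_curve_on (fst M) J (\<lambda>r. u (inv_into U u (x r)))"
    by (rule smooth_curve_on_cong[OF assms(2,3)]) (rule f_inv_into_f, use assms(4) in blast)
  moreover have "(\<lambda>r. inv_into U u (x r)) ` J \<subseteq> U" using assms(4) by (blast intro: inv_into_into)
  ultimately show ?thesis unfolding smooth_curve_in_on_def using assms(1,2) by blast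
qed

lemma smooth_curve_in_on_pair:
  assumes "smooth_curve_in_on M I c" "smooth_curve_in_on N I d"
  shows "smooth_curve_in_on (prod_manifold M N) I (\<lambda>t. (c t, d t))"
  unfolding smooth_curve_in_on_def
proof
  fix t assume t: "t \<in> I"
  obtain U u J where J: "(U, u) \<in> snd M" "open J" "t \<in> J" "c ` J \<subseteq> U"
    "smooth_curve_on (fst M) J (\<lambda>s. u (c s))" using smooth_curve_in_onE[OF assms(1) t] .
  obtain V v K where K: "(V, v) \<in> snd N" "open K" "t \<in> K" "d ` K \<subseteq> V"
    "smooth_curve_on (fst N) K (\<lambda>s. v (d s))" using smooth_curve_in_onE[OF assms(2) t] .
  have "smooth_curve_on (fst (prod_manifold M N)) (J \<inter> K) (\<lambda>s. map_prod u v (c s, d s))"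
    unfolding smooth_curve_on_def prod_manifold_def prod_functionals_def fst_conv
  proof clarify
    fix l k assume "l \<in> fst M" "k \<in> fst N"
    then have "smooth_real_on (J \<inter> K) (\<lambda>s. l (u (c s)))" "smooth_real_on (J \<inter> K) (\<lambda>s. k (v (d s)))"
      using smooth_curve_on_subset[OF J(5), of "J \<inter> K"] smooth_curve_on_subset[OF K(5), of "J \<inter> K"]
      by (auto simp: smooth_curve_on_def)
    then show "smooth_real_on (J \<inter> K) (\<lambda>t. case map_prod u v (c t, d t) of (x, y) \<Rightarrow> l x + k y)"
      using smooth_add[OF open_Int[OF J(2) K(2)]] by simp
  qed
  moreover have "(U \<times> V, map_prod u v) \<in> snd (prod_manifold M N)"
    using J(1) K(1) by (auto simp: prod_manifold_def)
  ultimately show "\<exists>U u J. (U, u) \<in> snd (prod_manifold M N) \<and> open J \<and> t \<in> J \<and> (\<lambda>t. (c t, d t)) ` J \<subseteq> U \<and>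
      smooth_curve_on (fst (prod_manifold M N)) J (\<lambda>s. u (c s, d s))"
    using J(2-4) K(2-4)
    by (intro exI[of _ "U \<times> V"] exI[of _ "map_prod u v"] exI[of _ "J \<inter> K"]) auto
qed

text \<open>The manifold-valued counterpart of \<open>smooth_family\<close>. It is preserved by
  smooth maps such as multiplication and the action, and becomes a \<open>smooth_family\<close> only
  after the final passage to coordinates.\<close>

definition smooth_points :: "(real \<times> real) set \<Rightarrow> ('m, 'e) manifold \<Rightarrow> (real \<Rightarrow> real \<Rightarrow> 'm) \<Rightarrow> bool" where
  "smooth_points W M Q \<longleftrightarrow> (\<forall>a b. smooth a \<and> smooth b \<longrightarrow>
     open {r. (a r, b r) \<in> W} \<and> smooth_curve_in_on M {r. (a r, b r) \<in> W} (\<lambda>r. Q (a r) (b r)))"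

lemma smooth_familyI:
  assumes "\<And>a b. smooth a \<Longrightarrow> smooth b \<Longrightarrow>
    open {r. (a r, b r) \<in> W} \<and> smooth_curve_on D {r. (a r, b r) \<in> W} (\<lambda>r. f (a r) (b r))"
  shows "smooth_family D W f"
  unfolding smooth_family_def smooth_along2_def using assms unfolding smooth_curve_on_def by blast

lemma smooth_points_pair:
  assumes "smooth_points W M Q" "smooth_points W' N Q'"
  shows "smooth_points (W \<inter> W') (prod_manifold M N) (\<lambda>s t. (Q s t, Q' s t))"
  unfolding smooth_points_def
proof (intro allI impI)
  fix a b :: "real \<Rightarrow> real" assume "smooth a \<and> smooth b"
  then have *: "open {r. (a r, b r) \<in> W}" "smooth_curve_in_on M {r. (a r, b r) \<in> W} (\<lambda>r. Q (a r) (b r))"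
    "open {r. (a r, b r) \<in> W'}" "smooth_curve_in_on N {r. (a r, b r) \<in> W'} (\<lambda>r. Q' (a r) (b r))"
    using assms unfolding smooth_points_def by blast+
  have eq: "{r. (a r, b r) \<in> W \<inter> W'} = {r. (a r, b r) \<in> W} \<inter> {r. (a r, b r) \<in> W'}" by auto
  show "open {r. (a r, b r) \<in> W \<inter> W'} \<and>
    smooth_curve_in_on (prod_manifold M N) {r. (a r, b r) \<in> W \<inter> W'} (\<lambda>r. (Q (a r) (b r), Q' (a r) (b r)))"
    unfolding eq using *
    by (intro conjI smooth_curve_in_on_pair open_Int smooth_curve_in_on_subset[OF *(2)] smooth_curve_in_on_subset[OF *(4)]) auto
qed

lemma smooth_points_map:
  assumes "smooth_points W M Q" "smooth_map M N f"
  shows "smooth_points W N (\<lambda>s t. f (Q s t))"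
  using assms smooth_map_local[OF assms(2)] unfolding smooth_points_def by blast

section \<open>Lie groups\<close>

locale lie =
  fixes G :: "('g, 'e::real_vector) lie_data"
  assumes lie: "lie_group G"
begin

sublocale group G using lie by (simp add: lie_group_def)

definition chart_dom :: "'g set" where "chart_dom = fst (id_chart G)"

text \<open>The vectors on which \<open>param\<close> really inverts the centred chart; elsewhere
  its value is arbitrary, so every domain below has to record this condition.\<close>

definition valid :: "'e \<Rightarrow> bool" where "valid x \<longleftrightarrow> coord G \<one>\<^bsub>G\<^esub> + x \<in> coord G ` chart_dom"

abbreviation "D \<equiv> functionals G"

lemma manifold: "is_manifold (manif G)" and points: "points (manif G) = carrier G"
  and smooth_mult: "smooth_map (prod_manifold (manif G) (manif G)) (manif G) (\<lambda>(x, y). x \<otimes>\<^bsub>G\<^esub> y)"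
  and chart: "(chart_dom, coord G) \<in> snd (manif G)" and one_chart: "\<one>\<^bsub>G\<^esub> \<in> chart_dom"
  using lie by (auto simp: lie_group_def chart_dom_def coord_def)

lemma convenient_G: "convenient D"
  using manifold by (simp add: is_manifold_def functionals_def)

lemma sep_G: "separating D"
  by (rule convenient_imp_separating[OF convenient_G])

lemma chart_carrier: "g \<in> chart_dom \<Longrightarrow> g \<in> carrier G"
  using chart unfolding points[symmetric] by (auto simp: points_def)

lemma inj_coord: "inj_on (coord G) chart_dom"
  using manifold chart unfolding is_manifold_def by blast

lemma param_mem: "valid x \<Longrightarrow> param G x \<in> chart_dom"
  unfolding valid_def param_def chart_dom_def by (rule inv_into_into)

lemma param_carrier: "valid x \<Longrightarrow> param G x \<in> carrier G"
  using param_mem chart_carrier by blast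

lemma coord_param: "valid x \<Longrightarrow> coord G (param G x) = coord G \<one>\<^bsub>G\<^esub> + x"
  unfolding valid_def param_def chart_dom_def by (rule f_inv_into_f)

lemma param_coord: "g \<in> chart_dom \<Longrightarrow> param G (coord G g - coord G \<one>\<^bsub>G\<^esub>) = g"
  using inj_coord by (simp add: param_def chart_dom_def)

lemma valid_coord: "g \<in> chart_dom \<Longrightarrow> valid (coord G g - coord G \<one>\<^bsub>G\<^esub>)"
  by (simp add: valid_def)

lemma valid_0: "valid 0" and param_0: "param G 0 = \<one>\<^bsub>G\<^esub>"
  using valid_coord[OF one_chart] param_coord[OF one_chart] by auto

lemma smooth_curve_param:
  assumes "open I" "smooth_curve_on D I x"
  shows "open {r \<in> I. valid (x r)}"
    and "smooth_curve_in_on (manif G) {r \<in> I. valid (x r)} (\<lambda>r. param G (x r))"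
proof -
  have s: "smooth_curve_on D I (\<lambda>r. coord G \<one>\<^bsub>G\<^esub> + x r)"
    by (intro smooth_curve_on_add sep_G assms smooth_curve_on_const)
  have c: "cinf_open D (coord G ` chart_dom)"
    using manifold chart unfolding is_manifold_def functionals_def by blast
  show o: "open {r \<in> I. valid (x r)}"
    unfolding valid_def by (rule cinf_open_local[OF c assms(1) s])
  have "smooth_curve_in_on (manif G) {r \<in> I. valid (x r)} (\<lambda>r. inv_into chart_dom (coord G) (coord G \<one>\<^bsub>G\<^esub> + x r))"
    by (rule smooth_curve_in_on_inv_chart[OF chart o])
       (use smooth_curve_on_subset[OF s, of "{r \<in> I. valid (x r)}"] in \<open>auto simp: valid_def functionals_def\<close>)
  then show "smooth_curve_in_on (manif G) {r \<in> I. valid (x r)} (\<lambda>r. param G (x r))"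
    by (simp add: param_def chart_dom_def)
qed

lemma smooth_points_param:
  assumes "\<And>a b. smooth a \<Longrightarrow> smooth b \<Longrightarrow>
    smooth_curve_on D UNIV (\<lambda>r. x (a r) (b r))"
  shows "smooth_points {(s, t). valid (x s t)} (manif G) (\<lambda>s t. param G (x s t))"
  unfolding smooth_points_def
  using smooth_curve_param[OF open_UNIV assms] by simp

lemma smooth_points_const:
  assumes "g \<in> carrier G"
  shows "smooth_points UNIV (manif G) (\<lambda>_ _. g)"
proof -
  obtain U u where "(U, u) \<in> snd (manif G)" "g \<in> U"
    using assms unfolding points[symmetric] by (auto simp: points_def)
  then have "smooth_curve_in_on (manif G) UNIV (\<lambda>_. g)"
    unfolding smooth_curve_in_on_def
    by (intro ballI exI[of _ U] exI[of _ u] exI[of _ UNIV]) (auto intro: smooth_curve_on_const)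
  then show ?thesis by (simp add: smooth_points_def)
qed

lemma smooth_points_mult:
  assumes "smooth_points W (manif G) Q" "smooth_points W' (manif G) Q'"
  shows "smooth_points (W \<inter> W') (manif G) (\<lambda>s t. Q s t \<otimes>\<^bsub>G\<^esub> Q' s t)"
  using smooth_points_map[OF smooth_points_pair[OF assms] smooth_mult] by simp

lemma smooth_family_coord:
  assumes "smooth_points W (manif G) Q"
  shows "smooth_family D (W \<inter> {(s, t). Q s t \<in> chart_dom}) (\<lambda>s t. coord G (Q s t))"
proof (rule smooth_familyI)
  fix a b :: "real \<Rightarrow> real" assume "smooth a" "smooth b"
  then have *: "open {r. (a r, b r) \<in> W}" "smooth_curve_in_on (manif G) {r. (a r, b r) \<in> W} (\<lambda>r. Q (a r) (b r))"
    using assms unfolding smooth_points_def by blast+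
  have eq: "{r. (a r, b r) \<in> W \<inter> {(s, t). Q s t \<in> chart_dom}} = {r \<in> {r. (a r, b r) \<in> W}. Q (a r) (b r) \<in> chart_dom}"
    by auto
  show "open {r. (a r, b r) \<in> W \<inter> {(s, t). Q s t \<in> chart_dom}} \<and>
    smooth_curve_on D {r. (a r, b r) \<in> W \<inter> {(s, t). Q s t \<in> chart_dom}} (\<lambda>r. coord G (Q (a r) (b r)))"
    unfolding eq functionals_def using smooth_curve_in_chart[OF manifold * chart] by blast
qed

lemma smooth_curve_scaled: "smooth a \<Longrightarrow> smooth_curve_on D UNIV (\<lambda>r. a r *\<^sub>R X)"
  by (rule smooth_curve_on_scale[OF sep_G open_UNIV _ smooth_curve_on_const[OF open_UNIV]])

lemma open_valid_line: "open {s. valid (s *\<^sub>R X)}"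
  using smooth_curve_param(1)[OF open_UNIV smooth_curve_scaled[OF smooth_id[OF open_UNIV]]] by simp

lemma velocity_coord_param: "velocity D (\<lambda>t. coord G (param G (t *\<^sub>R X))) 0 = X"
proof -
  have "velocity D (\<lambda>t. coord G (param G (t *\<^sub>R X))) 0
     = velocity D (\<lambda>t. coord G \<one>\<^bsub>G\<^esub> + t *\<^sub>R X) 0"
    by (rule velocity_cong[OF open_valid_line[of X]]) (auto simp: valid_0 coord_param)
  also have "\<dots> = X" by (rule velocity_eqI[OF sep_G has_velocity_scale_line[OF sep_G]])
  finally show ?thesis .
qed

section \<open>Multiplication in coordinates and the Lie bracket\<close>

definition mult_coord :: "'e \<Rightarrow> 'e \<Rightarrow> real \<Rightarrow> real \<Rightarrow> 'e" where
  "mult_coord X Y s t = coord G (param G (s *\<^sub>R X) \<otimes>\<^bsub>G\<^esub> param G (t *\<^sub>R Y))"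

definition mult_dom :: "'e \<Rightarrow> 'e \<Rightarrow> (real \<times> real) set" where
  "mult_dom X Y = {(s, t). valid (s *\<^sub>R X) \<and> valid (t *\<^sub>R Y) \<and>
     param G (s *\<^sub>R X) \<otimes>\<^bsub>G\<^esub> param G (t *\<^sub>R Y) \<in> chart_dom}"

lemma smooth_mult_coord: "smooth_family D (mult_dom X Y) (mult_coord X Y)"
proof -
  have dom: "mult_dom X Y = ({(s, t). valid (s *\<^sub>R X)} \<inter> {(s, t). valid (t *\<^sub>R Y)}) \<inter>
      {(s, t). param G (s *\<^sub>R X) \<otimes>\<^bsub>G\<^esub> param G (t *\<^sub>R Y) \<in> chart_dom}"
    by (auto simp: mult_dom_def)
  show ?thesis unfolding dom mult_coord_def
    by (intro smooth_family_coord smooth_points_mult smooth_points_param smooth_curve_scaled)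
qed

lemma mult_dom_0: "(s, 0) \<in> mult_dom X Y \<longleftrightarrow> valid (s *\<^sub>R X)" "(0, s) \<in> mult_dom X Y \<longleftrightarrow> valid (s *\<^sub>R Y)"
  using param_mem param_carrier by (auto simp: mult_dom_def valid_0 param_0)

lemma mult_coord_0:
  "valid (s *\<^sub>R X) \<Longrightarrow> mult_coord X Y s 0 = coord G \<one>\<^bsub>G\<^esub> + s *\<^sub>R X"
  "valid (s *\<^sub>R Y) \<Longrightarrow> mult_coord X Y 0 s = coord G \<one>\<^bsub>G\<^esub> + s *\<^sub>R Y"
  by (simp_all add: mult_coord_def param_0 param_carrier coord_param)

lemma left_field_line: "left_field G Y (s *\<^sub>R X) = velocity D (mult_coord X Y s) 0"
  by (simp add: left_field_def mult_coord_def[abs_def])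

lemma left_field_0: "left_field G X 0 = X"
proof -
  have "left_field G X 0 = velocity D (\<lambda>t. coord G (param G (t *\<^sub>R X))) 0"
    unfolding left_field_def
    by (rule velocity_cong[OF open_valid_line[of X]]) (auto simp: valid_0 param_0 param_carrier)
  then show ?thesis by (simp add: velocity_coord_param)
qed

text \<open>The fields take the values \<open>X\<close> and \<open>Y\<close> at the identity, so the
  bracket differentiates along the lines through \<open>X\<close> and \<open>Y\<close>, on which a
  left invariant field is the inner derivative of the product.\<close>

lemma ad_eq_mixed: "ad G X Y = mixed D (mult_coord X Y) - mixed D (mult_coord Y X)"
  by (simp add: ad_def vf_bracket_def left_field_0 left_field_line mixed_def)

lemma right_field_0: "right_field G (\<lambda>_. X) x 0 = X"
proof -
  have "right_field G (\<lambda>_. X) x 0 = velocity D (\<lambda>t. coord G (param G (t *\<^sub>R X))) 0"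
    unfolding right_field_def
    by (rule velocity_cong[OF open_valid_line[of X]]) (auto simp: valid_0 param_0 param_carrier)
  then show ?thesis by (simp add: velocity_coord_param)
qed

lemma right_field_line:
  "right_field G (\<lambda>_. X) x (t *\<^sub>R Y) = velocity D (\<lambda>s. mult_coord X Y s t) 0"
  by (simp add: right_field_def mult_coord_def)

text \<open>For right invariant fields the inner derivative is taken in the left factor. Compared
  with \<open>ad\<close> the order of differentiation is reversed; by symmetry of mixed derivatives
  the same two terms occur, but exchanged.\<close>

lemma field_bracket_const: "field_bracket G (\<lambda>_. X) (\<lambda>_. Y) x = - ad G X Y"
proof -
  have "mixed D (\<lambda>s t. mult_coord X Y t s) = mixed D (mult_coord X Y)" for X Y
    by (rule mixed_swap[OF convenient_G smooth_mult_coord]) (simp add: mult_dom_0 valid_0)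
  then show ?thesis
    by (simp add: field_bracket_def vf_bracket_def right_field_0 right_field_line mixed_def[symmetric] ad_eq_mixed)
qed

end

section \<open>Smooth actions by automorphisms\<close>

lemma has_velocity_diff_const:
  "separating D \<Longrightarrow> has_velocity D (\<lambda>s. c s - k) v t \<longleftrightarrow> has_velocity D c v t"
proof -
  assume D: "separating D"
  have "((\<lambda>s. l (c s - k)) has_real_derivative l v) (at t) \<longleftrightarrow> ((\<lambda>s. l (c s)) has_real_derivative l v) (at t)"
    if "l \<in> D" for l
  proof -
    have "linear l" using D that by (simp add: separating_def)
    then have eq: "(\<lambda>s. l (c s - k)) = (\<lambda>s. l (c s) - l k)" by (simp add: linear_diff)
    show ?thesis unfolding eq
      using DERIV_diff[of "\<lambda>s. l (c s)" "l v" t UNIV "\<lambda>_. l k" 0]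
        DERIV_add[of "\<lambda>s. l (c s) - l k" "l v" t UNIV "\<lambda>_. l k" 0] by auto
  qed
  then show ?thesis by (simp add: has_velocity_def)
qed

lemma velocity_diff_const: "separating D \<Longrightarrow> velocity D (\<lambda>s. c s - k) = velocity D c"
  by (rule ext) (simp add: velocity_def has_velocity_diff_const)

lemma smooth_family_diff_const:
  assumes D: "separating D" and f: "smooth_family D W f"
  shows "smooth_family D W (\<lambda>s t. f s t - x)"
  unfolding smooth_family_def smooth_along2_def
proof (intro ballI allI impI)
  fix k and a b :: "real \<Rightarrow> real"
  assume k: "k \<in> D" and ab: "smooth a \<and> smooth b"
  then have *: "open {r. (a r, b r) \<in> W}" "smooth_real_on {r. (a r, b r) \<in> W} (\<lambda>r. k (f (a r) (b r)))"
    using f unfolding smooth_family_def smooth_along2_def by blast+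
  have "linear k" using D k by (simp add: separating_def)
  then show "open {r. (a r, b r) \<in> W} \<and> smooth_real_on {r. (a r, b r) \<in> W} (\<lambda>r. k (f (a r) (b r) - x))"
    using * smooth_diff[OF * smooth_const[OF *(1)]] by (simp add: linear_diff)
qed

lemma open_contains_interval:
  assumes "open J" "(0::real) \<in> J"
  obtains \<epsilon> where "\<epsilon> > 0" "{-\<epsilon><..<\<epsilon>} \<subseteq> J"
proof -
  obtain e where "e > 0" "ball 0 e \<subseteq> J" using assms openE by blast
  then show ?thesis by (intro that[of e]) (auto simp: subset_iff dist_real_def)
qed

locale lie_action_pair = G: lie G + H: lie H
  for G :: "('g, 'e::real_vector) lie_data" and H :: "('h, 'f::real_vector) lie_data" +
  fixes B :: "'g \<Rightarrow> 'h \<Rightarrow> 'h"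
  assumes action: "smooth_group_action G H B"
begin

lemma B_hom: "B \<in> hom G (AutoGroup H)"
  and smooth_B: "smooth_map (prod_manifold (manif G) (manif H)) (manif H) (\<lambda>(g, x). B g x)"
  using action by (auto simp: smooth_group_action_def)

lemma B_auto: "g \<in> carrier G \<Longrightarrow> B g \<in> auto H"
  using B_hom by (auto simp: hom_def AutoGroup_def)

lemma B_closed: "g \<in> carrier G \<Longrightarrow> x \<in> carrier H \<Longrightarrow> B g x \<in> carrier H"
  using B_auto by (auto simp: auto_def hom_def)

lemma B_one: "g \<in> carrier G \<Longrightarrow> B g \<one>\<^bsub>H\<^esub> = \<one>\<^bsub>H\<^esub>"
  using B_auto by (auto simp: auto_def intro: hom_one H.is_group)

lemma B_mult: "g \<in> carrier G \<Longrightarrow> g' \<in> carrier G \<Longrightarrow> x \<in> carrier H \<Longrightarrow> B (g \<otimes>\<^bsub>G\<^esub> g') x = B g (B g' x)"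
  using B_hom B_auto[of g] B_auto[of g']
  by (auto simp: hom_def AutoGroup_def BijGroup_def auto_def compose_def)

lemma B_id: "x \<in> carrier H \<Longrightarrow> B \<one>\<^bsub>G\<^esub> x = x"
  using hom_one[OF B_hom G.is_group H.AutoGroup] by (simp add: AutoGroup_def BijGroup_def)

lemma smooth_points_act:
  assumes "smooth_points W (manif G) Q" "smooth_points W' (manif H) Q'"
  shows "smooth_points (W \<inter> W') (manif H) (\<lambda>s t. B (Q s t) (Q' s t))"
  using smooth_points_map[OF smooth_points_pair[OF assms] smooth_B] by simp

abbreviation "DG \<equiv> functionals G"
abbreviation "DH \<equiv> functionals H"
abbreviation "K \<equiv> semidirect G H B"
abbreviation "DK \<equiv> functionals K"

text \<open>An arbitrary curve \<open>c\<close> of group coordinates is allowed, since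
  \<open>\<beta>(param w) Y\<close> has to be smooth along all curves of \<open>w\<close> and not
  only along lines.\<close>

definition act_coord :: "(real \<Rightarrow> 'e) \<Rightarrow> 'f \<Rightarrow> real \<Rightarrow> real \<Rightarrow> 'f" where
  "act_coord c Y s t = coord H (B (param G (c s)) (param H (t *\<^sub>R Y)))"

definition act_dom :: "(real \<Rightarrow> 'e) \<Rightarrow> 'f \<Rightarrow> (real \<times> real) set" where
  "act_dom c Y = {(s, t). G.valid (c s) \<and> H.valid (t *\<^sub>R Y) \<and>
     B (param G (c s)) (param H (t *\<^sub>R Y)) \<in> H.chart_dom}"

lemma smooth_act_coord:
  assumes "smooth_curve_on DG UNIV c"
  shows "smooth_family DH (act_dom c Y) (act_coord c Y)"
proof -
  have "smooth_curve_on DG UNIV (\<lambda>r. c (a r))" if "smooth a" for a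
    by (rule smooth_curve_on_compose[OF open_UNIV open_UNIV assms that]) simp
  moreover have dom: "act_dom c Y = ({(s, t). G.valid (c s)} \<inter> {(s, t). H.valid (t *\<^sub>R Y)}) \<inter>
      {(s, t). B (param G (c s)) (param H (t *\<^sub>R Y)) \<in> H.chart_dom}"
    by (auto simp: act_dom_def)
  ultimately show ?thesis unfolding dom act_coord_def
    by (intro H.smooth_family_coord smooth_points_act H.smooth_points_param G.smooth_points_param H.smooth_curve_scaled)
qed

lemma act_dom_0: "(s, 0) \<in> act_dom c Y \<longleftrightarrow> G.valid (c s)"
  by (auto simp: act_dom_def H.valid_0 H.param_0 B_one G.param_carrier H.one_chart)

lemma action_diff_eq: "action_diff H B (param G (c s)) Y = velocity DH (act_coord c Y s) 0"
  by (simp add: action_diff_def act_coord_def[abs_def])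

lemma smooth_action_diff:
  assumes "smooth_curve_on DG UNIV c"
  shows "open {s. G.valid (c s)}"
    "smooth_curve_on DH {s. G.valid (c s)} (\<lambda>s. action_diff H B (param G (c s)) Y)"
  using smooth_family_slice(3)[OF H.convenient_G smooth_act_coord[OF assms, of Y], of 0]
    smooth_inner_velocity[OF H.convenient_G smooth_act_coord[OF assms, of Y]]
  by (simp_all add: act_dom_0 action_diff_eq)

lemma smooth_along_action_diff:
  assumes "l \<in> DH"
  shows "smooth_along DG {w. G.valid w} (\<lambda>w. l (action_diff H B (param G w) Y))"
  unfolding smooth_along_def using smooth_action_diff assms by (simp add: smooth_curve_on_def)

lemma has_velocity_lie_action:
  "has_velocity DH (\<lambda>s. action_diff H B (param G (s *\<^sub>R X)) Y) (lie_action G H B X Y) 0"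
proof -
  have c: "smooth_curve_on DG UNIV (\<lambda>s. s *\<^sub>R X)" by (rule G.smooth_curve_scaled[OF smooth_id[OF open_UNIV]])
  show ?thesis unfolding lie_action_def
    by (rule convenient_has_velocity[OF H.convenient_G smooth_action_diff[OF c]]) (simp add: G.valid_0)
qed

lemma lie_action_eq_mixed: "lie_action G H B X Y = mixed DH (act_coord (\<lambda>s. s *\<^sub>R X) Y)"
  by (simp add: lie_action_def mixed_def action_diff_eq[of "\<lambda>s. s *\<^sub>R X"])

lemma smooth_act_point:
  assumes g: "g \<in> carrier G" and c: "smooth_curve_on DH UNIV c"
  defines "J \<equiv> {r. H.valid (c r) \<and> B g (param H (c r)) \<in> H.chart_dom}"
  shows "open J" "smooth_curve_on DH J (\<lambda>r. coord H (B g (param H (c r))))"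
proof -
  have "smooth_curve_on DH UNIV (\<lambda>r. c (a r))" if "smooth a" for a
    by (rule smooth_curve_on_compose[OF open_UNIV open_UNIV c that]) simp
  \<comment> \<open>A family that does not depend on \<open>t\<close>; its slice at
    \<open>t = 0\<close> is the curve in question.\<close>
  then have f: "smooth_family DH
    ((UNIV \<inter> {(s, t). H.valid (c s)}) \<inter> {(s, t). B g (param H (c s)) \<in> H.chart_dom})
    (\<lambda>s t. coord H (B g (param H (c s))))"
    by (intro H.smooth_family_coord smooth_points_act H.smooth_points_param G.smooth_points_const g)
  show "open J" "smooth_curve_on DH J (\<lambda>r. coord H (B g (param H (c r))))"
    using smooth_family_slice(3,4)[OF H.convenient_G f, of 0] by (simp_all add: J_def)
qed

definition point_dom :: "'g \<Rightarrow> 'f set" where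
  "point_dom g = {y. H.valid y \<and> B g (param H y) \<in> H.chart_dom}"

lemma point_dom_0: "g \<in> carrier G \<Longrightarrow> 0 \<in> point_dom g"
  by (simp add: point_dom_def H.valid_0 H.param_0 B_one H.one_chart)

lemma smooth_along_point:
  assumes "g \<in> carrier G" "l \<in> DH"
  shows "smooth_along DH (point_dom g) (\<lambda>y. l (coord H (B g (param H y))))"
  unfolding smooth_along_def point_dom_def
  using smooth_act_point[OF assms(1)] assms(2) by (simp add: smooth_curve_on_def)

lemma functional_action_diff:
  assumes g: "g \<in> carrier G" and l: "l \<in> DH"
  shows "l (action_diff H B g Y) = deriv (\<lambda>t. l (coord H (B g (param H (t *\<^sub>R Y))))) 0"
  unfolding action_diff_def
  by (rule functional_velocity[OF H.convenient_G smooth_act_point[OF g H.smooth_curve_scaled[OF smooth_id[OF open_UNIV]]] _ l])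
     (use point_dom_0[OF g] in \<open>simp add: point_dom_def\<close>)

text \<open>\<open>\<beta>(g)\<close> is bounded and linear: additivity is the chain rule on the
  plane through \<open>y\<close> and \<open>z\<close>, homogeneity a change of parameter, and
  smoothness along curves that of a partial derivative. So \<open>l \<circ> \<beta>(g)\<close> is
  itself a functional and may be applied to velocities.\<close>

lemma action_diff_functional_mem:
  assumes g: "g \<in> carrier G" and l: "l \<in> DH"
  shows "(\<lambda>y. l (action_diff H B g y)) \<in> DH"
proof (rule convenient_mem[OF H.convenient_G])
  define \<Psi> where "\<Psi> y = l (coord H (B g (param H y)))" for y
  have \<Psi>: "smooth_along DH (point_dom g) \<Psi>"
    unfolding \<Psi>_def by (rule smooth_along_point[OF g l])
  have eq: "l (action_diff H B g y) = deriv (\<lambda>t. \<Psi> (t *\<^sub>R y)) 0" for y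
    unfolding \<Psi>_def by (rule functional_action_diff[OF g l])
  have line: "smooth_curve_on DH UNIV (\<lambda>s. s *\<^sub>R y)" for y
    by (rule H.smooth_curve_scaled[OF smooth_id[OF open_UNIV]])
  show "linear (\<lambda>y. l (action_diff H B g y))"
  proof (rule linearI)
    fix y z
    have s: "smooth_along2 {(s, t). s \<in> UNIV \<and> s *\<^sub>R y + t *\<^sub>R z \<in> point_dom g} (\<lambda>s t. \<Psi> (s *\<^sub>R y + t *\<^sub>R z))"
      by (rule smooth_along_plane[OF H.sep_G \<Psi> open_UNIV line smooth_curve_on_const[OF open_UNIV]])
    have "((\<lambda>s. \<Psi> (s *\<^sub>R y + s *\<^sub>R z)) has_real_derivative
        deriv (\<lambda>s. \<Psi> (s *\<^sub>R y + 0 *\<^sub>R z)) 0 + deriv (\<lambda>t. \<Psi> (0 *\<^sub>R y + t *\<^sub>R z)) 0) (at 0)"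
      by (rule smooth_along2_chain_rule[OF s]) (simp add: point_dom_0[OF g])
    from DERIV_imp_deriv[OF this]
    show "l (action_diff H B g (y + z)) = l (action_diff H B g y) + l (action_diff H B g z)"
      by (simp add: eq scaleR_right_distrib)
  next
    fix a y
    have s: "smooth_real_on {r. r *\<^sub>R y \<in> point_dom g} (\<lambda>r. \<Psi> (r *\<^sub>R y))" "open {r. r *\<^sub>R y \<in> point_dom g}"
      using \<Psi> line unfolding smooth_along_def by blast+
    have "(deriv ^^ 1) (\<lambda>x. \<Psi> ((a * x + 0) *\<^sub>R y)) 0 = a ^ 1 * (deriv ^^ 1) (\<lambda>r. \<Psi> (r *\<^sub>R y)) (a * 0 + 0)"
      by (rule higher_deriv_affine[OF s(2,1)]) (simp add: point_dom_0[OF g])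
    then show "l (action_diff H B g (a *\<^sub>R y)) = a *\<^sub>R l (action_diff H B g y)"
      by (simp add: eq mult.commute)
  qed
  fix c assume c: "smooth_curve_on DH UNIV c"
  have "smooth_along2 {(s, t). s \<in> UNIV \<and> 0 + t *\<^sub>R c s \<in> point_dom g} (\<lambda>s t. \<Psi> (0 + t *\<^sub>R c s))"
    by (rule smooth_along_plane[OF H.sep_G \<Psi> open_UNIV smooth_curve_on_const[OF open_UNIV] c])
  from smooth_along2_partial_deriv[OF this]
  show "smooth (\<lambda>t. l (action_diff H B g (c t)))"
    by (simp add: eq point_dom_0[OF g])
qed

text \<open>The image of the line through \<open>Y\<close> under \<open>B g'\<close> is not straight
  in coordinates, but to first order only its velocity \<open>\<beta>(g') Y\<close> counts.\<close>

lemma action_diff_mult: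
  assumes g: "g \<in> carrier G" "g' \<in> carrier G"
  shows "action_diff H B (g \<otimes>\<^bsub>G\<^esub> g') Y = action_diff H B g (action_diff H B g' Y)"
proof (rule separating_eqI[OF H.sep_G])
  fix l assume l: "l \<in> DH"
  define \<Psi> where "\<Psi> y = l (coord H (B g (param H y)))" for y
  have \<Psi>: "smooth_along DH (point_dom g) \<Psi>"
    unfolding \<Psi>_def by (rule smooth_along_point[OF g(1) l])
  define J where "J = {r. H.valid (r *\<^sub>R Y) \<and> B g' (param H (r *\<^sub>R Y)) \<in> H.chart_dom}"
  define d where "d r = coord H (B g' (param H (r *\<^sub>R Y)))" for r
  have J: "open J" "smooth_curve_on DH J d"
    unfolding J_def d_def by (rule smooth_act_point[OF g(2) H.smooth_curve_scaled[OF smooth_id[OF open_UNIV]]])+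
  have "0 \<in> J" using point_dom_0[OF g(2)] by (simp add: J_def point_dom_def)
  then obtain \<epsilon> where \<epsilon>: "\<epsilon> > 0" "{-\<epsilon><..<\<epsilon>} \<subseteq> J" using open_contains_interval[OF J(1)] by blast
  define c where "c r = d r - coord H \<one>\<^bsub>H\<^esub>" for r
  have "smooth_curve_on DH J c" unfolding c_def
    by (rule smooth_curve_on_diff[OF H.sep_G J(1,2) smooth_curve_on_const[OF J(1)]])
  then have c: "smooth_curve_on DH {-\<epsilon><..<\<epsilon>} c" using \<epsilon>(2) by (rule smooth_curve_on_subset)
  have c0: "c 0 = 0" by (simp add: c_def d_def H.param_0 B_one[OF g(2)])
  have vel: "velocity DH c 0 = action_diff H B g' Y"
    unfolding c_def velocity_diff_const[OF H.sep_G] by (simp add: d_def[abs_def] action_diff_def)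
  have "((\<lambda>r. \<Psi> (c r)) has_real_derivative deriv (\<lambda>t. \<Psi> (t *\<^sub>R action_diff H B g' Y)) 0) (at 0)"
    using smooth_along_first_order[OF H.convenient_G \<Psi> point_dom_0[OF g(1)] \<epsilon>(1) c c0] by (simp add: vel)
  then have "((\<lambda>r. \<Psi> (c r)) has_real_derivative l (action_diff H B g (action_diff H B g' Y))) (at 0)"
    by (simp add: functional_action_diff[OF g(1) l] \<Psi>_def)
  then have "((\<lambda>r. l (coord H (B (g \<otimes>\<^bsub>G\<^esub> g') (param H (r *\<^sub>R Y))))) has_real_derivative
      l (action_diff H B g (action_diff H B g' Y))) (at 0)"
  proof (rule has_field_derivative_transform_within_open[OF _ J(1) \<open>0 \<in> J\<close>])
    fix r assume r: "r \<in> J"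
    then have "param H (c r) = B g' (param H (r *\<^sub>R Y))"
      by (simp add: c_def d_def J_def H.param_coord)
    then show "\<Psi> (c r) = l (coord H (B (g \<otimes>\<^bsub>G\<^esub> g') (param H (r *\<^sub>R Y))))"
      using r g by (simp add: \<Psi>_def B_mult H.param_carrier J_def)
  qed
  then show "l (action_diff H B (g \<otimes>\<^bsub>G\<^esub> g') Y) = l (action_diff H B g (action_diff H B g' Y))"
    using functional_action_diff[OF G.m_closed[OF g] l] by (simp add: DERIV_imp_deriv)
qed

text \<open>On products \<open>\<Phi>\<close> becomes
  \<open>l(\<beta>(param(sX)) \<beta>(param(tX')) Y)\<close>. The derivative in \<open>t\<close>
  passes through the bounded linear \<open>\<beta>(param(sX))\<close>; the derivative in
  \<open>s\<close> then gives \<open>b(X) b(X') Y\<close>.\<close>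

lemma mult_family_action:
  fixes l :: "'f \<Rightarrow> real" and Y :: 'f
  assumes l: "l \<in> DH"
  defines "\<Phi> \<equiv> \<lambda>w. l (action_diff H B (param G w) Y)"
  defines "f \<equiv> \<lambda>X X' s t. G.mult_coord X X' s t - coord G \<one>\<^bsub>G\<^esub>"
  shows "smooth_along2 (G.mult_dom X X') (\<lambda>s t. \<Phi> (f X X' s t))"
    and "((\<lambda>s. deriv (\<lambda>t. \<Phi> (f X X' s t)) 0) has_real_derivative
        l (lie_action G H B X (lie_action G H B X' Y))) (at 0)"
proof -
  have \<Phi>: "smooth_along DG {w. G.valid w} \<Phi>" unfolding \<Phi>_def by (rule smooth_along_action_diff[OF l])
  show g: "smooth_along2 (G.mult_dom X X') (\<lambda>s t. \<Phi> (f X X' s t))"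
    unfolding smooth_along2_def
  proof (intro allI impI)
    fix a b :: "real \<Rightarrow> real" assume ab: "smooth a \<and> smooth b"
    define J where "J = {r. (a r, b r) \<in> G.mult_dom X X'}"
    have J: "open J" "smooth_curve_on DG J (\<lambda>r. G.mult_coord X X' (a r) (b r))"
      using G.smooth_mult_coord[of X X'] ab zero_functional_mem[OF G.convenient_G]
      unfolding smooth_family_def smooth_along2_def smooth_curve_on_def J_def by blast+
    have "smooth_curve_on DG J (\<lambda>r. f X X' (a r) (b r))" unfolding f_def
      by (rule smooth_curve_on_diff[OF G.sep_G J(1,2) smooth_curve_on_const[OF J(1)]])
    from smooth_along_local(2)[OF \<Phi> J(1) this]
    have "smooth_real_on {r \<in> J. f X X' (a r) (b r) \<in> {w. G.valid w}} (\<lambda>r. \<Phi> (f X X' (a r) (b r)))" .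
    moreover have "G.valid (f X X' s t)" if "(s, t) \<in> G.mult_dom X X'" for s t
      using that by (simp add: f_def G.mult_coord_def G.mult_dom_def G.valid_coord)
    then have "{r \<in> J. f X X' (a r) (b r) \<in> {w. G.valid w}} = J" by (auto simp: J_def)
    ultimately show "open {r. (a r, b r) \<in> G.mult_dom X X'} \<and>
        smooth_real_on {r. (a r, b r) \<in> G.mult_dom X X'} (\<lambda>r. \<Phi> (f X X' (a r) (b r)))"
      using J(1) by (simp add: J_def)
  qed
  have inner: "deriv (\<lambda>t. \<Phi> (f X X' s t)) 0 = l (action_diff H B (param G (s *\<^sub>R X)) (lie_action G H B X' Y))"
    if s: "G.valid (s *\<^sub>R X)" for s
  proof -
    have gs: "param G (s *\<^sub>R X) \<in> carrier G" by (rule G.param_carrier[OF s])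
    have "((\<lambda>t. l (action_diff H B (param G (s *\<^sub>R X)) (action_diff H B (param G (t *\<^sub>R X')) Y))) has_real_derivative
       l (action_diff H B (param G (s *\<^sub>R X)) (lie_action G H B X' Y))) (at 0)"
      using bspec[OF has_velocity_lie_action[of X' Y, unfolded has_velocity_def] action_diff_functional_mem[OF gs l]]
      by simp
    then have "((\<lambda>t. \<Phi> (f X X' s t)) has_real_derivative
       l (action_diff H B (param G (s *\<^sub>R X)) (lie_action G H B X' Y))) (at 0)"
    proof (rule has_field_derivative_transform_within_open)
      show "open {t. (s, t) \<in> G.mult_dom X X'}"
        by (rule smooth_along2_slice(1)[OF g])
      show "0 \<in> {t. (s, t) \<in> G.mult_dom X X'}" using s by (simp add: G.mult_dom_0)
      fix t assume "t \<in> {t. (s, t) \<in> G.mult_dom X X'}"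
      then show "l (action_diff H B (param G (s *\<^sub>R X)) (action_diff H B (param G (t *\<^sub>R X')) Y)) = \<Phi> (f X X' s t)"
        by (simp add: \<Phi>_def f_def G.mult_coord_def G.mult_dom_def G.param_coord action_diff_mult G.param_carrier)
    qed
    then show ?thesis by (rule DERIV_imp_deriv)
  qed
  have "((\<lambda>s. l (action_diff H B (param G (s *\<^sub>R X)) (lie_action G H B X' Y))) has_real_derivative
      l (lie_action G H B X (lie_action G H B X' Y))) (at 0)"
    by (rule bspec[OF has_velocity_lie_action[unfolded has_velocity_def] l])
  then show "((\<lambda>s. deriv (\<lambda>t. \<Phi> (f X X' s t)) 0) has_real_derivative
        l (lie_action G H B X (lie_action G H B X' Y))) (at 0)"
    by (rule has_field_derivative_transform_within_open[OF _ G.open_valid_line[of X]])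
       (auto simp: G.valid_0 inner)
qed

text \<open>\<open>b\<close> is a homomorphism of Lie algebras: the second derivatives at \<open>0\<close> of
  \<open>\<beta>(param(sX) param(tX'))\<close> and \<open>\<beta>(param(sX') param(tX))\<close> are compared along the diagonal, where the two
  curves in the group have the same velocity and their accelerations differ by \<open>2[X, X']\<close>.\<close>

theorem lie_action_ad:
  "lie_action G H B (ad G X X') Y
    = lie_action G H B X (lie_action G H B X' Y) - lie_action G H B X' (lie_action G H B X Y)"
proof (rule separating_eqI[OF H.sep_G])
  fix l assume l: "l \<in> DH"
  define b where "b = lie_action G H B"
  define \<Phi> where "\<Phi> w = l (action_diff H B (param G w) Y)" for w
  have \<Phi>: "smooth_along DG {w. G.valid w} \<Phi>" unfolding \<Phi>_def by (rule smooth_along_action_diff[OF l])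
  define f where "f X X' s t = G.mult_coord X X' s t - coord G \<one>\<^bsub>G\<^esub>" for X X' s t
  note sm = mult_family_action(1)[OF l, where Y = Y, folded f_def \<Phi>_def]
    and der = mult_family_action(2)[OF l, where Y = Y, folded f_def \<Phi>_def b_def]
  have dom0: "(0, 0) \<in> G.mult_dom X X'" for X X' by (simp add: G.mult_dom_0 G.valid_0)
  have f0: "f X X' s 0 = s *\<^sub>R X" if "G.valid (s *\<^sub>R X)" for X X' s
    using that by (simp add: f_def G.mult_coord_0)
  have f0': "f X X' 0 s = s *\<^sub>R X'" if "G.valid (s *\<^sub>R X')" for X X' s
    using that by (simp add: f_def G.mult_coord_0)
  \<comment> \<open>On the axes the product runs through the straight lines of \<open>X\<close> and
    \<open>X'\<close>. The axis terms are thus the same for both orders of the factors and cancel in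
    the commutator.\<close>
  have A: "(deriv ^^ 2) (\<lambda>s. \<Phi> (f X X' s 0)) 0 = (deriv ^^ 2) (\<lambda>s. \<Phi> (s *\<^sub>R X)) 0" for X X'
    by (rule higher_deriv_cong[OF G.open_valid_line[of X]]) (auto simp: f0 G.valid_0)
  have A': "(deriv ^^ 2) (\<lambda>s. \<Phi> (f X X' 0 s)) 0 = (deriv ^^ 2) (\<lambda>s. \<Phi> (s *\<^sub>R X')) 0" for X X'
    by (rule higher_deriv_cong[OF G.open_valid_line[of X']]) (auto simp: f0' G.valid_0)
  have bb: "l (b X (b X' Y)) = ((deriv ^^ 2) (\<lambda>s. \<Phi> (f X X' s s)) 0 - (deriv ^^ 2) (\<lambda>s. \<Phi> (s *\<^sub>R X)) 0
      - (deriv ^^ 2) (\<lambda>s. \<Phi> (s *\<^sub>R X')) 0) / 2" for X X'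
    using DERIV_unique[OF der smooth_along2_mixed_deriv[OF sm dom0]] by (simp only: A A')
  have fam: "smooth_family DG (G.mult_dom X X') (f X X')" for X X'
    unfolding f_def by (rule smooth_family_diff_const[OF G.sep_G G.smooth_mult_coord])
  define J where "J = {s. (s, s) \<in> G.mult_dom X X'} \<inter> {s. (s, s) \<in> G.mult_dom X' X}"
  note diag = smooth_family_diagonal[OF G.convenient_G fam]
  have J: "open J" "0 \<in> J" using diag(1) dom0 by (auto simp: J_def)
  then obtain \<epsilon> where \<epsilon>: "\<epsilon> > 0" "{-\<epsilon><..<\<epsilon>} \<subseteq> J" using open_contains_interval by blast
  have I: "open {-\<epsilon><..<\<epsilon>}" "0 \<in> {-\<epsilon><..<\<epsilon>}" using \<epsilon>(1) by auto
  have c: "smooth_curve_on DG {-\<epsilon><..<\<epsilon>} (\<lambda>s. f X X' s s)"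
    by (rule smooth_curve_on_subset[OF diag(2)]) (use \<epsilon>(2) in \<open>auto simp: J_def\<close>)
  have d: "smooth_curve_on DG {-\<epsilon><..<\<epsilon>} (\<lambda>s. f X' X s s)"
    by (rule smooth_curve_on_subset[OF diag(2)]) (use \<epsilon>(2) in \<open>auto simp: J_def\<close>)
  have vl: "velocity DG (\<lambda>s. s *\<^sub>R X) 0 = X" for X
    using velocity_eqI[OF G.sep_G has_velocity_scale_line[OF G.sep_G, of 0 X 0]] by simp
  have v0: "velocity DG (\<lambda>s. f X X' s 0) 0 = X" for X X'
    using velocity_cong[OF G.open_valid_line[of X], of 0 "\<lambda>s. f X X' s 0" "\<lambda>s. s *\<^sub>R X"] f0 G.valid_0 vl by simp
  have v0': "velocity DG (f X X' 0) 0 = X'" for X X'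
    using velocity_cong[OF G.open_valid_line[of X'], of 0 "f X X' 0" "\<lambda>s. s *\<^sub>R X'"] f0' G.valid_0 vl by simp
  have vel: "velocity DG (\<lambda>s. f X X' s s) 0 = X + X'" for X X'
    using smooth_family_chain_rule[OF G.convenient_G fam dom0] by (simp add: v0 v0')
  \<comment> \<open>Half the difference of the accelerations of the two diagonal curves. By
    polarization of the mixed derivatives this is the bracket of \<open>X\<close> and
    \<open>X'\<close>.\<close>
  define z where "z = (1/2) *\<^sub>R (velocity DG (velocity DG (\<lambda>s. f X X' s s)) 0 - velocity DG (velocity DG (\<lambda>s. f X' X s s)) 0)"
  have f00: "f X X' 0 0 = 0" for X X' using f0[of 0] G.valid_0 by simp
  have mixed_f: "mixed DG (f X X') = mixed DG (G.mult_coord X X')" for X X'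
    unfolding mixed_def f_def by (simp add: velocity_diff_const[OF G.sep_G])
  have "ad G X X' = z"
  proof (rule separating_eqI[OF G.sep_G])
    fix k assume k: "k \<in> DG"
    have lin: "linear k" by (rule convenient_linear[OF G.convenient_G k])
    have K: "(deriv ^^ 2) (\<lambda>s. k (f X X' s 0)) 0 = (deriv ^^ 2) (\<lambda>s. k (s *\<^sub>R X)) 0" for X X'
      by (rule higher_deriv_cong[OF G.open_valid_line[of X]]) (auto simp: f0 G.valid_0)
    have K': "(deriv ^^ 2) (\<lambda>s. k (f X X' 0 s)) 0 = (deriv ^^ 2) (\<lambda>s. k (s *\<^sub>R X')) 0" for X X'
      by (rule higher_deriv_cong[OF G.open_valid_line[of X']]) (auto simp: f0' G.valid_0)
    have "k (ad G X X') = k (mixed DG (f X X')) - k (mixed DG (f X' X))"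
      by (simp add: G.ad_eq_mixed linear_diff[OF lin] mixed_f)
    also have "\<dots> = ((deriv ^^ 2) (\<lambda>s. k (f X X' s s)) 0 - (deriv ^^ 2) (\<lambda>s. k (f X' X s s)) 0) / 2"
      unfolding functional_mixed[OF G.convenient_G fam dom0 k] K K' by (simp add: field_simps)
    also have "\<dots> = k z"
      using functional_velocity2[OF G.convenient_G I(1) c I(2) k] functional_velocity2[OF G.convenient_G I(1) d I(2) k]
      by (simp add: z_def linear_scale[OF lin] linear_diff[OF lin])
    finally show "k (ad G X X') = k z" .
  qed
  have "l (b X (b X' Y)) - l (b X' (b X Y)) = ((deriv ^^ 2) (\<lambda>s. \<Phi> (f X X' s s)) 0 - (deriv ^^ 2) (\<lambda>s. \<Phi> (f X' X s s)) 0) / 2"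
    unfolding bb by (simp add: field_simps)
  \<comment> \<open>Both diagonal curves start at \<open>0\<close> with velocity
    \<open>X + X'\<close>, so what remains is the derivative of \<open>\<Phi>\<close> in the
    direction \<open>z\<close>.\<close>
  also have "(deriv ^^ 2) (\<lambda>s. \<Phi> (f X X' s s)) 0 - (deriv ^^ 2) (\<lambda>s. \<Phi> (f X' X s s)) 0
     = 2 * deriv (\<lambda>t. \<Phi> (f X' X 0 0 + t *\<^sub>R z)) 0"
    unfolding z_def
    by (rule smooth_along_second_order[OF G.convenient_G \<Phi> \<epsilon>(1) c d]) (simp_all add: f00 vel G.valid_0 add.commute)
  also have "\<dots> = 2 * deriv (\<lambda>t. \<Phi> (t *\<^sub>R z)) 0" by (simp add: f00)
  also have "deriv (\<lambda>t. \<Phi> (t *\<^sub>R z)) 0 = l (b z Y)"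
    unfolding \<Phi>_def b_def using has_velocity_lie_action[of z Y] l
    by (auto simp: has_velocity_def intro: DERIV_imp_deriv)
  finally show "l (lie_action G H B (ad G X X') Y)
      = l (lie_action G H B X (lie_action G H B X' Y) - lie_action G H B X' (lie_action G H B X Y))"
    by (simp add: \<open>ad G X X' = z\<close> b_def linear_diff[OF convenient_linear[OF H.convenient_G l]])
qed

end

section \<open>Right invariant curvature\<close>

lemma ip_eqI:
  fixes ip :: "'e::real_vector \<Rightarrow> 'e \<Rightarrow> real"
  assumes "bilinear ip" "\<And>x. x \<noteq> 0 \<Longrightarrow> ip x x > 0" "\<And>c. ip x c = ip y c"
  shows "x = y"
proof -
  have "ip (x - y) (x - y) = 0" by (simp add: bilinear_lsub[OF assms(1)] assms(3))
  then show ?thesis using assms(2)[of "x - y"] by force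
qed

locale inner_product_ad =
  fixes ip :: "'e::real_vector \<Rightarrow> 'e \<Rightarrow> real" and br :: "'e \<Rightarrow> 'e \<Rightarrow> 'e"
  assumes bil: "bilinear ip" and sym: "ip x y = ip y x" and pos: "x \<noteq> 0 \<Longrightarrow> ip x x > 0"
    and tr: "has_transpose ip (br x)" and anti: "br x y = - br y x"
begin

lemmas ip_linear = bilinear_ladd[OF bil] bilinear_radd[OF bil] bilinear_lsub[OF bil] bilinear_rsub[OF bil]
  bilinear_lmul[OF bil] bilinear_rmul[OF bil] bilinear_lneg[OF bil] bilinear_rneg[OF bil]

abbreviation "adT x \<equiv> metric_transpose ip (br x)"

lemma has_transpose_eq: "has_transpose ip T \<Longrightarrow> ip (metric_transpose ip T a) c = ip a (T c)"
proof -
  assume "has_transpose ip T"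
  then obtain z where z: "\<forall>c. ip z c = ip a (T c)" unfolding has_transpose_def by blast
  have "metric_transpose ip T a = z" unfolding metric_transpose_def
  proof (rule the_equality[where P = "\<lambda>z. \<forall>c. ip z c = ip a (T c)"])
    fix z' assume "\<forall>c. ip z' c = ip a (T c)"
    then show "z' = z" using z by (intro ip_eqI[OF bil pos]) auto
  qed (rule z)
  with z show ?thesis by simp
qed

lemma metric_transpose_eqI: "(\<And>c. ip z c = ip a (T c)) \<Longrightarrow> metric_transpose ip T a = z"
  unfolding metric_transpose_def
  by (rule the_equality) (auto intro!: ip_eqI[OF bil pos])

lemma adT: "ip (adT x a) c = ip a (br x c)"
  by (rule has_transpose_eq[OF tr])

text \<open>An operator with a transpose is linear by nondegeneracy of the inner product. This gives
  the sign rule in the second argument, and antisymmetry moves it to the first.\<close>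

lemma br_minus_left: "br (- x) y = - br x y"
proof -
  have "br y (- x) = - br y x"
    by (rule ip_eqI[OF bil pos]) (simp_all add: sym[of "br y u" for u] sym[of "- br y u" for u] ip_linear flip: adT)
  then show ?thesis using anti[of "- x" y] anti[of x y] by simp
qed

text \<open>The Levi-Civita derivative on constant functions, that is, on right invariant fields,
  where the directional term vanishes.\<close>

definition connection :: "'e \<Rightarrow> 'e \<Rightarrow> 'e" where
  "connection x y = (1/2) *\<^sub>R adT x y + (1/2) *\<^sub>R adT y x - (1/2) *\<^sub>R br x y"

lemma ip_connection: "ip (connection x y) z = (ip y (br x z) + ip x (br y z) - ip (br x y) z) / 2"
  by (simp add: connection_def ip_linear adT)

text \<open>Metric compatibility: inner products of right invariant fields are constant, so the
  connection acts by skew operators.\<close>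

lemma ip_connection_skew: "ip (connection x y) z = - ip (connection x z) y"
  unfolding ip_connection using anti[of x y] anti[of x z] anti[of y z]
  by (simp add: ip_linear sym[of _ y] sym[of _ z] field_simps)

definition sec_num :: "'e \<Rightarrow> 'e \<Rightarrow> real" where
  "sec_num x y = 1/4 * ip (adT x y + adT y x) (adT x y + adT y x) - 3/4 * ip (br x y) (br x y)
     - ip (adT x x) (adT y y) - 1/2 * ip (adT x y - adT y x) (br x y)"

text \<open>Skewness turns the first two terms into inner products of \<open>connection\<close>
  values, with symmetric part \<open>1/2 S\<close> and antisymmetric part
  \<open>-1/2 [x, y]\<close>; they yield \<open>-1/4 |[x, y]|^2\<close>, and the last term adds
  \<open>-1/2 |[x, y]|^2\<close>. Its plus sign reflects that the bracket of right invariant fields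
  is minus the one of the Lie algebra.\<close>

lemma sec_num_eq: "ip (connection x (connection y y) - connection y (connection x y) + connection (br x y) y) x = sec_num x y"
proof -
  have br0: "br z z = 0" for z using anti[of z z] by (metis eq_neg_iff_add_eq_0 scaleR_2 scaleR_eq_0_iff zero_neq_numeral)
  have Nxx: "connection z z = adT z z" for z by (simp add: connection_def br0 flip: scaleR_left_distrib)
  have 1: "ip (connection x (connection y y)) x = - ip (adT y y) (adT x x)"
    using ip_connection_skew[of x "connection y y" x] by (simp add: Nxx sym)
  have Nyx: "connection y x = (1/2) *\<^sub>R (adT x y + adT y x) + (1/2) *\<^sub>R br x y"
    using anti[of y x] by (simp add: connection_def scaleR_right_distrib)
  have Nxy: "connection x y = (1/2) *\<^sub>R (adT x y + adT y x) - (1/2) *\<^sub>R br x y"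
    by (simp add: connection_def scaleR_right_distrib)
  have "ip (connection y x) (connection x y) = 1/4 * ip (adT x y + adT y x) (adT x y + adT y x) - 1/4 * ip (br x y) (br x y)"
    unfolding Nyx Nxy
    by (simp add: ip_linear sym[of "br x y" "adT x y"] sym[of "br x y" "adT y x"] algebra_simps)
  then have 2: "ip (connection y (connection x y)) x = - 1/4 * ip (adT x y + adT y x) (adT x y + adT y x) + 1/4 * ip (br x y) (br x y)"
    using ip_connection_skew[of y "connection x y" x] by simp
  have "ip (connection (br x y) y) x = (ip y (br (br x y) x) + ip (br x y) (br y x) - ip (br (br x y) y) x) / 2"
    by (rule ip_connection)
  also have "br (br x y) x = - br x (br x y)" by (rule anti)
  also have "br (br x y) y = - br y (br x y)" by (rule anti)
  also have "br y x = - br x y" by (rule anti)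
  also have "(ip y (- br x (br x y)) + ip (br x y) (- br x y) - ip (- br y (br x y)) x) / 2
    = (- ip (adT x y) (br x y) - ip (br x y) (br x y) + ip (adT y x) (br x y)) / 2"
    by (simp add: ip_linear adT sym[of "br y (br x y)" x])
  finally have 3: "ip (connection (br x y) y) x
    = (- ip (adT x y) (br x y) - ip (br x y) (br x y) + ip (adT y x) (br x y)) / 2" .
  show ?thesis
    by (simp add: ip_linear 1 2 3 sec_num_def sym[of "adT y y" "adT x x"] field_simps)
qed

end

lemma velocity_const: "separating D \<Longrightarrow> velocity D (\<lambda>_. c) t = 0"
  by (rule velocity_eqI[OF _ has_velocity_const])

lemma ip_curvature:
  fixes G :: "('g, 'e::real_vector) lie_data"
  assumes "inner_product_ad ip (ad G)" and D: "separating (functionals G)"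
    and fb: "field_bracket G (\<lambda>_. X) (\<lambda>_. Y) \<one>\<^bsub>G\<^esub> = - ad G X Y"
  shows "ip (curvature G ip X Y Y) X = inner_product_ad.sec_num ip (ad G) X Y"
proof -
  interpret inner_product_ad ip "ad G" by (rule assms(1))
  have dir: "directional G U (\<lambda>_. W) x = 0" for U W x
    by (simp add: directional_def velocity_const[OF D])
  have nab: "nabla G ip U (\<lambda>_. W) x = connection (U x) W" for U W x
    by (simp add: nabla_def dir connection_def)
  \<comment> \<open>For constant \<open>U\<close> the derivative of a constant function is again
    constant, so the directional term vanishes in the nested derivatives too.\<close>
  have nab': "nabla G ip U (\<lambda>_. W) = (\<lambda>x. connection (U x) W)" for U W
    by (rule ext) (rule nab)
  have "connection (- ad G X Y) Y = - connection (ad G X Y) Y"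
    by (rule ip_eqI[OF bil pos]) (simp_all add: ip_connection ip_linear br_minus_left field_simps)
  then have "curvature G ip X Y Y = connection X (connection Y Y) - connection Y (connection X Y) + connection (ad G X Y) Y"
    by (simp add: curvature_def curvature_field_def nab nab' fb)
  then show ?thesis by (simp add: sec_num_eq)
qed

section \<open>The Lie algebra of a semidirect product\<close>

lemma has_velocity_pair:
  assumes "has_velocity D c v t" "has_velocity D' d w t"
  shows "has_velocity (prod_functionals D D') (\<lambda>s. (c s, d s)) (v, w) t"
  unfolding has_velocity_def
proof
  fix m assume "m \<in> prod_functionals D D'"
  then obtain l k where m: "m = (\<lambda>(x, y). l x + k y)" "l \<in> D" "k \<in> D'" by (auto simp: prod_functionals_def)
  then show "((\<lambda>s. m (c s, d s)) has_real_derivative m (v, w)) (at t)"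
    using assms by (auto simp: has_velocity_def intro!: DERIV_add)
qed

text \<open>This gives uniqueness of velocities in the product; their existence is obtained
  componentwise from the two factors.\<close>

lemma separating_prod_functionals:
  assumes "convenient D" "convenient D'"
  shows "separating (prod_functionals D D')"
  unfolding separating_def
proof (intro conjI ballI allI impI)
  fix m assume "m \<in> prod_functionals D D'"
  then obtain l k where m: "m = (\<lambda>(x, y). l x + k y)" "l \<in> D" "k \<in> D'" by (auto simp: prod_functionals_def)
  have "linear l" "linear k" using m assms convenient_linear by blast+
  then show "linear m" unfolding m(1) by (intro linearI) (auto simp: linear_add linear_scale algebra_simps)
next
  fix z assume z: "\<forall>m\<in>prod_functionals D D'. m z = 0"
  obtain x y where xy: "z = (x, y)" by (cases z)
  have "l x = 0" if "l \<in> D" for l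
  proof -
    have "(\<lambda>(x, y). l x + 0) \<in> prod_functionals D D'" unfolding prod_functionals_def
      using that zero_functional_mem[OF assms(2)] by (intro CollectI exI[of _ l] exI[of _ "\<lambda>_. 0"]) simp
    then show ?thesis using z xy by auto
  qed
  moreover have "k y = 0" if "k \<in> D'" for k
  proof -
    have "(\<lambda>(x, y). 0 + k y) \<in> prod_functionals D D'" unfolding prod_functionals_def
      using that zero_functional_mem[OF assms(1)] by (intro CollectI exI[of _ "\<lambda>_. 0"] exI[of _ k]) simp
    then show ?thesis using z xy by auto
  qed
  ultimately have "x = 0" "y = 0"
    using assms convenient_imp_separating unfolding separating_def by blast+
  then show "z = 0" by (simp add: xy zero_prod_def)
qed

context lie_action_pair
begin

lemma functionals_K: "DK = prod_functionals DG DH"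
  by (simp add: functionals_def semidirect_def prod_manifold_def)

lemma sep_K: "separating DK"
  unfolding functionals_K by (rule separating_prod_functionals[OF G.convenient_G H.convenient_G])

lemma velocity_pair_K:
  "has_velocity DG c v t \<Longrightarrow> has_velocity DH d w t \<Longrightarrow> velocity DK (\<lambda>s. (c s, d s)) t = (v, w)"
  by (rule velocity_eqI[OF sep_K]) (simp add: functionals_K has_velocity_pair)

lemma coord_K: "coord K (g, x) = (coord G g, coord H x)"
  by (simp add: coord_def semidirect_def)

lemma mult_K: "(g, x) \<otimes>\<^bsub>K\<^esub> (g', x') = (g \<otimes>\<^bsub>G\<^esub> g', x \<otimes>\<^bsub>H\<^esub> B g x')"
  by (simp add: semidirect_def)

lemma param_K:
  assumes "G.valid X" "H.valid Y"
  shows "param K (X, Y) = (param G X, param H Y)"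
proof -
  have one: "\<one>\<^bsub>K\<^esub> = (\<one>\<^bsub>G\<^esub>, \<one>\<^bsub>H\<^esub>)" by (simp add: semidirect_def)
  have dom: "fst (id_chart K) = G.chart_dom \<times> H.chart_dom"
    by (simp add: semidirect_def G.chart_dom_def H.chart_dom_def)
  have "inj_on (coord K) (G.chart_dom \<times> H.chart_dom)"
    using G.inj_coord H.inj_coord by (auto simp: inj_on_def coord_K)
  then show ?thesis unfolding param_def[of K] dom
    by (rule inv_into_f_eq)
       (use assms in \<open>auto simp: one coord_K G.param_mem H.param_mem G.coord_param H.coord_param\<close>)
qed

text \<open>The \<open>H\<close>-component of the product of the points with coordinates
  \<open>s(X, Y)\<close> and \<open>t(X', Y')\<close>. There is no \<open>X'\<close>, since only the
  left factor acts.\<close>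

definition sd_coord :: "'e \<Rightarrow> 'f \<Rightarrow> 'f \<Rightarrow> real \<Rightarrow> real \<Rightarrow> 'f" where
  "sd_coord X Y Y' s t = coord H (param H (s *\<^sub>R Y) \<otimes>\<^bsub>H\<^esub> B (param G (s *\<^sub>R X)) (param H (t *\<^sub>R Y')))"

definition sd_dom :: "'e \<Rightarrow> 'f \<Rightarrow> 'f \<Rightarrow> (real \<times> real) set" where
  "sd_dom X Y Y' = {(s, t). H.valid (s *\<^sub>R Y) \<and> G.valid (s *\<^sub>R X) \<and> H.valid (t *\<^sub>R Y') \<and>
     param H (s *\<^sub>R Y) \<otimes>\<^bsub>H\<^esub> B (param G (s *\<^sub>R X)) (param H (t *\<^sub>R Y')) \<in> H.chart_dom}"

lemma smooth_sd_coord: "smooth_family DH (sd_dom X Y Y') (sd_coord X Y Y')"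
proof -
  have dom: "sd_dom X Y Y' = ({(s, t). H.valid (s *\<^sub>R Y)} \<inter> ({(s, t). G.valid (s *\<^sub>R X)} \<inter> {(s, t). H.valid (t *\<^sub>R Y')})) \<inter>
      {(s, t). param H (s *\<^sub>R Y) \<otimes>\<^bsub>H\<^esub> B (param G (s *\<^sub>R X)) (param H (t *\<^sub>R Y')) \<in> H.chart_dom}"
    by (auto simp: sd_dom_def)
  show ?thesis unfolding dom sd_coord_def
    by (intro H.smooth_family_coord H.smooth_points_mult smooth_points_act H.smooth_points_param
        G.smooth_points_param H.smooth_curve_scaled G.smooth_curve_scaled)
qed

lemma sd_dom_0:
  "(s, 0) \<in> sd_dom X Y Y' \<longleftrightarrow> G.valid (s *\<^sub>R X) \<and> H.valid (s *\<^sub>R Y)"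
  "(0, s) \<in> sd_dom X Y Y' \<longleftrightarrow> H.valid (s *\<^sub>R Y')"
  by (auto simp: sd_dom_def G.valid_0 H.valid_0 G.param_0 H.param_0 B_one B_id G.param_carrier H.param_carrier H.param_mem)

text \<open>By the symmetry of mixed derivatives, the derivative in \<open>s\<close> can be taken first; then the
  chain rule separates the two factors.\<close>

lemma mixed_sd_coord:
  "mixed DH (sd_coord X Y Y') = mixed DH (H.mult_coord Y Y') + lie_action G H B X Y'"
proof -
  have line: "smooth_curve_on DG UNIV (\<lambda>s. s *\<^sub>R X)" by (rule G.smooth_curve_scaled[OF smooth_id[OF open_UNIV]])
  have inner: "velocity DH (\<lambda>s. sd_coord X Y Y' s t) 0
      = velocity DH (\<lambda>s. H.mult_coord Y Y' s t) 0 + velocity DH (\<lambda>s. act_coord (\<lambda>s. s *\<^sub>R X) Y' s t) 0"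
    if t: "H.valid (t *\<^sub>R Y')" for t
  proof -
    \<comment> \<open>The parameter \<open>s\<close> enters both through the left factor in
      \<open>H\<close> and through the acting element of \<open>G\<close>. \<open>F\<close> makes
      these two occurrences independent; its diagonal is the original function.\<close>
    define F where "F s1 s2 = coord H (param H (s1 *\<^sub>R Y) \<otimes>\<^bsub>H\<^esub> B (param G (s2 *\<^sub>R X)) (param H (t *\<^sub>R Y')))" for s1 s2
    define Q where "Q s1 s2 = param H (s1 *\<^sub>R Y) \<otimes>\<^bsub>H\<^esub> B (param G (s2 *\<^sub>R X)) (param H (t *\<^sub>R Y'))" for s1 s2
    define W where "W = ({(s1, s2). H.valid (s1 *\<^sub>R Y)} \<inter> ({(s1, s2). G.valid (s2 *\<^sub>R X)} \<inter> UNIV)) \<inter>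
      {(s1, s2). Q s1 s2 \<in> H.chart_dom}"
    have F: "smooth_family DH W F"
      unfolding F_def W_def Q_def
      by (intro H.smooth_family_coord H.smooth_points_mult smooth_points_act H.smooth_points_param
          G.smooth_points_param H.smooth_curve_scaled G.smooth_curve_scaled H.smooth_points_const H.param_carrier t)
    have W: "(0, 0) \<in> W"
      using t by (simp add: W_def Q_def G.valid_0 H.valid_0 G.param_0 H.param_0 B_id H.param_carrier H.param_mem)
    have "velocity DH (\<lambda>s. F s s) 0 = velocity DH (\<lambda>s. F s 0) 0 + velocity DH (F 0) 0"
      by (rule smooth_family_chain_rule[OF H.convenient_G F W])
    moreover have "F s 0 = H.mult_coord Y Y' s t" for s
      using t by (simp add: F_def H.mult_coord_def G.param_0 B_id H.param_carrier)
    moreover have "velocity DH (F 0) 0 = velocity DH (\<lambda>s. act_coord (\<lambda>s. s *\<^sub>R X) Y' s t) 0"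
      by (rule velocity_cong[OF G.open_valid_line[of X]])
         (use t in \<open>auto simp: F_def act_coord_def G.valid_0 H.param_0 B_closed G.param_carrier H.param_carrier\<close>)
    ultimately show ?thesis by (simp add: F_def sd_coord_def)
  qed
  have dom: "(0, 0) \<in> sd_dom X Y Y'" "(0, 0) \<in> H.mult_dom Y Y'" "(0, 0) \<in> act_dom (\<lambda>s. s *\<^sub>R X) Y'"
    by (simp_all add: sd_dom_0 H.mult_dom_0 act_dom_0 G.valid_0 H.valid_0)
  note sw1 = mixed_swap[OF H.convenient_G H.smooth_mult_coord dom(2)]
    and sw2 = mixed_swap[OF H.convenient_G smooth_act_coord[OF line] dom(3)]
  have "has_velocity DH (\<lambda>t. velocity DH (\<lambda>s. H.mult_coord Y Y' s t) 0) (mixed DH (H.mult_coord Y Y')) 0"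
    using has_velocity_mixed[OF H.convenient_G smooth_family_swap[OF H.smooth_mult_coord[of Y Y']]] dom(2) sw1 by simp
  moreover have "has_velocity DH (\<lambda>t. velocity DH (\<lambda>s. act_coord (\<lambda>s. s *\<^sub>R X) Y' s t) 0)
      (mixed DH (act_coord (\<lambda>s. s *\<^sub>R X) Y')) 0"
    using has_velocity_mixed[OF H.convenient_G smooth_family_swap[OF smooth_act_coord[OF line, of Y']]] dom(3) sw2 by simp
  ultimately have "has_velocity DH (\<lambda>t. velocity DH (\<lambda>s. H.mult_coord Y Y' s t) 0 + velocity DH (\<lambda>s. act_coord (\<lambda>s. s *\<^sub>R X) Y' s t) 0)
      (mixed DH (H.mult_coord Y Y') + mixed DH (act_coord (\<lambda>s. s *\<^sub>R X) Y')) 0"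
    by (rule has_velocity_add[OF H.sep_G])
  then have "has_velocity DH (\<lambda>t. velocity DH (\<lambda>s. sd_coord X Y Y' s t) 0)
      (mixed DH (H.mult_coord Y Y') + mixed DH (act_coord (\<lambda>s. s *\<^sub>R X) Y')) 0"
    by (subst has_velocity_cong[OF H.open_valid_line[of Y']]) (simp_all add: H.valid_0 inner)
  from velocity_eqI[OF H.sep_G this] mixed_swap[OF H.convenient_G smooth_sd_coord dom(1)]
  show ?thesis by (simp add: mixed_def[of _ "\<lambda>s t. sd_coord X Y Y' t s"] lie_action_eq_mixed)
qed

lemma open_valid_K: "open {s. G.valid (s *\<^sub>R X) \<and> H.valid (s *\<^sub>R Y)}"
  using open_Int[OF G.open_valid_line[of X] H.open_valid_line[of Y]] by (simp add: Int_def)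

lemma velocity_K_line:
  assumes "\<And>t. G.valid (t *\<^sub>R X) \<Longrightarrow> H.valid (t *\<^sub>R Y) \<Longrightarrow> c t = (param G (t *\<^sub>R X), param H (t *\<^sub>R Y))"
  shows "velocity DK (\<lambda>t. coord K (c t)) 0 = (X, Y)"
proof -
  have "velocity DK (\<lambda>t. coord K (c t)) 0
      = velocity DK (\<lambda>t. (coord G \<one>\<^bsub>G\<^esub> + t *\<^sub>R X, coord H \<one>\<^bsub>H\<^esub> + t *\<^sub>R Y)) 0"
    by (rule velocity_cong[OF open_valid_K[of X Y]])
       (auto simp: G.valid_0 H.valid_0 assms coord_K G.coord_param H.coord_param)
  also have "\<dots> = (X, Y)"
    by (intro velocity_pair_K has_velocity_scale_line G.sep_G H.sep_G)
  finally show ?thesis .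
qed

lemma param_K_0: "param K 0 = (\<one>\<^bsub>G\<^esub>, \<one>\<^bsub>H\<^esub>)"
  using param_K[OF G.valid_0 H.valid_0] by (simp add: G.param_0 H.param_0 zero_prod_def)

lemma left_field_K_0: "left_field K (X, Y) 0 = (X, Y)"
  unfolding left_field_def
  by (rule velocity_K_line) (simp add: param_K_0 param_K mult_K B_id G.param_carrier H.param_carrier)

lemma right_field_K_0: "right_field K (\<lambda>_. (X, Y)) x 0 = (X, Y)"
  unfolding right_field_def
  by (rule velocity_K_line) (simp add: param_K_0 param_K mult_K B_one G.param_carrier H.param_carrier)

lemma mult_coord_K:
  assumes "G.valid (s *\<^sub>R X)" "H.valid (s *\<^sub>R Y)" "G.valid (t *\<^sub>R X')" "H.valid (t *\<^sub>R Y')"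
  shows "coord K (param K (s *\<^sub>R (X, Y)) \<otimes>\<^bsub>K\<^esub> param K (t *\<^sub>R (X', Y')))
    = (G.mult_coord X X' s t, sd_coord X Y Y' s t)"
  using assms by (simp add: param_K mult_K coord_K G.mult_coord_def sd_coord_def)

lemma left_field_K_line:
  assumes s: "G.valid (s *\<^sub>R X)" "H.valid (s *\<^sub>R Y)"
  shows "left_field K (X', Y') (s *\<^sub>R (X, Y))
    = (velocity DG (G.mult_coord X X' s) 0, velocity DH (sd_coord X Y Y' s) 0)"
proof -
  have "left_field K (X', Y') (s *\<^sub>R (X, Y))
      = velocity DK (\<lambda>t. (G.mult_coord X X' s t, sd_coord X Y Y' s t)) 0"
    unfolding left_field_def
    by (rule velocity_cong[OF open_valid_K[of X' Y']])
       (auto simp: G.valid_0 H.valid_0 mult_coord_K[OF s] simp del: scaleR_Pair)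
  also have "\<dots> = (velocity DG (G.mult_coord X X' s) 0, velocity DH (sd_coord X Y Y' s) 0)"
    using s
    by (intro velocity_pair_K
        convenient_has_velocity[OF G.convenient_G smooth_family_slice(1,2)[OF G.convenient_G G.smooth_mult_coord]]
        convenient_has_velocity[OF H.convenient_G smooth_family_slice(1,2)[OF H.convenient_G smooth_sd_coord]])
       (simp_all add: G.mult_dom_0 sd_dom_0)
  finally show ?thesis .
qed

lemma right_field_K_line:
  assumes t: "G.valid (t *\<^sub>R X')" "H.valid (t *\<^sub>R Y')"
  shows "right_field K (\<lambda>_. (X, Y)) x (t *\<^sub>R (X', Y'))
    = (velocity DG (\<lambda>s. G.mult_coord X X' s t) 0, velocity DH (\<lambda>s. sd_coord X Y Y' s t) 0)"
proof -
  have "right_field K (\<lambda>_. (X, Y)) x (t *\<^sub>R (X', Y'))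
      = velocity DK (\<lambda>s. (G.mult_coord X X' s t, sd_coord X Y Y' s t)) 0"
    unfolding right_field_def
    by (rule velocity_cong[OF open_valid_K[of X Y]])
       (auto simp: G.valid_0 H.valid_0 mult_coord_K[OF _ _ t] simp del: scaleR_Pair)
  also have "\<dots> = (velocity DG (\<lambda>s. G.mult_coord X X' s t) 0, velocity DH (\<lambda>s. sd_coord X Y Y' s t) 0)"
    using t
    by (intro velocity_pair_K
        convenient_has_velocity[OF G.convenient_G smooth_family_slice(3,4)[OF G.convenient_G G.smooth_mult_coord]]
        convenient_has_velocity[OF H.convenient_G smooth_family_slice(3,4)[OF H.convenient_G smooth_sd_coord]])
       (simp_all add: G.mult_dom_0 sd_dom_0)
  finally show ?thesis .
qed

lemma velocity_left_field_K:
  "velocity DK (\<lambda>s. left_field K (X', Y') (s *\<^sub>R (X, Y))) 0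
    = (mixed DG (G.mult_coord X X'), mixed DH (sd_coord X Y Y'))"
proof -
  have "velocity DK (\<lambda>s. left_field K (X', Y') (s *\<^sub>R (X, Y))) 0
      = velocity DK (\<lambda>s. (velocity DG (G.mult_coord X X' s) 0, velocity DH (sd_coord X Y Y' s) 0)) 0"
    by (rule velocity_cong[OF open_valid_K[of X Y]])
       (auto simp: G.valid_0 H.valid_0 left_field_K_line simp del: scaleR_Pair)
  also have "\<dots> = (mixed DG (G.mult_coord X X'), mixed DH (sd_coord X Y Y'))"
    by (intro velocity_pair_K
        has_velocity_mixed[OF G.convenient_G G.smooth_mult_coord] has_velocity_mixed[OF H.convenient_G smooth_sd_coord])
       (simp_all add: G.mult_dom_0 sd_dom_0 G.valid_0 H.valid_0)
  finally show ?thesis .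
qed

lemma velocity_right_field_K:
  "velocity DK (\<lambda>t. right_field K (\<lambda>_. (X, Y)) x (t *\<^sub>R (X', Y'))) 0
    = (mixed DG (G.mult_coord X X'), mixed DH (sd_coord X Y Y'))"
proof -
  have dom: "(0, 0) \<in> G.mult_dom X X'" "(0, 0) \<in> sd_dom X Y Y'"
    by (simp_all add: G.mult_dom_0 sd_dom_0 G.valid_0 H.valid_0)
  have "velocity DK (\<lambda>t. right_field K (\<lambda>_. (X, Y)) x (t *\<^sub>R (X', Y'))) 0
      = velocity DK (\<lambda>t. (velocity DG (\<lambda>s. G.mult_coord X X' s t) 0, velocity DH (\<lambda>s. sd_coord X Y Y' s t) 0)) 0"
    by (rule velocity_cong[OF open_valid_K[of X' Y']])
       (auto simp: G.valid_0 H.valid_0 right_field_K_line simp del: scaleR_Pair)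
  also have "\<dots> = (mixed DG (\<lambda>t s. G.mult_coord X X' s t), mixed DH (\<lambda>t s. sd_coord X Y Y' s t))"
    by (intro velocity_pair_K
        has_velocity_mixed[OF G.convenient_G smooth_family_swap[OF G.smooth_mult_coord]]
        has_velocity_mixed[OF H.convenient_G smooth_family_swap[OF smooth_sd_coord]])
       (simp_all add: dom)
  also have "\<dots> = (mixed DG (G.mult_coord X X'), mixed DH (sd_coord X Y Y'))"
    using mixed_swap[OF G.convenient_G G.smooth_mult_coord dom(1)] mixed_swap[OF H.convenient_G smooth_sd_coord dom(2)]
    by simp
  finally show ?thesis .
qed

theorem ad_K:
  "ad K (X, Y) (X', Y') = (ad G X X', ad H Y Y' + lie_action G H B X Y' - lie_action G H B X' Y)"
  by (simp add: ad_def[of K] vf_bracket_def left_field_K_0 velocity_left_field_K G.ad_eq_mixed H.ad_eq_mixed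
      mixed_sd_coord del: scaleR_Pair)

text \<open>The sign is that of the factors. It follows componentwise, as the mixed derivatives of
  both coordinate functions are symmetric.\<close>

theorem field_bracket_K: "field_bracket K (\<lambda>_. (X, Y)) (\<lambda>_. (X', Y')) x = - ad K (X, Y) (X', Y')"
  by (simp add: field_bracket_def vf_bracket_def right_field_K_0 velocity_right_field_K ad_K G.ad_eq_mixed H.ad_eq_mixed
      mixed_sd_coord del: scaleR_Pair)

end

text \<open>Strict Cauchy-Schwarz: the component of \<open>u\<close> orthogonal to \<open>v\<close>
  is nonzero, and its squared length times that of \<open>v\<close> is the Gram determinant. This is
  the denominator of the sectional curvature.\<close>

lemma independent_imp_gram_pos:
  fixes ip :: "'e::real_vector \<Rightarrow> 'e \<Rightarrow> real"
  assumes bil: "bilinear ip" and sym: "\<And>x y. ip x y = ip y x" and pos: "\<And>x. x \<noteq> 0 \<Longrightarrow> ip x x > 0"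
    and ind: "independent {u, v}" "u \<noteq> v"
  shows "ip u u * ip v v - (ip u v)\<^sup>2 > 0"
proof -
  have "v \<noteq> 0" using ind(1) dependent_zero[of "{u, v}"] by auto
  then have v: "ip v v > 0" by (rule pos)
  define a where "a = ip u v / ip v v"
  have "u \<notin> span {v}" using ind by (simp add: independent_insert)
  then have "u - a *\<^sub>R v \<noteq> 0" by (metis eq_iff_diff_eq_0 insertI1 span_base span_scale)
  then have "ip (u - a *\<^sub>R v) (u - a *\<^sub>R v) > 0" by (rule pos)
  moreover have "ip (u - a *\<^sub>R v) (u - a *\<^sub>R v) = ip u u - 2 * a * ip u v + a * a * ip v v"
    by (simp add: bilinear_lsub[OF bil] bilinear_rsub[OF bil] bilinear_lmul[OF bil] bilinear_rmul[OF bil]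
        sym[of v u] algebra_simps)
  moreover have "a * ip v v = ip u v" using v by (simp add: a_def)
  ultimately have "0 < (ip u u - a * ip u v) * ip v v" using v by (simp add: algebra_simps)
  also have "\<dots> = ip u u * ip v v - (ip u v)\<^sup>2"
    using \<open>a * ip v v = ip u v\<close> by (simp add: power2_eq_square algebra_simps)
  finally show ?thesis .
qed

text \<open>The bilinear algebra of the final expansion. Here \<open>aij\<close>, \<open>pij\<close>, \<open>qij\<close> and \<open>hij\<close> stand for
  \<open>ad(Xi)\<^sup>T Xj\<close>, \<open>ad(Yi)\<^sup>T Yj\<close>, \<open>b(Xi)\<^sup>T Yj\<close> and \<open>h(Yi, Yj)\<close>, further \<open>c = ad(X1) X2\<close>,
  \<open>e = ad(Y1) Y2\<close> and \<open>dij = b(Xi) Yj\<close>.\<close>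

lemma semidirect_expansion:
  fixes ipG :: "'e::real_vector \<Rightarrow> 'e \<Rightarrow> real" and ipH :: "'f::real_vector \<Rightarrow> 'f \<Rightarrow> real"
  assumes G: "bilinear ipG" "\<And>x y. ipG x y = ipG y x" and H: "bilinear ipH" "\<And>x y. ipH x y = ipH y x"
    and h12: "ipG h12 c = ipH q12 d21 - ipH q22 d11" and h21: "ipG h21 c = ipH q11 d22 - ipH q21 d12"
  shows
    "1/4 * (ipG (a12 - h12 + (a21 - h21)) (a12 - h12 + (a21 - h21)) + ipH (p12 + q12 + (p21 + q21)) (p12 + q12 + (p21 + q21)))
     - 3/4 * (ipG c c + ipH (e + d12 - d21) (e + d12 - d21))
     - (ipG (a11 - h11) (a22 - h22) + ipH (p11 + q11) (p22 + q22))
     - 1/2 * (ipG (a12 - h12 - (a21 - h21)) c + ipH (p12 + q12 - (p21 + q21)) (e + d12 - d21))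
   = (1/4 * ipG (a12 + a21) (a12 + a21) - 3/4 * ipG c c - ipG a11 a22 - 1/2 * ipG (a12 - a21) c)
     + (1/4 * ipH (p12 + p21) (p12 + p21) - 3/4 * ipH e e - ipH p11 p22 - 1/2 * ipH (p12 - p21) e)
     + 1/4 * ipG (h12 + h21) (h12 + h21) - ipG h11 h22 - 1/2 * ipG (h12 + h21) (a12 + a21)
     + ipG h11 a22 + ipG h22 a11
     + 1/4 * ipH (q12 + q21) (q12 + q21) - 3/4 * ipH (d12 - d21) (d12 - d21) - ipH q11 q22
     - 1/2 * ipH q11 d22 - 1/2 * ipH q22 d11
     + ipH q12 d21 + ipH q21 d12 - 1/2 * ipH q12 d12 - 1/2 * ipH q21 d21
     - ipH p11 q22 - ipH p22 q11
     + 1/2 * ipH p12 (q12 + q21 - d12 + d21) + 1/2 * ipH p21 (q12 + q21 - d21 + d12)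
     - 1/2 * ipH e (q12 - q21 + 3 *\<^sub>R d12 - 3 *\<^sub>R d21)"
proof -
  note lin = bilinear_ladd[OF G(1)] bilinear_radd[OF G(1)] bilinear_lsub[OF G(1)] bilinear_rsub[OF G(1)]
    bilinear_ladd[OF H(1)] bilinear_radd[OF H(1)] bilinear_lsub[OF H(1)] bilinear_rsub[OF H(1)] bilinear_rmul[OF H(1)]
  have symG: "ipG h12 a12 = ipG a12 h12" "ipG h12 a21 = ipG a21 h12" "ipG h21 a12 = ipG a12 h21" "ipG h21 a21 = ipG a21 h21"
    "ipG a21 a12 = ipG a12 a21" "ipG h21 h12 = ipG h12 h21" "ipG h11 a22 = ipG a22 h11" "ipG h22 a11 = ipG a11 h22"
    by (rule G(2))+
  have symH: "ipH q12 p12 = ipH p12 q12" "ipH q12 p21 = ipH p21 q12" "ipH q21 p12 = ipH p12 q21" "ipH q21 p21 = ipH p21 q21"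
    "ipH p21 p12 = ipH p12 p21" "ipH q21 q12 = ipH q12 q21" "ipH q11 p22 = ipH p22 q11"
    "ipH d12 e = ipH e d12" "ipH d21 e = ipH e d21" "ipH d21 d12 = ipH d12 d21" "ipH q12 e = ipH e q12" "ipH q21 e = ipH e q21"
    by (rule H(2))+
  show ?thesis
    by (simp add: lin symG symH h12 h21 field_simps)
qed

lemma inner_product_ad_lie_group:
  fixes G :: "('g, 'e::real_vector) lie_data"
  assumes "bounded_inner_product (functionals G) ip" "\<And>X. has_transpose ip (ad G X)"
  shows "inner_product_ad ip (ad G)"
  using assms by unfold_locales (auto simp: bounded_inner_product_def ad_def vf_bracket_def)

theorem proposition2:
  fixes G :: "('g, 'e::real_vector) lie_data"
    and H :: "('h, 'f::real_vector) lie_data"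
    and ipG :: "'e \<Rightarrow> 'e \<Rightarrow> real"
    and ipH :: "'f \<Rightarrow> 'f \<Rightarrow> real"
    and B :: "'g \<Rightarrow> 'h \<Rightarrow> 'h"
    and h :: "'f \<Rightarrow> 'f \<Rightarrow> 'e"
    and X1 X2 :: 'e
    and Y1 Y2 :: 'f
  assumes "lie_group G"
    and "lie_group H"
    and "bounded_inner_product (functionals G) ipG"
    and "bounded_inner_product (functionals H) ipH"
    and "smooth_group_action G H B"
    and "\<And>X. has_transpose ipG (ad G X)"
    and "\<And>Y. has_transpose ipH (ad H Y)"
    and "\<And>X. has_transpose ipH (lie_action G H B X)"
    and "bilinear h"
    and "\<And>X Y Y'. ipH (lie_action G H B X Y) Y' = ipG (h Y Y') X"
  shows "let K = semidirect G H B;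
             ipK = prod_ip ipG ipH;
             adG\<^sub>T = (\<lambda>X. metric_transpose ipG (ad G X));
             adH = ad H;
             adH\<^sub>T = (\<lambda>Y. metric_transpose ipH (ad H Y));
             b = lie_action G H B;
             b\<^sub>T = (\<lambda>X. metric_transpose ipH (lie_action G H B X));
             R = ipK (curvature K ipK (X1, Y1) (X2, Y2) (X2, Y2)) (X1, Y1)
         in
           (independent {(X1, Y1), (X2, Y2)} \<and> (X1, Y1) \<noteq> (X2, Y2) \<longrightarrow>
              sgn (sectional_curvature K ipK (X1, Y1) (X2, Y2)) = sgn R) \<and>
           R = ipG (curvature G ipG X1 X2 X2) X1 + ipH (curvature H ipH Y1 Y2 Y2) Y1
             + 1/4 * ipG (h Y1 Y2 + h Y2 Y1) (h Y1 Y2 + h Y2 Y1)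
             - ipG (h Y1 Y1) (h Y2 Y2)
             - 1/2 * ipG (h Y1 Y2 + h Y2 Y1) (adG\<^sub>T X1 X2 + adG\<^sub>T X2 X1)
             + ipG (h Y1 Y1) (adG\<^sub>T X2 X2) + ipG (h Y2 Y2) (adG\<^sub>T X1 X1)
             + 1/4 * ipH (b\<^sub>T X1 Y2 + b\<^sub>T X2 Y1) (b\<^sub>T X1 Y2 + b\<^sub>T X2 Y1)
             - 3/4 * ipH (b X1 Y2 - b X2 Y1) (b X1 Y2 - b X2 Y1)
             - ipH (b\<^sub>T X1 Y1) (b\<^sub>T X2 Y2)
             - 1/2 * ipH (b\<^sub>T X1 Y1) (b X2 Y2) - 1/2 * ipH (b\<^sub>T X2 Y2) (b X1 Y1)
             + ipH (b\<^sub>T X1 Y2) (b X2 Y1) + ipH (b\<^sub>T X2 Y1) (b X1 Y2)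
             - 1/2 * ipH (b\<^sub>T X1 Y2) (b X1 Y2) - 1/2 * ipH (b\<^sub>T X2 Y1) (b X2 Y1)
             - ipH (adH\<^sub>T Y1 Y1) (b\<^sub>T X2 Y2) - ipH (adH\<^sub>T Y2 Y2) (b\<^sub>T X1 Y1)
             + 1/2 * ipH (adH\<^sub>T Y1 Y2) (b\<^sub>T X1 Y2 + b\<^sub>T X2 Y1 - b X1 Y2 + b X2 Y1)
             + 1/2 * ipH (adH\<^sub>T Y2 Y1) (b\<^sub>T X1 Y2 + b\<^sub>T X2 Y1 - b X2 Y1 + b X1 Y2)
             - 1/2 * ipH (adH Y1 Y2)
                 (b\<^sub>T X1 Y2 - b\<^sub>T X2 Y1 + 3 *\<^sub>R b X1 Y2 - 3 *\<^sub>R b X2 Y1)"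
proof -
  interpret lie_action_pair G H B
    using assms(1,2,5) by (simp add: lie_action_pair_def lie_action_pair_axioms_def lie_def)
  interpret IG: inner_product_ad ipG "ad G" by (rule inner_product_ad_lie_group[OF assms(3,6)])
  interpret IH: inner_product_ad ipH "ad H" by (rule inner_product_ad_lie_group[OF assms(4,7)])
  define b where "b = lie_action G H B"
  define bT where "bT X = metric_transpose ipH (b X)" for X
  define ipK where "ipK = prod_ip ipG ipH"
  have ipK: "ipK (X, Y) (X', Y') = ipG X X' + ipH Y Y'" for X Y X' Y' by (simp add: ipK_def prod_ip_def)
  have bT: "ipH (bT X Y) Y' = ipH Y (b X Y')" for X Y Y'
    unfolding bT_def b_def by (rule IH.has_transpose_eq[OF assms(8)])
  have hb: "ipG (h Y Y') X = ipH (b X Y) Y'" for X Y Y' using assms(10) by (simp add: b_def)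
  have adK: "ad K (X, Y) (X', Y') = (ad G X X', ad H Y Y' + b X Y' - b X' Y)" for X Y X' Y'
    unfolding b_def by (rule ad_K)
  \<comment> \<open>The term \<open>- b X' Y\<close> of the bracket depends on \<open>X'\<close>, so
    its pairing with \<open>C\<close> is carried by \<open>h\<close> into the
    \<open>G\<close>-component, with a minus sign.\<close>
  have adKT: "ipK (IG.adT X A - h Y C, IH.adT Y C + bT X C) Z = ipK (A, C) (ad K (X, Y) Z)" for X Y A C Z
  proof (cases Z)
    case (Pair X' Y')
    show ?thesis
      by (simp add: Pair adK ipK IG.ip_linear IH.ip_linear IG.adT IH.adT bT hb IH.sym[of "b X' Y" C])
  qed
  \<comment> \<open>The explicit transpose formula supplies the existence of transposes, so the
    general curvature computation applies to the semidirect product as well.\<close>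
  interpret IK: inner_product_ad ipK "ad K"
  proof
    show "bilinear ipK" unfolding bilinear_def
      by (auto intro!: linearI simp: ipK IG.ip_linear IH.ip_linear algebra_simps)
    show "ipK x y = ipK y x" for x y by (cases x; cases y) (simp add: ipK IG.sym IH.sym)
    show "ipK x x > 0" if "x \<noteq> 0" for x
    proof (cases x)
      case (Pair X Y)
      have "ipG X X \<ge> 0" "ipH Y Y \<ge> 0"
        using IG.pos[of X] IH.pos[of Y] bilinear_lzero[OF IG.bil, of 0] bilinear_lzero[OF IH.bil, of 0]
        by (cases "X = 0"; cases "Y = 0"; simp)+
      moreover have "X \<noteq> 0 \<or> Y \<noteq> 0" using that by (auto simp: Pair zero_prod_def)
      ultimately show ?thesis using IG.pos[of X] IH.pos[of Y] by (auto simp: Pair ipK add_pos_nonneg add_nonneg_pos)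
    qed
    show "has_transpose ipK (ad K x)" for x
    proof (cases x)
      case (Pair X Y)
      show ?thesis unfolding has_transpose_def
      proof
        fix a :: "'e \<times> 'f"
        obtain A C where a: "a = (A, C)" by (cases a)
        show "\<exists>z. \<forall>c. ipK z c = ipK a (ad K x c)"
          unfolding a Pair using adKT by blast
      qed
    qed
    show "ad K x y = - ad K y x" for x y by (simp add: ad_def vf_bracket_def)
  qed
  have adKT_eq: "IK.adT (X, Y) (A, C) = (IG.adT X A - h Y C, IH.adT Y C + bT X C)" for X Y A C
    by (rule IK.metric_transpose_eqI) (rule adKT)
  define R where "R = ipK (curvature K ipK (X1, Y1) (X2, Y2) (X2, Y2)) (X1, Y1)"
  have RK: "R = IK.sec_num (X1, Y1) (X2, Y2)"
    unfolding R_def by (rule ip_curvature[OF IK.inner_product_ad_axioms sep_K field_bracket_K])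
  have RG: "ipG (curvature G ipG X1 X2 X2) X1 = IG.sec_num X1 X2"
    by (rule ip_curvature[OF IG.inner_product_ad_axioms G.sep_G G.field_bracket_const])
  have RH: "ipH (curvature H ipH Y1 Y2 Y2) Y1 = IH.sec_num Y1 Y2"
    by (rule ip_curvature[OF IH.inner_product_ad_axioms H.sep_G H.field_bracket_const])
  \<comment> \<open>The homomorphism property trades the terms pairing \<open>h\<close> with the
    bracket of \<open>X1\<close> and \<open>X2\<close>, absent from the final formula, for products
    of \<open>b\<close> and its transposes.\<close>
  have b_ad: "b (ad G X1 X2) Y = b X1 (b X2 Y) - b X2 (b X1 Y)" for Y
    unfolding b_def by (rule lie_action_ad)
  have h12: "ipG (h Y1 Y2) (ad G X1 X2) = ipH (bT X1 Y2) (b X2 Y1) - ipH (bT X2 Y2) (b X1 Y1)"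
    by (simp add: hb b_ad IH.ip_linear bT IH.sym[of "b X1 (b X2 Y1)" Y2] IH.sym[of "b X2 (b X1 Y1)" Y2])
  have h21: "ipG (h Y2 Y1) (ad G X1 X2) = ipH (bT X1 Y1) (b X2 Y2) - ipH (bT X2 Y1) (b X1 Y2)"
    by (simp add: hb b_ad IH.ip_linear bT IH.sym[of "b X1 (b X2 Y2)" Y1] IH.sym[of "b X2 (b X1 Y2)" Y1])
  note expansion = semidirect_expansion[OF IG.bil IG.sym IH.bil IH.sym h12 h21,
      of "IG.adT X1 X2" "IG.adT X2 X1" "IH.adT Y1 Y2" "IH.adT Y2 Y1" "ad H Y1 Y2"
        "IG.adT X1 X1" "h Y1 Y1" "IG.adT X2 X2" "h Y2 Y2" "IH.adT Y1 Y1" "IH.adT Y2 Y2"]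
  note formula = RK[unfolded IK.sec_num_def adKT_eq adK add_Pair diff_Pair ipK expansion,
      folded IG.sec_num_def IH.sec_num_def, folded RG RH]
  have "sgn (sectional_curvature K ipK (X1, Y1) (X2, Y2)) = sgn R"
    if "independent {(X1, Y1), (X2, Y2)}" "(X1, Y1) \<noteq> (X2, Y2)"
    using independent_imp_gram_pos[OF IK.bil IK.sym IK.pos that]
    by (simp add: sectional_curvature_def R_def[symmetric] sgn_divide)
  with formula show ?thesis
    unfolding Let_def b_def[symmetric] bT_def[symmetric] ipK_def[symmetric] R_def[symmetric] by blast
qed

end
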